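(* Let $K_d=\prod_{j=1}^d[a_j,b_j]\subset\mathbb{R}^d$ and $u_0\in K_d$. Let $\tilde\rho$ be a quasi-metric on $\mathbb{R}^d$ for which there exist $0<\underline{H}\le\overline{H}\le1$ and $c_{2,1},c_{2,2}\in(0,\infty)$ with $c_{2,1}\|x-y\|^{\overline{H}}\le\tilde\rho(x,y)\le c_{2,2}\|x-y\|^{\underline{H}}$ for all $x,y\in\mathbb{R}^d$ with $\|x-y\|\le1$. Let $\alpha:K_d\to(0,2)$ belong to $\mathcal{H}_{\tilde\rho}(K_d,1,0)$. Set $a=\min_{K_d}\alpha$, $b=\max_{K_d}\alpha$, $K_1=[a,b]\subset(0,2)$, $K_{d+1}=[a,b]\times K_d$, and consider the quasi-metric on $\mathbb{R}\times\mathbb{R}^d$ defined by $\rho((\alpha,u),(\alpha',v))=|\alpha-\alpha'|+\tilde\rho(u,v)$. Let $(g_n)_{n\ge1}$ be a sequence of independent complex-valued symmetric sub-Gaussian random variables with parameter $1$, let $T_n$ be the $n$th arrival time of a Poisson process with intensity $1$, let $\nu$ be a $\sigma$-finite measure on $(\mathbb{R}^d,\mathcal{B}(\mathbb{R}^d))$, and let $(\xi_n)_{n\ge1}$ be a sequence of i.i.d. random variables with common law $\mu(\mathrm{d}\xi)=m(\xi)\nu(\mathrm{d}\xi)$ equivalent to $\nu$; the sequences $(g_n)$, $(T_n)$, $(\xi_n)$ are independent. For any $\alpha\in K_1$ let $f_\alpha:K_d\times\mathbb{R}^d\to\mathbb{C}$ be a deterministic function such that $\int_{\mathbb{R}^d}|f_\alpha(u,\xi)|^\alpha\nu(\mathrm{d}\xi)<+\infty$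 for all $u\in K_d$. Put $V_1(\alpha,u)=f_\alpha(u,\xi_1)m(\xi_1)^{-1/\alpha}$. Assume that for some $r>0$, $p>b/2$, $\beta\in(0,1]$ and $\eta\in\mathbb{R}$, $$\mathbb{E}\Bigg(\Bigg[\sup_{\substack{x,y\in K_{d+1}\\0<\|x-y\|\le r}}\frac{|V_1(x)-V_1(y)|}{\rho(x,y)^{\beta}|\log\rho(x,y)|^{\eta}}\Bigg]^{2p}\Bigg)<\infty,$$ and that $$\mathbb{E}\big(|V_1(\alpha(u_0),u_0)|^{2p}\big)=\int_{\mathbb{R}^d}|f_{\alpha(u_0)}(u_0,\xi)|^{2p}m(\xi)^{1-2p/\alpha(u_0)}\,\nu(\mathrm{d}\xi)<+\infty.$$ For $u\in K_d$ let $$\tilde S_{m,N}(u)=\sum_{n=1}^N T_n^{-1/\alpha(u)}f_{\alpha(u)}(u,\xi_n)m(\xi_n)^{-1/\alpha(u)}g_n,\qquad \tilde S_m(u)=\sum_{n=1}^{+\infty}T_n^{-1/\alpha(u)}f_{\alpha(u)}(u,\xi_n)m(\xi_n)^{-1/\alpha(u)}g_n.$$ 1. Then, almost surely, $(\tilde S_{m,N})_{N\in\mathbb{N}}$ converges uniformly on $K_d$ to $\tilde S_m$, and almost surely the limit $\tilde S_m$ belongs to $\mathcal{H}_{\tilde\rho}(K_d,\beta,\max(\eta,0)+1/2)$. 2. Moreover, for all $p'>0$ such that $1/p'\in(0,1/b-1/\min(2p,2))$, almost surely $$\sup_{N\in\mathbb{N}}N^{1/p'}\sup_{u\in K_d}|\tilde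 S_m(u)-\tilde S_{m,N}(u)|<+\infty.$$
   Context: $\|\cdot\|$ is the Euclidean norm. A complex-valued random variable $Z$ is sub-Gaussian with parameter $s\in[0,+\infty)$ if $\mathbb{E}(e^{\Re(\overline z Z)})\le e^{s^2|z|^2/2}$ for all $z\in\mathbb{C}$; $Z$ is symmetric if $Z$ and $-Z$ have the same law. "$\mu=m\nu$ equivalent to $\nu$" means $m(\xi)>0$ for $\nu$-almost every $\xi$. For each fixed $u$ the series defining $\tilde S_m(u)$ converges almost surely; $\tilde S_m(u)$ is the limit of $\tilde S_{m,N}(u)$ wherever it exists (and, say, $0$ elsewhere). A quasi-metric on $\mathbb{R}^k$ is a continuous function $\rho:\mathbb{R}^k\times\mathbb{R}^k\to[0,+\infty)$ such that $\rho(x,y)=0$ iff $x=y$, $\rho(x,y)=\rho(y,x)$, and for some constant $\kappa\ge1$, $\rho(x,z)\le\kappa(\rho(x,y)+\rho(y,z))$ for all $x,y,z$. A (complex-valued) function $f$ on a set $K$ belongs to $\mathcal{H}_\rho(K,\beta,\eta)$ if there exists $C\in(0,+\infty)$ such that $|f(x)-f(y)|\le C\rho(x,y)^\beta[\log(1+\rho(x,y)^{-1})]^\eta$ for all $x,y\in K$ (the right-hand side being $0$ when $x=y$). In particular $\alpha\in\mathcal{H}_{\tilde\rho}(K_d,1,0)$ means $|\alpha(u)-\alpha(v)|\le C\tilde\rho(u,v)$ on $K_d$. *)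

theory Defs
  imports "HOL-Probability.Probability"
begin

definition quasi_metric :: "('a::topological_space \<Rightarrow> 'a \<Rightarrow> real) \<Rightarrow> bool" where
  "quasi_metric \<rho> \<longleftrightarrow>
     continuous_on UNIV (\<lambda>(x, y). \<rho> x y) \<and>
     (\<forall>x y. 0 \<le> \<rho> x y) \<and>
     (\<forall>x y. \<rho> x y = 0 \<longleftrightarrow> x = y) \<and>
     (\<forall>x y. \<rho> x y = \<rho> y x) \<and>
     (\<exists>\<kappa>\<ge>1. \<forall>x y z. \<rho> x z \<le> \<kappa> * (\<rho> x y + \<rho> y z))"

text \<open>When \<open>\<rho> x y = 0\<close> the bound is \<open>0\<close>, because \<open>0 powr \<beta> = 0\<close>. When \<open>\<rho> x y > 0\<close>
  the logarithm is positive, so \<open>powr\<close> is the usual real power.\<close>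

definition holder_log :: "('a \<Rightarrow> 'a \<Rightarrow> real) \<Rightarrow> 'a set \<Rightarrow> real \<Rightarrow> real \<Rightarrow> ('a \<Rightarrow> 'b::real_normed_vector) set" where
  "holder_log \<rho> K \<beta> \<eta> =
     {f. \<exists>C>0. \<forall>x\<in>K. \<forall>y\<in>K.
        norm (f x - f y) \<le> C * \<rho> x y powr \<beta> * ln (1 + inverse (\<rho> x y)) powr \<eta>}"

text \<open>Real powers in \<open>[0, \<infinity>]\<close>, with \<open>x\<^sup>0 = 1\<close> for every \<open>x\<close> (unlike \<open>powr\<close>, where
  \<open>0 powr 0 = 0\<close>) and \<open>0\<close>, \<open>\<top>\<close> exchanged by negative exponents.\<close>

definition enn_powr :: "ennreal \<Rightarrow> real \<Rightarrow> ennreal" where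
  "enn_powr x a =
     (if a = 0 then 1
      else if x = 0 then (if 0 < a then 0 else \<top>)
      else if x = \<top> then (if 0 < a then \<top> else 0)
      else ennreal (enn2real x powr a))"

text \<open>The supremum of \<open>|F x - F y| / (\<rho>(x,y)\<^sup>\<beta> |log \<rho>(x,y)|\<^sup>\<eta>)\<close> over distinct points of \<open>K\<close> at
  distance at most \<open>r\<close>, in \<open>[0, \<infinity>]\<close>. At \<open>\<rho>(x,y) = 1\<close> the logarithm vanishes; the quotient
  is then read in \<open>[0, \<infinity>]\<close>, where \<open>c / 0 = \<top>\<close> for \<open>c > 0\<close>, \<open>0 / 0 = 0\<close> and \<open>c / \<top> = 0\<close>.\<close>

definition log_modulus ::
    "('a::real_normed_vector \<Rightarrow> 'a \<Rightarrow> real) \<Rightarrow> 'a set \<Rightarrow> real \<Rightarrow> real \<Rightarrow> real \<Rightarrow> ('a \<Rightarrow> complex) \<Rightarrow> ennreal" where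
  "log_modulus \<rho> K r \<beta> \<eta> F =
     (SUP (x, y) \<in> {(x, y). x \<in> K \<and> y \<in> K \<and> 0 < norm (x - y) \<and> norm (x - y) \<le> r}.
        ennreal (cmod (F x - F y)) /
          (ennreal (\<rho> x y powr \<beta>) * enn_powr (ennreal \<bar>ln (\<rho> x y)\<bar>) \<eta>))"

definition sub_gaussian :: "'w measure \<Rightarrow> ('w \<Rightarrow> complex) \<Rightarrow> real \<Rightarrow> bool" where
  "sub_gaussian M Z s \<longleftrightarrow>
     Z \<in> borel_measurable M \<and> 0 \<le> s \<and>
     (\<forall>z::complex. (\<integral>\<^sup>+ \<omega>. ennreal (exp (Re (cnj z * Z \<omega>))) \<partial>M)
        \<le> ennreal (exp (s\<^sup>2 * (cmod z)\<^sup>2 / 2)))"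

definition symmetric_rv :: "'w measure \<Rightarrow> ('w \<Rightarrow> complex) \<Rightarrow> bool" where
  "symmetric_rv M Z \<longleftrightarrow> Z \<in> borel_measurable M \<and> distr M borel Z = distr M borel (\<lambda>\<omega>. - Z \<omega>)"

definition poisson_process :: "'w measure \<Rightarrow> real \<Rightarrow> (real \<Rightarrow> 'w \<Rightarrow> nat) \<Rightarrow> bool" where
  "poisson_process M l X \<longleftrightarrow>
     (\<forall>t\<ge>0. X t \<in> measurable M (count_space UNIV)) \<and>
     (AE \<omega> in M. X 0 \<omega> = 0 \<and>
        (\<forall>s t. 0 \<le> s \<and> s \<le> t \<longrightarrow> X s \<omega> \<le> X t \<omega>) \<and>
        (\<forall>t\<ge>0. \<exists>e>0. \<forall>s\<in>{t..<t+e}. X s \<omega> = X t \<omega>)) \<and>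
     (\<forall>s t. 0 \<le> s \<and> s < t \<longrightarrow>
        distr M (count_space UNIV) (\<lambda>\<omega>. X t \<omega> - X s \<omega>) = measure_pmf (poisson_pmf (l * (t - s)))) \<and>
     (\<forall>t::nat \<Rightarrow> real. \<forall>n. 0 \<le> t 0 \<and> incseq t \<longrightarrow>
        prob_space.indep_vars M (\<lambda>_. count_space UNIV)
          (\<lambda>i \<omega>. X (t (Suc i)) \<omega> - X (t i) \<omega>) {..<n})"

definition arrival_time :: "(real \<Rightarrow> 'w \<Rightarrow> nat) \<Rightarrow> nat \<Rightarrow> 'w \<Rightarrow> real" where
  "arrival_time X n \<omega> = Inf {t. 0 \<le> t \<and> n \<le> X t \<omega>}"

definition sigma_seq :: "'w measure \<Rightarrow> (nat \<Rightarrow> 'w \<Rightarrow> 'a::topological_space) \<Rightarrow> 'w set set" where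
  "sigma_seq M X =
     sets (vimage_algebra (space M) (\<lambda>\<omega>. \<lambda>n\<in>{1..}. X n \<omega>) (PiM {1..} (\<lambda>_. borel)))"

text \<open>Mutual independence of three sequences with different value types, through the
  sigma-algebras they generate; the members of one sequence may be dependent.\<close>

definition indep_three_seqs ::
    "'w measure \<Rightarrow> (nat \<Rightarrow> 'w \<Rightarrow> 'a::topological_space) \<Rightarrow> (nat \<Rightarrow> 'w \<Rightarrow> 'b::topological_space) \<Rightarrow>
     (nat \<Rightarrow> 'w \<Rightarrow> 'c::topological_space) \<Rightarrow> bool" where
  "indep_three_seqs M X Y Z \<longleftrightarrow>
     prob_space.indep_sets M
       (\<lambda>i::nat. if i = 0 then sigma_seq M X else if i = 1 then sigma_seq M Y else sigma_seq M Z)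
       {0, 1, 2}"

text \<open>The field \<open>V\<close> as a function of the value \<open>z\<close> of \<open>\<xi>\<^sub>n\<close>: \<open>V_field f m (\<xi>\<^sub>n \<omega>) (a, u)\<close> is
  \<open>f\<^sub>a(u, \<xi>\<^sub>n) m(\<xi>\<^sub>n)\<^sup>-\<^sup>1\<^sup>/\<^sup>a\<close>. Its \<open>log_modulus\<close> is a supremum over uncountably many pairs, so an
  expectation of it needs its measurability in \<open>z\<close> (up to \<open>\<nu>\<close>-null sets) as a hypothesis:
  \<open>nn_integral\<close> of a non-measurable function is only a lower integral.\<close>

definition V_field ::
    "(real \<Rightarrow> 'a \<Rightarrow> 'b \<Rightarrow> complex) \<Rightarrow> ('b \<Rightarrow> real) \<Rightarrow> 'b \<Rightarrow> real \<times> 'a \<Rightarrow> complex" where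
  "V_field f m z = (\<lambda>(a, u). f a u z * complex_of_real (m z powr (- 1 / a)))"

definition S_partial ::
    "(real \<Rightarrow> 'a \<Rightarrow> 'b \<Rightarrow> complex) \<Rightarrow> ('b \<Rightarrow> real) \<Rightarrow> ('a \<Rightarrow> real) \<Rightarrow> (nat \<Rightarrow> 'w \<Rightarrow> real) \<Rightarrow>
     (nat \<Rightarrow> 'w \<Rightarrow> 'b) \<Rightarrow> (nat \<Rightarrow> 'w \<Rightarrow> complex) \<Rightarrow> nat \<Rightarrow> 'w \<Rightarrow> 'a \<Rightarrow> complex" where
  "S_partial f m \<alpha> T \<xi> g N \<omega> u =
     (\<Sum>n=1..N. complex_of_real (T n \<omega> powr (- 1 / \<alpha> u)) * f (\<alpha> u) u (\<xi> n \<omega>)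
        * complex_of_real (m (\<xi> n \<omega>) powr (- 1 / \<alpha> u)) * g n \<omega>)"

definition S_limit ::
    "(real \<Rightarrow> 'a \<Rightarrow> 'b \<Rightarrow> complex) \<Rightarrow> ('b \<Rightarrow> real) \<Rightarrow> ('a \<Rightarrow> real) \<Rightarrow> (nat \<Rightarrow> 'w \<Rightarrow> real) \<Rightarrow>
     (nat \<Rightarrow> 'w \<Rightarrow> 'b) \<Rightarrow> (nat \<Rightarrow> 'w \<Rightarrow> complex) \<Rightarrow> 'w \<Rightarrow> 'a \<Rightarrow> complex" where
  "S_limit f m \<alpha> T \<xi> g \<omega> u =
     (if convergent (\<lambda>N. S_partial f m \<alpha> T \<xi> g N \<omega> u)
      then lim (\<lambda>N. S_partial f m \<alpha> T \<xi> g N \<omega> u) else 0)"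

text \<open>The moment of \<open>V\<close> at a point, as an integral against \<open>\<nu>\<close>.\<close>

lemma nn_integral_V_field_powr:
  fixes X :: "'w \<Rightarrow> 'b::topological_space"
  assumes X: "X \<in> measurable M borel" "distr M borel X = density \<nu> (\<lambda>z. ennreal (m z))"
    and \<nu>: "sets \<nu> = sets borel"
    and m: "m \<in> borel_measurable borel" "AE z in \<nu>. 0 < m z"
    and f: "f a u \<in> borel_measurable borel"
  shows "(\<integral>\<^sup>+ \<omega>. ennreal (cmod (V_field f m (X \<omega>) (a, u)) powr q) \<partial>M)
       = (\<integral>\<^sup>+ z. ennreal (cmod (f a u z) powr q * m z powr (1 - q / a)) \<partial>\<nu>)"
proof -
  note [measurable] = X(1) m(1) f
  have [measurable_cong]: "sets \<nu> = sets borel" by (fact \<nu>)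
  have "(\<integral>\<^sup>+ \<omega>. ennreal (cmod (V_field f m (X \<omega>) (a, u)) powr q) \<partial>M)
      = (\<integral>\<^sup>+ z. ennreal (cmod (V_field f m z (a, u)) powr q) \<partial>distr M borel X)"
    by (subst nn_integral_distr) (auto simp: V_field_def)
  also have "\<dots> = (\<integral>\<^sup>+ z. ennreal (m z) * ennreal (cmod (V_field f m z (a, u)) powr q) \<partial>\<nu>)"
    unfolding X(2) by (subst nn_integral_density) (auto simp: V_field_def)
  also have "\<dots> = (\<integral>\<^sup>+ z. ennreal (cmod (f a u z) powr q * m z powr (1 - q / a)) \<partial>\<nu>)"
  proof (rule nn_integral_cong_AE, use m(2) in eventually_elim)
    case (elim z)
    have "m z * (m z powr (- 1 / a)) powr q = m z powr 1 * m z powr (- 1 / a * q)"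
      using elim by (simp add: powr_powr)
    also have "\<dots> = m z powr (1 - q / a)"
      using elim by (simp add: powr_add[symmetric] powr_diff powr_minus divide_inverse mult.commute)
    finally show ?case
      using elim
      by (simp add: V_field_def norm_mult powr_mult ennreal_mult'[symmetric] mult.left_commute)
  qed
  finally show ?thesis .
qed

end

theory Submission
  imports Defs
begin

text \<open>
  Multiply the \<open>n\<close>-th term of the series by \<open>n\<^sup>\<gamma>\<close> for some \<open>0 < \<gamma> < 1/b - 1/min (2p) 2\<close>. If the
  partial sums of this weighted series are almost surely bounded on \<open>K\<close>, and have increments
  bounded by \<open>B h(u,v)\<close> with \<open>h = \<rho>t\<^sup>\<beta> (log (1 + 1/\<rho>t))\<^sup>e\<close> and \<open>e = max \<eta> 0 + 1/2\<close>, uniformly in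
  the number of terms, then summation by parts gives everything: the remainder of the original series
  after \<open>N\<close> terms is at most \<open>2B N\<^sup>-\<^sup>\<gamma>\<close> uniformly on \<open>K\<close>, and the limit has increments at most
  \<open>2B h(u,v)\<close> (\<open>weighted_sums_bounded_imp_convergence\<close>). With \<open>\<gamma> = 1/p'\<close> this is the rate, and
  admissible \<open>\<gamma>\<close> exist because \<open>b < min (2p) 2\<close>.

  The bound on the weighted partial sums is obtained conditionally on the sequences \<open>T\<close> and \<open>\<xi>\<close>.
  Since \<open>g\<close> is independent of them, it is enough to fix a typical realisation of \<open>(T, \<xi>)\<close> and to
  prove the bound almost surely in \<open>g\<close> (\<open>AE_product_distr_freeze\<close>). Suprema over \<open>K\<close> are not
  obviously measurable in \<open>(T, \<xi>, g)\<close>, so the event that is transported only involves points of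
  dyadic grids (\<open>grid_bounded\<close>); the passage from the grids to \<open>K\<close> is deterministic.

  For fixed \<open>(T, \<xi>)\<close> the weighted sum is \<open>\<Sum> c\<^sub>n(u) g\<^sub>n\<close>, where \<open>|c\<^sub>n(u)| \<le> A\<^sub>n\<close> and, for close points,
  \<open>|c\<^sub>n(u) - c\<^sub>n(v)| \<le> A\<^sub>n \<rho>t\<^sup>\<beta> (log (1 + 1/\<rho>t))\<^sup>e\<close>, now with \<open>e = max \<eta> 0\<close>
  (\<open>weighted_coef_bounds\<close>). Here \<open>A\<^sub>n\<close> is a constant times \<open>n\<^sup>\<gamma>\<^sup>-\<^sup>\<sigma> Y\<^sub>n\<close>, with \<open>\<sigma>\<close> slightly smaller than \<open>1/b\<close> and \<open>Y\<^sub>n\<close> the sum of the modulus of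
  continuity of \<open>V\<^sub>n\<close> and of \<open>|V\<^sub>n|\<close> at the base point: a Poisson process has \<open>T\<^sub>n \<ge> c n\<close>
  (\<open>arrival_time_linear_lower_bound\<close>), and the gap between \<open>\<sigma>\<close> and \<open>1/b\<close> absorbs the logarithm
  produced by varying the exponent of \<open>T\<^sub>n\<close>. The moment hypotheses make \<open>\<Sum> A\<^sub>n\<^sup>2\<close> finite: the \<open>Y\<^sub>n\<close> are
  identically distributed with a finite moment of order \<open>2 min p 1\<close>, and a series of nonnegative
  terms converges as soon as the series of their \<open>min p 1\<close>-th powers does (\<open>AE_summable_weighted_squares\<close>).

  With \<open>\<Sum> A\<^sub>n\<^sup>2 < \<infinity>\<close>, a maximal inequality for the sub-Gaussian partial sums and the Borel--Cantelli
  lemma bound, for all large \<open>k\<close> and all pairs of points of the \<open>k\<close>-th dyadic grid at once, the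
  increments of all partial sums by a multiple of the square root of \<open>k\<close> times the modulus of the
  coefficients (\<open>AE_sub_gaussian_sums_le\<close>). Since \<open>k\<close> is comparable to \<open>log(1 + 1/\<rho>t)\<close> at the
  relevant scale, chaining turns this square root into the additional exponent \<open>1/2\<close> of the
  logarithm (\<open>chaining\<close>).
\<close>

section \<open>Moduli of power-logarithm type\<close>

definition log_power :: "real \<Rightarrow> real \<Rightarrow> real \<Rightarrow> real" where
  "log_power \<beta> e x = x powr \<beta> * ln (1 + inverse x) powr e"

lemma log_power_0 [simp]: "log_power \<beta> e 0 = 0"
  by (simp add: log_power_def)

lemma log_power_nonneg [simp]: "0 \<le> log_power \<beta> e x"
  by (simp add: log_power_def)

lemma log_power_pos: "0 < x \<Longrightarrow> 0 < log_power \<beta> e x"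
  by (simp add: log_power_def add_pos_pos less_imp_neq[symmetric] ln_gt_zero)

text \<open>
  In general the function is increasing only near \<open>0\<close>, on a range that depends on the exponents. This
  inequality replaces monotonicity, and the factor \<open>(x / y)\<close> to the power \<open>\<beta> / 2\<close> also makes
  the values along a geometric sequence of arguments summable. For \<open>t = x / y < 1\<close> the logarithm
  grows by at most a factor \<open>1 + 2 log (1 / t)\<close>, which half of the power \<open>t\<^sup>\<beta>\<close> absorbs.
\<close>

lemma log_power_decay:
  fixes \<beta> e C :: real
  assumes "0 < \<beta>" "0 \<le> e" "1 \<le> C"
  obtains B where "0 < B"
    "\<And>x y. 0 \<le> x \<Longrightarrow> x \<le> C * y \<Longrightarrow> 0 < y \<Longrightarrow> y \<le> 1 \<Longrightarrow>
       log_power \<beta> e x \<le> B * (x / y) powr (\<beta> / 2) * log_power \<beta> e y"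
proof -
  \<comment> \<open>Chosen so that \<open>log (1 / t)\<^sup>e\<close> is at most a constant times \<open>t powr (- \<beta> / 2)\<close>.\<close>
  define \<epsilon> where "\<epsilon> = \<beta> / (2 * (e + 1))"
  have \<epsilon>: "0 < \<epsilon>" "\<epsilon> * e \<le> \<beta> / 2"
    using assms by (auto simp: \<epsilon>_def field_simps)
  define B where "B = C powr (\<beta> / 2) + (1 + 2 / \<epsilon>) powr e"
  have "0 < B" using assms \<epsilon> by (auto simp: B_def intro!: add_pos_pos add_pos_nonneg)
  moreover have "log_power \<beta> e x \<le> B * (x / y) powr (\<beta> / 2) * log_power \<beta> e y"
    if x: "0 \<le> x" "x \<le> C * y" and y: "0 < y" "y \<le> 1" for x y
  proof (cases "x = 0")
    case False
    define t where "t = x / y"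
    have t: "0 < t" "t \<le> C" "x = t * y" using x y False by (auto simp: t_def field_simps)
    have ly: "1 / 2 \<le> ln (1 + inverse y)"
    proof -
      have "1 / 2 \<le> ln (2::real)" using ln2_ge_two_thirds by simp
      also have "\<dots> \<le> ln (1 + inverse y)" using y one_le_inverse[of y] by (intro iffD2[OF ln_le_cancel_iff]) (auto simp: add_pos_pos)
      finally show ?thesis .
    qed
    have main: "t powr (\<beta> / 2) * ln (1 + inverse x) powr e \<le> B * ln (1 + inverse y) powr e"
    proof (cases "1 \<le> t")
      case True
      have "y \<le> x" using True y by (simp add: t(3))
      hence "ln (1 + inverse x) powr e \<le> ln (1 + inverse y) powr e"
        using y assms by (intro powr_mono2) (auto simp: le_imp_inverse_le add_pos_pos)
      moreover have "t powr (\<beta> / 2) \<le> C powr (\<beta> / 2)"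
        using t assms by (intro powr_mono2) auto
      moreover have "C powr (\<beta> / 2) \<le> B" using \<epsilon> by (simp add: B_def)
      ultimately show ?thesis using \<open>0 < B\<close> by (intro mult_mono) auto
    next
      case False
      have "1 + inverse x \<le> (1 + inverse y) / t"
        using False t y by (simp add: field_simps)
      hence "ln (1 + inverse x) \<le> ln ((1 + inverse y) / t)"
        using t y by (subst ln_le_cancel_iff) (auto simp: add_pos_pos)
      also have "\<dots> = ln (1 + inverse y) + ln (1 / t)"
        using t add_pos_pos[of 1 "inverse y"] y by (simp add: ln_div)
      also have "ln (1 / t) \<le> (1 / t) powr \<epsilon> / \<epsilon>"
        using False t \<epsilon> by (intro ln_powr_bound) auto
      also have "ln (1 + inverse y) + (1 / t) powr \<epsilon> / \<epsilon>
          \<le> ln (1 + inverse y) * ((1 + 2 / \<epsilon>) * (1 / t) powr \<epsilon>)"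
      proof -
        define l where "l = ln (1 + inverse y)"
        define z where "z = (1 / t) powr \<epsilon>"
        have "1 \<le> z" unfolding z_def using False t \<epsilon> by (intro ge_one_powr_ge_zero) auto
        moreover have "1 / 2 \<le> l" using ly by (simp add: l_def)
        ultimately have "l * 1 \<le> l * z" "1 * (z / \<epsilon>) \<le> 2 * l * (z / \<epsilon>)"
          using \<epsilon> by (auto intro!: mult_left_mono mult_right_mono divide_right_mono)
        hence "l + z / \<epsilon> \<le> l * ((1 + 2 / \<epsilon>) * z)" by (simp add: algebra_simps)
        thus ?thesis unfolding l_def z_def .
      qed
      finally have l: "ln (1 + inverse x) \<le> ln (1 + inverse y) * ((1 + 2 / \<epsilon>) * (1 / t) powr \<epsilon>)"
        by simp
      have "ln (1 + inverse x) powr e \<le> (ln (1 + inverse y) * ((1 + 2 / \<epsilon>) * (1 / t) powr \<epsilon>)) powr e"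
        using l assms t y by (intro powr_mono2) auto
      also have "\<dots> = ln (1 + inverse y) powr e * ((1 + 2 / \<epsilon>) powr e * t powr (- (\<epsilon> * e)))"
        using t \<epsilon> ly by (simp add: powr_mult powr_powr powr_minus powr_divide inverse_eq_divide)
      finally have "t powr (\<beta> / 2) * ln (1 + inverse x) powr e
          \<le> t powr (\<beta> / 2) * (ln (1 + inverse y) powr e * ((1 + 2 / \<epsilon>) powr e * t powr (- (\<epsilon> * e))))"
        by (intro mult_left_mono) auto
      also have "\<dots> = (1 + 2 / \<epsilon>) powr e * t powr (\<beta> / 2 - \<epsilon> * e) * ln (1 + inverse y) powr e"
        by (simp add: diff_conv_add_uminus powr_add mult_ac del: add_uminus_conv_diff)
      also have "\<dots> \<le> (1 + 2 / \<epsilon>) powr e * 1 * ln (1 + inverse y) powr e"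
        using False t \<epsilon> by (intro mult_right_mono mult_left_mono powr_le1) auto
      also have "\<dots> \<le> B * ln (1 + inverse y) powr e"
        by (intro mult_right_mono) (auto simp: B_def)
      finally show ?thesis .
    qed
    have "log_power \<beta> e x = y powr \<beta> * t powr (\<beta> / 2) * (t powr (\<beta> / 2) * ln (1 + inverse x) powr e)"
      using t y by (simp add: log_power_def powr_mult powr_add[symmetric])
    also have "\<dots> \<le> y powr \<beta> * t powr (\<beta> / 2) * (B * ln (1 + inverse y) powr e)"
      using main by (intro mult_left_mono) auto
    finally show ?thesis by (simp add: log_power_def t_def mult_ac)
  qed auto
  ultimately show thesis using that by blast
qed

lemma log_power_le_powr:
  assumes "0 < \<beta>" "0 \<le> e"
  obtains B where "0 < B" "\<And>x. 0 \<le> x \<Longrightarrow> x \<le> 1 \<Longrightarrow> log_power \<beta> e x \<le> B * x powr (\<beta> / 2)"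
proof -
  obtain B where B: "0 < B" "\<And>x y. 0 \<le> x \<Longrightarrow> x \<le> 1 * y \<Longrightarrow> 0 < y \<Longrightarrow> y \<le> 1 \<Longrightarrow>
       log_power \<beta> e x \<le> B * (x / y) powr (\<beta> / 2) * log_power \<beta> e y"
    using log_power_decay[OF assms, of 1] by auto
  show thesis
  proof (rule that[of "B * log_power \<beta> e 1"])
    show "0 < B * log_power \<beta> e 1" using B(1) log_power_pos[of 1 \<beta> e] by simp
    show "log_power \<beta> e x \<le> B * log_power \<beta> e 1 * x powr (\<beta> / 2)" if "0 \<le> x" "x \<le> 1" for x
      using B(2)[of x 1] that by (simp add: mult_ac)
  qed
qed

text \<open>
  Below \<open>1/4 < 1/e\<close> the logarithm exceeds \<open>1\<close> in absolute value, so that raising its exponent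
  or lowering the exponent of \<open>x\<close> only increases the modulus.
\<close>

lemma log_power_near_zero:
  assumes "0 < x" "x \<le> 1 / 4" "0 < \<beta>" "\<beta> \<le> 1" "0 \<le> e"
  shows "x \<le> log_power \<beta> e x" "1 \<le> \<bar>ln x\<bar>" "\<bar>ln x\<bar> \<le> ln (1 + inverse x)"
proof -
  have "exp (1::real) \<le> 4" using exp_le by simp
  hence "ln (exp 1) \<le> ln (4::real)" by (intro iffD2[OF ln_le_cancel_iff]) auto
  hence "1 \<le> ln (4::real)" by simp
  moreover have "ln x \<le> ln (1 / 4)" using assms by (intro iffD2[OF ln_le_cancel_iff]) auto
  ultimately have 1: "ln x \<le> -1" by (simp add: ln_div)
  thus l: "1 \<le> \<bar>ln x\<bar>" by simp
  have "\<bar>ln x\<bar> = ln (inverse x)" using 1 assms by (simp add: ln_inverse)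
  also have "\<dots> \<le> ln (1 + inverse x)" using assms by (intro iffD2[OF ln_le_cancel_iff]) (auto simp: add_pos_pos)
  finally show l': "\<bar>ln x\<bar> \<le> ln (1 + inverse x)" .
  have "x powr 1 * 1 \<le> x powr \<beta> * ln (1 + inverse x) powr e"
    using assms l l' by (intro mult_mono powr_mono' ge_one_powr_ge_zero) auto
  thus "x \<le> log_power \<beta> e x" using assms by (simp add: log_power_def)
qed

lemma log_power_modulus_continuous_on:
  fixes F :: "real ^ 'd \<Rightarrow> complex"
  assumes H: "0 < H" and c: "0 < c" and q0: "\<And>x y. 0 \<le> q x y"
    and up: "\<And>x y. norm (x - y) \<le> 1 \<Longrightarrow> q x y \<le> c * norm (x - y) powr H"
    and \<beta>: "0 < \<beta>" and e: "0 \<le> e" and \<delta>: "0 < \<delta>" and L: "0 \<le> L"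
    and F: "\<And>u v. u \<in> K \<Longrightarrow> v \<in> K \<Longrightarrow> norm (u - v) \<le> \<delta> \<Longrightarrow> cmod (F u - F v) \<le> L * log_power \<beta> e (q u v)"
  shows "continuous_on K F"
  unfolding continuous_on_def
proof
  fix u assume u: "u \<in> K"
  obtain B where B: "0 < B" "\<And>x. 0 \<le> x \<Longrightarrow> x \<le> 1 \<Longrightarrow> log_power \<beta> e x \<le> B * x powr (\<beta> / 2)"
    using log_power_le_powr[OF \<beta> e] by metis
  have n0: "((\<lambda>v. norm (v - u)) \<longlongrightarrow> 0) (at u within K)"
    by (rule tendsto_eq_intros refl | simp)+
  have h0: "((\<lambda>v. c * norm (v - u) powr H) \<longlongrightarrow> c * 0 powr H) (at u within K)"
    using H by (intro tendsto_intros n0) auto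
  have "((\<lambda>v. L * (B * (c * norm (v - u) powr H) powr (\<beta> / 2))) \<longlongrightarrow> L * (B * (c * 0 powr H) powr (\<beta> / 2))) (at u within K)"
    by (rule tendsto_mult[OF tendsto_const tendsto_mult[OF tendsto_const tendsto_powr'[OF h0 tendsto_const]]])
      (use c \<beta> in auto)
  hence lim: "((\<lambda>v. L * (B * (c * norm (v - u) powr H) powr (\<beta> / 2))) \<longlongrightarrow> 0) (at u within K)" by simp
  have "\<forall>\<^sub>F v in at u within K. norm (v - u) < min \<delta> 1"
    using n0 \<delta> by (intro order_tendstoD(2)) auto
  moreover have "\<forall>\<^sub>F v in at u within K. c * norm (v - u) powr H < 1"
    using h0 by (intro order_tendstoD(2)) auto
  moreover have "\<forall>\<^sub>F v in at u within K. v \<in> K" by (simp add: eventually_at_filter)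
  ultimately have "\<forall>\<^sub>F v in at u within K. norm (F v - F u) \<le> L * (B * (c * norm (v - u) powr H) powr (\<beta> / 2))"
  proof eventually_elim
    case (elim v)
    have q1: "q v u \<le> c * norm (v - u) powr H" using elim by (intro up) auto
    have "cmod (F v - F u) \<le> L * log_power \<beta> e (q v u)" using elim u by (intro F) auto
    also have "\<dots> \<le> L * (B * q v u powr (\<beta> / 2))"
      using L elim q1 q0 by (intro mult_left_mono B) auto
    also have "\<dots> \<le> L * (B * (c * norm (v - u) powr H) powr (\<beta> / 2))"
      using L B q1 q0 \<beta> by (intro mult_left_mono powr_mono2) auto
    finally show ?case .
  qed
  hence "((\<lambda>v. F v - F u) \<longlongrightarrow> 0) (at u within K)" using lim by (rule Lim_null_comparison)
  thus "(F \<longlongrightarrow> F u) (at u within K)" by (simp add: LIM_zero_iff)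
qed

text \<open>
  Away from the diagonal a modulus bound is a mere boundedness statement; this compactness
  argument is what extends a bound from close pairs to all pairs.
\<close>

lemma log_power_quasi_metric_bounded_below:
  fixes q :: "'a::euclidean_space \<Rightarrow> 'a \<Rightarrow> real"
  assumes qm: "quasi_metric q" and K: "compact K" and \<delta>: "0 < \<delta>"
  obtains \<mu> where "0 < \<mu>" "\<And>u v. u \<in> K \<Longrightarrow> v \<in> K \<Longrightarrow> \<delta> \<le> norm (u - v) \<Longrightarrow> \<mu> \<le> log_power \<beta> e (q u v)"
proof -
  define S where "S = (K \<times> K) \<inter> {p. \<delta> \<le> norm (fst p - snd p)}"
  have "closed {p :: 'a \<times> 'a. \<delta> \<le> norm (fst p - snd p)}"
    by (intro closed_Collect_le continuous_intros)
  hence S: "compact S" unfolding S_def using K by (intro compact_Int_closed compact_Times)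
  have q: "0 < q (fst p) (snd p)" if "p \<in> S" for p
    using qm that \<delta> unfolding quasi_metric_def S_def by (auto simp: less_le)
  have "continuous_on UNIV (\<lambda>p. q (fst p) (snd p))"
    using qm by (simp add: quasi_metric_def case_prod_beta')
  hence "continuous_on S (\<lambda>p. q (fst p) (snd p))" by (rule continuous_on_subset) simp
  moreover have "q (fst p) (snd p) \<noteq> 0" "1 + inverse (q (fst p) (snd p)) \<noteq> 0" "ln (1 + inverse (q (fst p) (snd p))) \<noteq> 0" if "p \<in> S" for p
  proof -
    have "0 < inverse (q (fst p) (snd p))" using q[OF that] by simp
    hence "0 < 1 + inverse (q (fst p) (snd p))" "0 < ln (1 + inverse (q (fst p) (snd p)))"
      by (auto intro: add_pos_pos ln_gt_zero)
    thus "q (fst p) (snd p) \<noteq> 0" "1 + inverse (q (fst p) (snd p)) \<noteq> 0" "ln (1 + inverse (q (fst p) (snd p))) \<noteq> 0"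
      using q[OF that] by simp_all
  qed
  ultimately have cont: "continuous_on S (\<lambda>p. log_power \<beta> e (q (fst p) (snd p)))"
    unfolding log_power_def by (intro continuous_intros) auto
  show thesis
  proof (cases "S = {}")
    case True
    thus thesis by (intro that[of 1]) (auto simp: S_def)
  next
    case False
    then obtain p where p: "p \<in> S" "\<And>p'. p' \<in> S \<Longrightarrow> log_power \<beta> e (q (fst p) (snd p)) \<le> log_power \<beta> e (q (fst p') (snd p'))"
      using continuous_attains_inf[OF S _ cont] by blast
    show thesis
    proof (rule that)
      show "0 < log_power \<beta> e (q (fst p) (snd p))" using q[OF p(1)] by (rule log_power_pos)
      show "log_power \<beta> e (q (fst p) (snd p)) \<le> log_power \<beta> e (q u v)"
        if "u \<in> K" "v \<in> K" "\<delta> \<le> norm (u - v)" for u v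
        using p(2)[of "(u, v)"] that by (simp add: S_def)
    qed
  qed
qed

section \<open>Dyadic grids and chaining\<close>

definition dyadic_floor :: "real ^ 'd \<Rightarrow> nat \<Rightarrow> real ^ 'd \<Rightarrow> real ^ 'd" where
  "dyadic_floor lo k u = (\<chi> i. lo $ i + real_of_int \<lfloor>2 ^ k * (u $ i - lo $ i)\<rfloor> / 2 ^ k)"

lemma dyadic_floor_in_cbox:
  assumes "u \<in> cbox lo hi"
  shows "dyadic_floor lo k u \<in> cbox lo hi"
proof -
  have "lo $ i \<le> dyadic_floor lo k u $ i \<and> dyadic_floor lo k u $ i \<le> hi $ i" for i
  proof -
    have u: "lo $ i \<le> u $ i" "u $ i \<le> hi $ i" using assms by (auto simp: mem_box_cart)
    have "0 \<le> \<lfloor>2 ^ k * (u $ i - lo $ i)\<rfloor>" using u by simp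
    moreover have "real_of_int \<lfloor>2 ^ k * (u $ i - lo $ i)\<rfloor> / 2 ^ k \<le> u $ i - lo $ i"
      by (simp add: divide_le_eq mult.commute)
    ultimately show ?thesis using u by (simp add: dyadic_floor_def)
  qed
  thus ?thesis by (simp add: mem_box_cart)
qed

lemma norm_dyadic_floor_le:
  fixes u :: "real ^ 'd"
  shows "norm (u - dyadic_floor lo k u) \<le> real CARD('d) / 2 ^ k"
proof -
  have "\<bar>(u - dyadic_floor lo k u) $ i\<bar> \<le> 1 / 2 ^ k" for i
  proof -
    define z where "z = 2 ^ k * (u $ i - lo $ i)"
    have "(u - dyadic_floor lo k u) $ i = (z - real_of_int \<lfloor>z\<rfloor>) / 2 ^ k"
      by (simp add: dyadic_floor_def z_def field_simps)
    moreover have "\<bar>z - real_of_int \<lfloor>z\<rfloor>\<bar> \<le> 1" by linarith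
    ultimately show ?thesis by (simp add: abs_divide divide_right_mono)
  qed
  hence "(\<Sum>i\<in>UNIV. \<bar>(u - dyadic_floor lo k u) $ i\<bar>) \<le> real CARD('d) * (1 / 2 ^ k)"
    by (intro sum_bounded_above) auto
  thus ?thesis using norm_le_l1_cart[of "u - dyadic_floor lo k u"] by simp
qed

text \<open>
  The bound is exponential in \<open>k\<close>, which is what the tail \<open>exp (- \<kappa> k)\<close> of sub-Gaussian sums at
  level \<open>sqrt k\<close> can compensate.
\<close>

lemma dyadic_grid_card:
  fixes lo hi :: "real ^ 'd"
  obtains C B :: nat where
    "\<And>k. finite (dyadic_floor lo k ` cbox lo hi)"
    "\<And>k. card (dyadic_floor lo k ` cbox lo hi) \<le> C * B ^ k"
proof -
  define R :: nat where "R = nat \<lceil>Max (range (\<lambda>i. hi $ i - lo $ i))\<rceil> + 1"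
  have R: "hi $ i - lo $ i < real R" for i
  proof -
    have "hi $ i - lo $ i \<le> Max (range (\<lambda>i. hi $ i - lo $ i))" by (intro Max_ge) auto
    thus ?thesis unfolding R_def by linarith
  qed
  define P :: "nat \<Rightarrow> ('d \<Rightarrow> nat) set" where "P k = PiE UNIV (\<lambda>_. {..<R * 2 ^ k})" for k
  have sub: "dyadic_floor lo k ` cbox lo hi \<subseteq> (\<lambda>h. \<chi> i. lo $ i + real (h i) / 2 ^ k) ` P k" for k
  proof
    fix x assume "x \<in> dyadic_floor lo k ` cbox lo hi"
    then obtain u where u: "u \<in> cbox lo hi" "x = dyadic_floor lo k u" by auto
    define h where "h i = nat \<lfloor>2 ^ k * (u $ i - lo $ i)\<rfloor>" for i
    have "x = (\<chi> i. lo $ i + real (h i) / 2 ^ k)"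
      using u by (simp add: dyadic_floor_def h_def vec_eq_iff mem_box_cart)
    moreover have "h i < R * 2 ^ k" for i
    proof -
      have "u $ i - lo $ i < real R" using R[of i] u(1) unfolding mem_box_cart by (smt (verit))
      hence "2 ^ k * (u $ i - lo $ i) < 2 ^ k * real R" by simp
      also have "\<dots> = of_int (int (R * 2 ^ k))" by (simp add: mult.commute)
      finally have "\<lfloor>2 ^ k * (u $ i - lo $ i)\<rfloor> < int (R * 2 ^ k)" by (simp add: floor_less_iff)
      moreover have "0 < R * 2 ^ k" by (simp add: R_def)
      ultimately show ?thesis unfolding h_def by (metis nat_less_iff nat_0_iff nat_int zless_nat_conj not_le_imp_less nat_eq_iff2 of_nat_0_less_iff)
    qed
    hence "h \<in> P k" by (auto simp: P_def)
    ultimately show "x \<in> (\<lambda>h. \<chi> i. lo $ i + real (h i) / 2 ^ k) ` P k" by blast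
  qed
  have fin: "finite (P k)" for k by (simp add: P_def finite_PiE)
  have "card (dyadic_floor lo k ` cbox lo hi) \<le> card (P k)" for k
    using card_mono[OF finite_imageI[OF fin] sub] card_image_le[OF fin] by (rule le_trans)
  moreover have "card (P k) = R ^ CARD('d) * (2 ^ CARD('d)) ^ k" for k
    by (simp add: P_def card_PiE power_mult_distrib power_mult[symmetric] mult.commute)
  ultimately show thesis using that finite_subset[OF sub finite_imageI[OF fin]] by metis
qed

text \<open>
  Converts the factors \<open>sqrt k\<close> that the union bound over the \<open>k\<close>-th grid produces into powers of
  the logarithm.
\<close>

lemma ln_ge_scale:
  fixes x y H :: real
  assumes "0 < H" "0 < x" "x \<le> 2 powr (- (real k * H))"
  shows "real k * H * ln 2 \<le> ln (1 + inverse x)"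
proof -
  have "2 powr (real k * H) \<le> inverse x"
    using assms le_imp_inverse_le[of x "2 powr (- (real k * H))"] by (simp add: powr_minus)
  hence "2 powr (real k * H) \<le> 1 + inverse x" by simp
  hence "ln (2 powr (real k * H)) \<le> ln (1 + inverse x)"
    by (intro iffD2[OF ln_le_cancel_iff]) (use assms in \<open>auto simp: add_pos_pos\<close>)
  thus ?thesis by (simp add: ln_powr)
qed

text \<open>
  Two consecutive levels are taken together because chaining compares the approximations of a
  point in one grid and in the next.
\<close>

definition grid_pairs :: "real ^ 'd \<Rightarrow> real ^ 'd \<Rightarrow> real \<Rightarrow> nat \<Rightarrow> ((real ^ 'd) \<times> (real ^ 'd)) set" where
  "grid_pairs lo hi \<delta> k =
     {(u, v). u \<in> dyadic_floor lo k ` cbox lo hi \<union> dyadic_floor lo (Suc k) ` cbox lo hi \<and>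
              v \<in> dyadic_floor lo k ` cbox lo hi \<union> dyadic_floor lo (Suc k) ` cbox lo hi \<and>
              norm (u - v) \<le> \<delta>}"

lemma grid_pairs_in_cbox:
  assumes "(u, v) \<in> grid_pairs lo hi \<delta> k"
  shows "u \<in> cbox lo hi" "v \<in> cbox lo hi" "norm (u - v) \<le> \<delta>"
  using assms dyadic_floor_in_cbox unfolding grid_pairs_def by blast+

lemma grid_pairs_card:
  fixes lo hi :: "real ^ 'd"
  obtains C B :: nat where
    "\<And>k. finite (grid_pairs lo hi \<delta> k)" "\<And>k. card (grid_pairs lo hi \<delta> k) \<le> C * B ^ k"
proof -
  obtain C B :: nat where fin: "\<And>k. finite (dyadic_floor lo k ` cbox lo hi)"
    and card: "\<And>k. card (dyadic_floor lo k ` cbox lo hi) \<le> C * B ^ k"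
    using dyadic_grid_card[of lo hi] by metis
  define E where "E k = dyadic_floor lo k ` cbox lo hi \<union> dyadic_floor lo (Suc k) ` cbox lo hi" for k
  have finE: "finite (E k)" for k by (simp add: E_def fin del: finite_imageI) 
  have sub: "grid_pairs lo hi \<delta> k \<subseteq> E k \<times> E k" for k by (auto simp: grid_pairs_def E_def)
  have "card (grid_pairs lo hi \<delta> k) \<le> (C * (1 + B))\<^sup>2 * (B\<^sup>2) ^ k" for k
  proof -
    have "card (E k) \<le> C * B ^ k + C * B ^ Suc k"
      unfolding E_def by (intro order_trans[OF card_Un_le] add_mono card)
    also have "\<dots> = C * (1 + B) * B ^ k" by (simp add: algebra_simps)
    finally have "card (E k) \<le> C * (1 + B) * B ^ k" .
    hence "card (E k) * card (E k) \<le> (C * (1 + B) * B ^ k) * (C * (1 + B) * B ^ k)" by (intro mult_mono) auto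
    moreover have "card (grid_pairs lo hi \<delta> k) \<le> card (E k \<times> E k)"
      using finE by (intro card_mono sub finite_cartesian_product)
    ultimately show ?thesis
      by (simp add: card_cartesian_product power2_eq_square power_mult_distrib mult_ac)
  qed
  thus thesis using that finite_subset[OF sub finite_cartesian_product[OF finE finE]] by metis
qed

lemma norm_diff_add_le: "norm (x - z + w) \<le> norm x + norm z + norm (w :: 'a :: real_normed_vector)"
  using norm_triangle_ineq[of "x - z" w] norm_triangle_ineq4[of x z] by simp

text \<open>
  Two points \<open>u\<close>, \<open>v\<close> are compared through their approximations in the grid of level \<open>k\<close>, where
  \<open>k\<close> is the first level whose mesh \<open>2\<^sup>-\<^sup>k\<close> satisfies \<open>(2\<^sup>-\<^sup>k)\<^sup>H \<le> q u v\<close>. The quasi-metric is only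
  bounded above by a power of the norm, so at this level \<open>u\<close> and \<open>v\<close> may still be many
  grid cells apart; this is why the hypothesis concerns all pairs of grid points and not just
  neighbours. Passing from a point to its approximation is a telescoping sum over the finer levels,
  dominated by a multiple of its first term thanks to \<open>log_power_decay\<close>. The threshold \<open>\<delta>\<close> depends on \<open>k0\<close>
  but not on \<open>F\<close>, so that the result applies uniformly to a family of functions.
\<close>

lemma chaining:
  fixes q :: "real ^ 'd \<Rightarrow> real ^ 'd \<Rightarrow> real" and lo hi :: "real ^ 'd"
  assumes qm: "quasi_metric q" and H: "0 < H" and c: "0 < c"
    and up: "\<And>x y. norm (x - y) \<le> 1 \<Longrightarrow> q x y \<le> c * norm (x - y) powr H"
    and \<beta>: "0 < \<beta>" and e: "0 \<le> e" and \<delta>0: "0 < \<delta>0"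
  obtains B where "0 < B"
    "\<forall>k0. \<exists>\<delta>>0. \<forall>(F :: real ^ 'd \<Rightarrow> complex) A.
       continuous_on (cbox lo hi) F \<longrightarrow> 0 \<le> A \<longrightarrow>
       (\<forall>k\<ge>k0. \<forall>u v. (u, v) \<in> grid_pairs lo hi \<delta>0 k \<longrightarrow> cmod (F u - F v) \<le> A * sqrt k * log_power \<beta> e (q u v)) \<longrightarrow>
       (\<forall>u\<in>cbox lo hi. \<forall>v\<in>cbox lo hi. norm (u - v) \<le> \<delta> \<longrightarrow>
          cmod (F u - F v) \<le> B * A * log_power \<beta> (e + 1 / 2) (q u v))"
proof -
  define d where "d = real CARD('d)"
  have d: "1 \<le> d" unfolding d_def by (simp add: Suc_leI)
  define K where "K = cbox lo hi"
  define \<pi> where "\<pi> k u = dyadic_floor lo k u" for k and u :: "real ^ 'd"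
  define y where "y k = 2 powr (- (real k * H))" for k :: nat
  have y: "0 < y k" "y k \<le> 1" for k
    using H by (auto simp: y_def powr_le_one_le powr_minus inverse_le_1_iff ge_one_powr_ge_zero)
  have [simp]: "0 \<le> y k" for k using y(1)[of k] by simp
  have y_alt: "y k = (1 / 2 ^ k) powr H" for k
  proof -
    have "(1 / 2 ^ k) = (2::real) powr (- real k)" by (simp add: powr_minus powr_realpow divide_inverse)
    thus ?thesis by (simp only: powr_powr y_def) simp
  qed
  have y_anti: "y j \<le> y i" if "i \<le> j" for i j
    unfolding y_def using that H by (intro powr_mono) (auto intro: mult_right_mono)
  have y_add: "y (k + i) = y k * y i" for k i
    by (simp add: y_def algebra_simps powr_add[symmetric])
  have q: "0 \<le> q u v" "q u v = 0 \<longleftrightarrow> u = v" "q u v = q v u" for u v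
    using qm by (auto simp: quasi_metric_def)
  obtain \<kappa> where \<kappa>: "1 \<le> \<kappa>" "\<And>u v w. q u w \<le> \<kappa> * (q u v + q v w)"
    using qm by (auto simp: quasi_metric_def)
  have ln2: "0 < ln (2::real)" by simp
  let ?l = "log_power \<beta> e" and ?l' = "log_power \<beta> (e + 1 / 2)"
  have l'_eq: "?l' x = ?l x * sqrt (ln (1 + inverse x))" if "0 \<le> x" for x
    using that by (cases "x = 0") (simp_all add: log_power_def powr_add powr_half_sqrt)

  \<comment> \<open>Points of consecutive grids that approximate the same point are within \<open>C1 * y k\<close> for \<open>q\<close>.\<close>
  define C1 where "C1 = max 1 (c * (2 * d) powr H)"
  have C1: "1 \<le> C1" by (simp add: C1_def)
  have step: "q u v \<le> C1 * y k" if "norm (u - v) \<le> 2 * d / 2 ^ k" "2 * d / 2 ^ k \<le> 1" for u v k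
  proof -
    have "q u v \<le> c * norm (u - v) powr H" by (intro up order_trans[OF that])
    also have "\<dots> \<le> c * ((2 * d) * (1 / 2 ^ k)) powr H"
      using that c H by (intro mult_left_mono powr_mono2) auto
    also have "\<dots> = c * (2 * d) powr H * y k" 
      unfolding y_alt using d powr_mult[of "2 * d" "1 / 2 ^ k" H] by (simp only: mult.assoc)
    also have "\<dots> \<le> C1 * y k" using y by (intro mult_right_mono) (auto simp: C1_def)
    finally show ?thesis .
  qed
  \<comment> \<open>The relaxed triangle inequality, applied twice, bounds the quasi-distance of the
    approximations of \<open>u\<close> and \<open>v\<close> by \<open>C3 * q u v\<close>.\<close>
  define C3 where "C3 = \<kappa> * \<kappa> * (2 * C1 + 1)"
  have C3: "1 \<le> C3"
  proof -
    have "1 * 1 * 1 \<le> \<kappa> * \<kappa> * (2 * C1 + 1)"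
      using \<kappa>(1) C1 by (intro mult_mono) auto
    thus ?thesis by (simp add: C3_def)
  qed
  obtain B1 where B1: "0 < B1" "\<And>x y. 0 \<le> x \<Longrightarrow> x \<le> C3 * y \<Longrightarrow> 0 < y \<Longrightarrow> y \<le> 1 \<Longrightarrow>
       ?l x \<le> B1 * (x / y) powr (\<beta> / 2) * ?l y"
    using log_power_decay[OF \<beta> e C3] by metis
  obtain B2 where B2: "0 < B2" "\<And>x y. 0 \<le> x \<Longrightarrow> x \<le> 1 * y \<Longrightarrow> 0 < y \<Longrightarrow> y \<le> 1 \<Longrightarrow>
       ?l' x \<le> B2 * (x / y) powr (\<beta> / 2) * ?l' y"
    using log_power_decay[OF \<beta>, of "e + 1 / 2" 1] e by auto
  define D1 where "D1 = B1 * C3 powr (\<beta> / 2)"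
  have D1: "0 < D1" using B1 C3 by (simp add: D1_def)
  have cmp: "?l x \<le> D1 * ?l z" if "0 \<le> x" "x \<le> C3 * z" "0 < z" "z \<le> 1" for x z
  proof -
    have "?l x \<le> B1 * (x / z) powr (\<beta> / 2) * ?l z" using that by (rule B1)
    also have "\<dots> \<le> D1 * ?l z"
      unfolding D1_def using that B1 \<beta>
      by (intro mult_right_mono mult_left_mono powr_mono2) (auto simp: divide_le_eq)
    finally show ?thesis .
  qed
  have C13: "C1 \<le> C3"
  proof -
    have "1 * 1 \<le> \<kappa> * \<kappa>" using \<kappa>(1) by (intro mult_mono) auto
    hence "1 * C1 \<le> (\<kappa> * \<kappa>) * (2 * C1 + 1)" using C1 by (intro mult_mono) auto
    thus ?thesis by (simp add: C3_def)
  qed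
  define D2 where "D2 = sqrt (2 / (H * ln 2))"
  have D2: "0 < D2" using H by (simp add: D2_def)
  have sq: "sqrt (real k) * ?l x \<le> D2 * ?l' x" if "0 < x" "x \<le> y (k - 1)" "2 \<le> k" for k x
  proof -
    have "real (k - 1) * H * ln 2 \<le> ln (1 + inverse x)"
      using that H by (intro ln_ge_scale) (auto simp: y_def)
    moreover have "real k * (H * ln 2) \<le> 2 * real (k - 1) * (H * ln 2)"
      using that H ln2 by (intro mult_right_mono) auto
    moreover have "2 * real (k - 1) * (H * ln 2) = 2 * (real (k - 1) * H * ln 2)" by simp
    ultimately have "real k * (H * ln 2) \<le> 2 * ln (1 + inverse x)" by linarith
    hence "real k \<le> 2 * ln (1 + inverse x) / (H * ln 2)"
      using H by (intro iffD2[OF pos_le_divide_eq]) auto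
    hence "real k \<le> 2 / (H * ln 2) * ln (1 + inverse x)" by simp
    hence "sqrt (real k) \<le> D2 * sqrt (ln (1 + inverse x))"
      unfolding D2_def real_sqrt_mult[symmetric] by (rule real_sqrt_le_mono)
    hence "sqrt (real k) * ?l x \<le> D2 * sqrt (ln (1 + inverse x)) * ?l x"
      by (intro mult_right_mono) auto
    thus ?thesis using that by (simp add: l'_eq mult_ac)
  qed
  \<comment> \<open>The ratio of the geometric series that dominates the telescoping sum.\<close>
  define r where "r = 2 powr (- (H * \<beta> / 2))"
  have r: "0 < r" "r < 1" using H \<beta> by (auto simp: r_def powr_less_one)
  have y_r: "y i powr (\<beta> / 2) = r ^ i" for i
    by (simp add: y_def r_def powr_powr powr_realpow[symmetric] mult_ac)
  define D where "D = D1 * D2 * B2 / (1 - r)"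
  have D: "0 < D" using D1 D2 B2 r by (simp add: D_def)
  define B where "B = 2 * (D * B2) + D1 * D2"
  have "0 < B" using D D1 D2 B2 by (simp add: B_def add_pos_pos)
  moreover have "\<exists>\<delta>>0. \<forall>(F :: real ^ 'd \<Rightarrow> complex) A.
       continuous_on K F \<longrightarrow> 0 \<le> A \<longrightarrow>
       (\<forall>k\<ge>k0. \<forall>u v. (u, v) \<in> grid_pairs lo hi \<delta>0 k \<longrightarrow> cmod (F u - F v) \<le> A * sqrt k * ?l (q u v)) \<longrightarrow>
       (\<forall>u\<in>K. \<forall>v\<in>K. norm (u - v) \<le> \<delta> \<longrightarrow> cmod (F u - F v) \<le> B * A * ?l' (q u v))" for k0
  proof -
    have "(\<lambda>k. 2 * d * (1 / 2) ^ k) \<longlonglongrightarrow> 2 * d * 0"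
      by (intro tendsto_mult tendsto_const LIMSEQ_power_zero) auto
    hence "\<forall>\<^sub>F k in sequentially. 2 * d * (1 / 2) ^ k < min 1 (\<delta>0 / 2)"
      using \<delta>0 by (intro order_tendstoD(2)) auto
    then obtain k2 where k2: "\<And>k. k \<ge> k2 \<Longrightarrow> 2 * d / 2 ^ k < min 1 (\<delta>0 / 2)"
      by (auto simp: eventually_sequentially power_divide)
    define k1 where "k1 = max 2 (max k0 k2)"
    have k1: "2 \<le> k" "k0 \<le> k" "2 * d / 2 ^ k \<le> 1" "2 * d / 2 ^ k \<le> \<delta>0 / 2" if "k1 \<le> k" for k
      using that k2[of k] by (auto simp: k1_def)
    define \<delta> where "\<delta> = min (min 1 (\<delta>0 / 2)) ((y k1 / (2 * c)) powr (1 / H))"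
    have \<delta>: "0 < \<delta>" "\<delta> \<le> 1" "\<delta> \<le> \<delta>0 / 2" using \<delta>0 y(1)[of k1] c by (auto simp: \<delta>_def)
    have c\<delta>: "c * \<delta> powr H < y k1"
    proof -
      have "\<delta> powr H \<le> ((y k1 / (2 * c)) powr (1 / H)) powr H"
        using \<delta> H by (intro powr_mono2) (auto simp: \<delta>_def)
      also have "\<dots> = y k1 / (2 * c)" using H y(1)[of k1] c by (simp add: powr_powr)
      finally have "c * \<delta> powr H \<le> c * (y k1 / (2 * c))" using c by (intro mult_left_mono) auto
      also have "\<dots> < y k1" using c y(1)[of k1] by (simp add: field_simps)
      finally show ?thesis .
    qed
    have pi_K: "\<pi> k u \<in> K" if "u \<in> K" for k u
      using that dyadic_floor_in_cbox by (auto simp: K_def \<pi>_def)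
    have pi_near: "norm (u - \<pi> k u) \<le> d / 2 ^ k" for k u
      by (simp add: \<pi>_def d_def norm_dyadic_floor_le)
    have main: "cmod (F u - F v) \<le> B * A * ?l' (q u v)"
      if F: "continuous_on K F" and A: "0 \<le> A"
        and FA: "\<And>k u v. k \<ge> k0 \<Longrightarrow> u \<in> \<pi> k ` K \<union> \<pi> (Suc k) ` K \<Longrightarrow> v \<in> \<pi> k ` K \<union> \<pi> (Suc k) ` K \<Longrightarrow>
          norm (u - v) \<le> \<delta>0 \<Longrightarrow> cmod (F u - F v) \<le> A * sqrt k * ?l (q u v)"
        and uv: "u \<in> K" "v \<in> K" "norm (u - v) \<le> \<delta>" for F :: "real ^ 'd \<Rightarrow> complex" and A u v
    proof (cases "u = v")
      case False
      have approx: "cmod (F (\<pi> k w) - F w) \<le> A * D * ?l' (y k)" if k: "k1 \<le> k" and w: "w \<in> K" for k w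
      proof -
        have inc: "cmod (F (\<pi> (k + Suc i) w) - F (\<pi> (k + i) w)) \<le> A * (D1 * D2 * B2) * ?l' (y k) * r ^ i" for i
        proof -
          have ki: "k1 \<le> k + i" using k by simp
          have "norm (\<pi> (k + Suc i) w - \<pi> (k + i) w) \<le> norm (w - \<pi> (k + i) w) + norm (w - \<pi> (k + Suc i) w)"
            using norm_triangle_ineq4[of "w - \<pi> (k + i) w" "w - \<pi> (k + Suc i) w"] by simp
          also have "\<dots> \<le> d / 2 ^ (k + i) + d / 2 ^ (k + Suc i)" by (intro add_mono pi_near)
          also have "\<dots> \<le> d / 2 ^ (k + i) + d / 2 ^ (k + i)"
            using d by (intro add_left_mono divide_left_mono) auto
          finally have n: "norm (\<pi> (k + Suc i) w - \<pi> (k + i) w) \<le> 2 * d / 2 ^ (k + i)" by simp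
          have n0: "norm (\<pi> (k + Suc i) w - \<pi> (k + i) w) \<le> \<delta>0"
            using n k1(4)[OF ki] \<delta>0 by linarith
          have "q (\<pi> (k + Suc i) w) (\<pi> (k + i) w) \<le> C1 * y (k + i)"
            using n k1[OF ki] by (intro step) auto
          also have "\<dots> \<le> C3 * y (k + i)" using C13 y(1)[of "k + i"] by (intro mult_right_mono) auto
          finally have qle: "q (\<pi> (k + Suc i) w) (\<pi> (k + i) w) \<le> C3 * y (k + i)" .
          have "cmod (F (\<pi> (k + Suc i) w) - F (\<pi> (k + i) w))
              \<le> A * sqrt (k + i) * ?l (q (\<pi> (k + Suc i) w) (\<pi> (k + i) w))"
            using k1(2)[OF ki] w n0 by (intro FA) auto
          also have "\<dots> \<le> A * sqrt (k + i) * (D1 * ?l (y (k + i)))"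
            using A qle y q by (intro mult_left_mono cmp) auto
          also have "\<dots> = A * D1 * (sqrt (k + i) * ?l (y (k + i)))" by simp
          also have "\<dots> \<le> A * D1 * (D2 * ?l' (y (k + i)))"
            using A D1 k1[OF ki] y by (intro mult_left_mono sq y_anti) auto
          also have "\<dots> \<le> A * D1 * (D2 * (B2 * (y (k + i) / y k) powr (\<beta> / 2) * ?l' (y k)))"
            using A D1 D2 y(1)[of k] y(2)[of k] y_anti[of k "k + i"] y(1)[of "k + i"]
            by (intro mult_left_mono B2(2)) (auto simp: less_imp_le)
          also have "(y (k + i) / y k) powr (\<beta> / 2) = r ^ i"
            using y(1)[of k] by (simp add: y_add y_r)
          finally show ?thesis by (simp add: mult_ac)
        qed
        have sum: "cmod (F (\<pi> (k + m) w) - F (\<pi> k w)) \<le> A * D * ?l' (y k)" for m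
        proof -
          have "F (\<pi> (k + m) w) - F (\<pi> k w) = (\<Sum>i<m. F (\<pi> (k + Suc i) w) - F (\<pi> (k + i) w))"
            using sum_lessThan_telescope[of "\<lambda>i. F (\<pi> (k + i) w)" m] by simp
          hence "cmod (F (\<pi> (k + m) w) - F (\<pi> k w))
              \<le> (\<Sum>i<m. A * (D1 * D2 * B2) * ?l' (y k) * r ^ i)"
            using inc by (auto intro: sum_norm_le)
          also have "\<dots> = A * (D1 * D2 * B2) * ?l' (y k) * (\<Sum>i<m. r ^ i)"
            by (simp add: sum_distrib_left)
          also have "\<dots> \<le> A * (D1 * D2 * B2) * ?l' (y k) * (1 / (1 - r))"
          proof (intro mult_left_mono)
            show "(\<Sum>i<m. r ^ i) \<le> 1 / (1 - r)"
              using r sum_le_suminf[of "\<lambda>i. r ^ i" "{..<m}"] by (simp add: suminf_geometric summable_geometric)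
          qed (use A D1 D2 B2 in auto)
          finally show ?thesis by (simp add: D_def mult_ac)
        qed
        have "(\<lambda>m. \<pi> (k + m) w) \<longlonglongrightarrow> w"
        proof (rule LIMSEQ_I)
          fix \<epsilon> :: real assume "0 < \<epsilon>"
          have "(\<lambda>m. d * (1 / 2) ^ m) \<longlonglongrightarrow> d * 0"
            by (intro tendsto_mult tendsto_const LIMSEQ_power_zero) auto
          hence "\<forall>\<^sub>F m in sequentially. d * (1 / 2) ^ m < \<epsilon>"
            using \<open>0 < \<epsilon>\<close> by (intro order_tendstoD(2)) auto
          then obtain m0 where m0: "\<And>m. m \<ge> m0 \<Longrightarrow> d / 2 ^ m < \<epsilon>"
            by (auto simp: eventually_sequentially power_divide)
          have "norm (\<pi> (k + m) w - w) < \<epsilon>" if "m \<ge> m0" for m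
            using pi_near[of w "k + m"] m0[of "k + m"] that by (simp add: norm_minus_commute)
          thus "\<exists>m0. \<forall>m\<ge>m0. norm (\<pi> (k + m) w - w) < \<epsilon>" by blast
        qed
        hence "(\<lambda>m. F (\<pi> (k + m) w)) \<longlonglongrightarrow> F w"
          using F w pi_K by (auto simp: continuous_on_sequentially o_def)
        hence "(\<lambda>m. cmod (F (\<pi> (k + m) w) - F (\<pi> k w))) \<longlonglongrightarrow> cmod (F w - F (\<pi> k w))"
          by (intro tendsto_intros)
        hence "cmod (F w - F (\<pi> k w)) \<le> A * D * ?l' (y k)"
          by (rule LIMSEQ_le_const2) (use sum in auto)
        thus ?thesis by (simp add: norm_minus_commute)
      qed
      have q0: "0 < q u v" using q[of u v] False by (simp add: less_le)
      have "q u v \<le> c * norm (u - v) powr H" using uv \<delta> by (intro up) auto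
      also have "\<dots> \<le> c * \<delta> powr H" using uv c H by (intro mult_left_mono powr_mono2) auto
      finally have qk1: "q u v < y k1" using c\<delta> by simp
      have "y \<longlonglongrightarrow> 0"
      proof -
        have "y = (\<lambda>k. (2 powr (- H)) ^ k)"
          by (simp add: y_def powr_powr powr_realpow[symmetric] mult_ac fun_eq_iff)
        moreover have "2 powr (- H) < 1" using H by (simp add: powr_less_one)
        ultimately show ?thesis by (simp add: LIMSEQ_power_zero)
      qed
      hence "\<forall>\<^sub>F k in sequentially. y k < q u v" using q0 by (rule order_tendstoD(2))
      then obtain k3 where "y k3 \<le> q u v" by (auto simp: eventually_sequentially intro: less_imp_le)
      \<comment> \<open>Minimality gives \<open>q u v < y (k - 1)\<close>, so that \<open>k\<close> is at most a multiple of the logarithm.\<close>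
      define k where "k = (LEAST k. y k \<le> q u v)"
      have k: "y k \<le> q u v" unfolding k_def by (rule LeastI) fact
      have k_gt: "k1 < k"
      proof (rule ccontr)
        assume "\<not> k1 < k"
        hence "y k1 \<le> y k" by (intro y_anti) auto
        thus False using k qk1 by simp
      qed
      have k': "q u v < y (k - 1)"
        using not_less_Least[of "k - 1" "\<lambda>k. y k \<le> q u v"] k_gt by (simp add: k_def[symmetric])
      note kk = k1[OF less_imp_le[OF k_gt]]
      have q1: "q u v \<le> 1" using qk1 y(2)[of k1] by simp
      have qpi: "q w (\<pi> k w) \<le> C1 * q u v" for w
      proof -
        have "norm (w - \<pi> k w) \<le> 2 * d / 2 ^ k"
          using pi_near[of w k] d by (auto intro!: order_trans[OF pi_near] divide_right_mono)
        hence "q w (\<pi> k w) \<le> C1 * y k" using kk by (intro step) auto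
        also have "\<dots> \<le> C1 * q u v" using k C1 by (intro mult_left_mono) auto
        finally show ?thesis .
      qed
      have "q (\<pi> k u) (\<pi> k v) \<le> \<kappa> * (q (\<pi> k u) v + q v (\<pi> k v))" by (rule \<kappa>)
      also have "\<dots> \<le> \<kappa> * (\<kappa> * (C1 * q u v + q u v) + \<kappa> * (C1 * q u v))"
      proof (intro mult_left_mono add_mono)
        have "q (\<pi> k u) v \<le> \<kappa> * (q (\<pi> k u) u + q u v)" by (rule \<kappa>)
        also have "\<dots> \<le> \<kappa> * (C1 * q u v + q u v)"
          using \<kappa>(1) qpi[of u] q(3)[of "\<pi> k u" u] by (intro mult_left_mono add_mono) auto
        finally show "q (\<pi> k u) v \<le> \<kappa> * (C1 * q u v + q u v)" .
        have "1 * (C1 * q u v) \<le> \<kappa> * (C1 * q u v)"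
          using \<kappa>(1) C1 q0 by (intro mult_right_mono) auto
        thus "q v (\<pi> k v) \<le> \<kappa> * (C1 * q u v)" using qpi[of v] by simp
      qed (use \<kappa>(1) in auto)
      also have "\<dots> = C3 * q u v" by (simp add: C3_def algebra_simps)
      finally have q3: "q (\<pi> k u) (\<pi> k v) \<le> C3 * q u v" .
      have "norm (\<pi> k u - \<pi> k v) \<le> norm (u - v) + norm (u - \<pi> k u) + norm (v - \<pi> k v)"
        using norm_diff_add_le[of "u - v" "u - \<pi> k u" "v - \<pi> k v"] by simp
      also have "\<dots> \<le> \<delta> + d / 2 ^ k + d / 2 ^ k"
        using pi_near[of u k] pi_near[of v k] uv(3) by (intro add_mono) auto
      also have "\<dots> \<le> \<delta>0" using \<delta> kk by simp
      finally have npi: "norm (\<pi> k u - \<pi> k v) \<le> \<delta>0" .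
      have "cmod (F (\<pi> k u) - F (\<pi> k v)) \<le> A * sqrt k * ?l (q (\<pi> k u) (\<pi> k v))"
        using kk npi uv by (intro FA) auto
      also have "\<dots> \<le> A * sqrt k * (D1 * ?l (q u v))"
        using A q3 q q0 q1 by (intro mult_left_mono cmp) auto
      also have "\<dots> = A * D1 * (sqrt k * ?l (q u v))" by simp
      also have "\<dots> \<le> A * D1 * (D2 * ?l' (q u v))"
        using A D1 q0 k' kk by (intro mult_left_mono sq) auto
      finally have mid: "cmod (F (\<pi> k u) - F (\<pi> k v)) \<le> A * (D1 * D2) * ?l' (q u v)" by (simp add: mult_ac)
      have ly: "?l' (y k) \<le> B2 * ?l' (q u v)"
      proof -
        have "?l' (y k) \<le> B2 * (y k / q u v) powr (\<beta> / 2) * ?l' (q u v)"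
          using y(1)[of k] k q0 q1 by (intro B2(2)) auto
        also have "\<dots> \<le> B2 * 1 * ?l' (q u v)"
          using y(1)[of k] k q0 B2(1) \<beta> by (intro mult_right_mono mult_left_mono powr_le1) auto
        finally show ?thesis by simp
      qed
      have fin: "cmod (F (\<pi> k w) - F w) \<le> A * (D * B2) * ?l' (q u v)" if "w \<in> K" for w
      proof -
        have "cmod (F (\<pi> k w) - F w) \<le> A * D * ?l' (y k)" using k_gt that by (intro approx) auto
        also have "\<dots> \<le> A * D * (B2 * ?l' (q u v))" using A D ly by (intro mult_left_mono) auto
        finally show ?thesis by (simp add: mult_ac)
      qed
      have "cmod (F u - F v) \<le> cmod (F (\<pi> k u) - F (\<pi> k v)) + cmod (F (\<pi> k u) - F u) + cmod (F (\<pi> k v) - F v)"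
        using norm_diff_add_le[of "F (\<pi> k u) - F (\<pi> k v)" "F (\<pi> k u) - F u" "F (\<pi> k v) - F v"] by simp
      also have "\<dots> \<le> A * (D1 * D2) * ?l' (q u v) + A * (D * B2) * ?l' (q u v) + A * (D * B2) * ?l' (q u v)"
        using mid fin[OF uv(1)] fin[OF uv(2)] by (intro add_mono) auto
      also have "\<dots> = B * A * ?l' (q u v)" by (simp add: B_def algebra_simps)
      finally show ?thesis .
    qed (use q[of v v] in simp)
    show ?thesis
    proof (intro exI[of _ \<delta>] conjI allI impI ballI \<delta>(1))
      fix F :: "real ^ 'd \<Rightarrow> complex" and A u v
      assume *: "continuous_on K F" "0 \<le> A" "u \<in> K" "v \<in> K" "norm (u - v) \<le> \<delta>"
        and FA: "\<forall>k\<ge>k0. \<forall>u v. (u, v) \<in> grid_pairs lo hi \<delta>0 k \<longrightarrow> cmod (F u - F v) \<le> A * sqrt k * ?l (q u v)"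
      show "cmod (F u - F v) \<le> B * A * ?l' (q u v)"
      proof (rule main[OF *(1,2) FA[rule_format] *(3-5)])
        show "(u, v) \<in> grid_pairs lo hi \<delta>0 k"
          if "u \<in> \<pi> k ` K \<union> \<pi> (Suc k) ` K" "v \<in> \<pi> k ` K \<union> \<pi> (Suc k) ` K" "norm (u - v) \<le> \<delta>0" for k u v
          using that unfolding grid_pairs_def K_def \<pi>_def by blast
      qed
    qed
  qed
  ultimately show thesis unfolding K_def by (rule that[OF _ allI])
qed

text \<open>
  Local control gives global control by walking along the segment in boundedly many steps.
\<close>

lemma convex_oscillation:
  fixes K :: "'a::real_normed_vector set"
  assumes "convex K" "bounded K" "0 < \<delta>"
  obtains m :: nat where
    "\<And>(G :: 'a \<Rightarrow> complex) b u v. (\<And>u v. u \<in> K \<Longrightarrow> v \<in> K \<Longrightarrow> norm (u - v) \<le> \<delta> \<Longrightarrow> cmod (G u - G v) \<le> b) \<Longrightarrow>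
       u \<in> K \<Longrightarrow> v \<in> K \<Longrightarrow> cmod (G u - G v) \<le> real m * b"
proof -
  obtain R where R: "\<And>u. u \<in> K \<Longrightarrow> norm u \<le> R" using assms(2) by (auto simp: bounded_iff)
  define m where "m = nat \<lceil>2 * R / \<delta>\<rceil> + 1"
  have m: "0 < m" "2 * R / real m \<le> \<delta>"
  proof -
    have "2 * R / \<delta> \<le> real m" unfolding m_def by linarith
    thus "2 * R / real m \<le> \<delta>" using assms(3) by (simp add: m_def field_simps)
  qed (simp add: m_def)
  have main: "cmod (G u - G v) \<le> real m * b"
    if G: "\<And>u v. u \<in> K \<Longrightarrow> v \<in> K \<Longrightarrow> norm (u - v) \<le> \<delta> \<Longrightarrow> cmod (G u - G v) \<le> b" and uv: "u \<in> K" "v \<in> K"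
    for G :: "'a \<Rightarrow> complex" and b u v
  proof -
    define w where "w i = v + (real i / real m) *\<^sub>R (u - v)" for i :: nat
    have wK: "w i \<in> K" if "i \<le> m" for i
    proof -
      have "w i = (1 - real i / real m) *\<^sub>R v + (real i / real m) *\<^sub>R u"
        by (simp add: w_def algebra_simps)
      thus ?thesis using assms(1) uv that m unfolding convex_alt by (auto simp: divide_le_eq)
    qed
    have step: "cmod (G (w (Suc i)) - G (w i)) \<le> b" if "i < m" for i
    proof (rule G)
      have "w (Suc i) - w i = (1 / real m) *\<^sub>R (u - v)"
        by (simp add: w_def scaleR_diff_left[symmetric] diff_divide_distrib[symmetric])
      hence "norm (w (Suc i) - w i) = norm (u - v) / real m" by simp
      also have "\<dots> \<le> 2 * R / real m"
        using norm_triangle_ineq4[of u v] R[OF uv(1)] R[OF uv(2)] m(1) by (intro divide_right_mono) auto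
      finally show "norm (w (Suc i) - w i) \<le> \<delta>" using m(2) by simp
    qed (use that in \<open>auto intro: wK\<close>)
    have "G u - G v = (\<Sum>i<m. G (w (Suc i)) - G (w i))"
      using m by (subst sum_lessThan_telescope) (simp add: w_def)
    also have "cmod \<dots> \<le> (\<Sum>i<m. b)" using step by (intro sum_norm_le) auto
    finally show ?thesis by simp
  qed
  show thesis by (rule that) (fact main)
qed

text \<open>
  Chaining gives the modulus for close pairs. Together with the bound at \<open>u0\<close> it bounds \<open>F\<close>, and
  this in turn gives the modulus for distant pairs.
\<close>

lemma modulus_from_grid:
  fixes q :: "real ^ 'd \<Rightarrow> real ^ 'd \<Rightarrow> real" and lo hi u0 :: "real ^ 'd"
  assumes qm: "quasi_metric q" and H: "0 < H" and c: "0 < c"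
    and up: "\<And>x y. norm (x - y) \<le> 1 \<Longrightarrow> q x y \<le> c * norm (x - y) powr H"
    and \<beta>: "0 < \<beta>" and e: "0 \<le> e" and \<delta>0: "0 < \<delta>0" and u0: "u0 \<in> cbox lo hi" and L: "0 \<le> L"
  obtains B where "0 < B"
    "\<And>F :: real ^ 'd \<Rightarrow> complex. continuous_on (cbox lo hi) F \<Longrightarrow> cmod (F u0) \<le> L \<Longrightarrow>
       (\<And>k u v. k \<ge> k0 \<Longrightarrow> (u, v) \<in> grid_pairs lo hi \<delta>0 k \<Longrightarrow> cmod (F u - F v) \<le> L * sqrt k * log_power \<beta> e (q u v)) \<Longrightarrow>
       (\<forall>u\<in>cbox lo hi. cmod (F u) \<le> B) \<and>
       (\<forall>u\<in>cbox lo hi. \<forall>v\<in>cbox lo hi. cmod (F u - F v) \<le> B * log_power \<beta> (e + 1 / 2) (q u v))"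
proof -
  let ?l = "log_power \<beta> e" and ?l' = "log_power \<beta> (e + 1 / 2)"
  define K where "K = cbox lo hi"
  have q0: "0 \<le> q u v" for u v using qm by (simp add: quasi_metric_def)
  obtain B1 \<delta>1 where B1: "0 < B1" and \<delta>1: "0 < \<delta>1" and
    ch: "\<forall>(F :: real ^ 'd \<Rightarrow> complex) A.
       continuous_on (cbox lo hi) F \<longrightarrow> 0 \<le> A \<longrightarrow>
       (\<forall>k\<ge>k0. \<forall>u v. (u, v) \<in> grid_pairs lo hi \<delta>0 k \<longrightarrow> cmod (F u - F v) \<le> A * sqrt k * ?l (q u v)) \<longrightarrow>
       (\<forall>u\<in>cbox lo hi. \<forall>v\<in>cbox lo hi. norm (u - v) \<le> \<delta>1 \<longrightarrow>
          cmod (F u - F v) \<le> B1 * A * ?l' (q u v))"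
    by (rule chaining[OF qm H c up \<beta> e \<delta>0, of lo hi]) (assumption, drule spec[of _ k0], elim exE conjE, rule that)
  obtain B2 where B2: "0 < B2" "\<And>x. 0 \<le> x \<Longrightarrow> x \<le> 1 \<Longrightarrow> ?l' x \<le> B2 * x powr (\<beta> / 2)"
    using log_power_le_powr[OF \<beta>, of "e + 1 / 2"] e by (metis add_nonneg_nonneg half_gt_zero_iff less_imp_le zero_less_one)
  define \<delta> where "\<delta> = min (min \<delta>1 1) ((1 / c) powr (1 / H))"
  have \<delta>: "0 < \<delta>" "\<delta> \<le> \<delta>1" "\<delta> \<le> 1" using \<delta>1 c by (auto simp: \<delta>_def)
  have q1: "q u v \<le> 1" if "norm (u - v) \<le> \<delta>" for u v
  proof -
    have "q u v \<le> c * norm (u - v) powr H" using that \<delta> by (intro up) auto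
    also have "\<dots> \<le> c * ((1 / c) powr (1 / H)) powr H"
      using that c H by (intro mult_left_mono powr_mono2) (auto simp: \<delta>_def)
    also have "\<dots> = 1" using c H by (simp add: powr_powr)
    finally show ?thesis .
  qed
  obtain m :: nat where m: "\<And>(G :: real ^ 'd \<Rightarrow> complex) b u v.
       (\<And>u v. u \<in> K \<Longrightarrow> v \<in> K \<Longrightarrow> norm (u - v) \<le> \<delta> \<Longrightarrow> cmod (G u - G v) \<le> b) \<Longrightarrow>
       u \<in> K \<Longrightarrow> v \<in> K \<Longrightarrow> cmod (G u - G v) \<le> real m * b"
    using convex_oscillation[of K \<delta>] \<delta>(1) unfolding K_def by (metis convex_box(1) bounded_cbox)
  obtain \<mu> where \<mu>: "0 < \<mu>" "\<And>u v. u \<in> K \<Longrightarrow> v \<in> K \<Longrightarrow> \<delta> \<le> norm (u - v) \<Longrightarrow> \<mu> \<le> ?l' (q u v)"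
    using log_power_quasi_metric_bounded_below[OF qm _ \<delta>(1), of K] unfolding K_def by (metis compact_cbox)
  define B3 where "B3 = L + real m * (B1 * L * B2)"
  define B where "B = max 1 (max B3 (max (B1 * L) (2 * B3 / \<mu>)))"
  have B: "0 < B" "B3 \<le> B" "B1 * L \<le> B" "2 * B3 / \<mu> \<le> B" by (auto simp: B_def)
  have main: "(\<forall>u\<in>cbox lo hi. cmod (F u) \<le> B) \<and>
       (\<forall>u\<in>cbox lo hi. \<forall>v\<in>cbox lo hi. cmod (F u - F v) \<le> B * ?l' (q u v))"
    if F: "continuous_on (cbox lo hi) F" "cmod (F u0) \<le> L"
      and FG: "\<And>k u v. k \<ge> k0 \<Longrightarrow> (u, v) \<in> grid_pairs lo hi \<delta>0 k \<Longrightarrow> cmod (F u - F v) \<le> L * sqrt k * ?l (q u v)"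
    for F :: "real ^ 'd \<Rightarrow> complex"
  proof -
    have loc: "cmod (F u - F v) \<le> B1 * L * ?l' (q u v)" if "u \<in> K" "v \<in> K" "norm (u - v) \<le> \<delta>" for u v
    proof -
      have "\<forall>k\<ge>k0. \<forall>u v. (u, v) \<in> grid_pairs lo hi \<delta>0 k \<longrightarrow> cmod (F u - F v) \<le> L * sqrt k * ?l (q u v)"
        using FG by blast
      thus ?thesis using ch[rule_format, OF F(1) L, of u v] that \<delta>(2) unfolding K_def by auto
    qed
    have osc: "cmod (F u - F v) \<le> real m * (B1 * L * B2)" if "u \<in> K" "v \<in> K" for u v
    proof (rule m[OF _ that])
      fix u v assume uv: "u \<in> K" "v \<in> K" "norm (u - v) \<le> \<delta>"
      have "?l' (q u v) \<le> B2 * q u v powr (\<beta> / 2)" by (intro B2 q0 q1 uv)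
      also have "\<dots> \<le> B2 * 1" using B2 q0 q1[OF uv(3)] \<beta> by (intro mult_left_mono powr_le1) auto
      finally have "B1 * L * ?l' (q u v) \<le> B1 * L * B2" using B1 L by (intro mult_left_mono) auto
      thus "cmod (F u - F v) \<le> B1 * L * B2" using loc[OF uv] by linarith
    qed
    have bd: "cmod (F u) \<le> B3" if "u \<in> K" for u
      using osc[OF that, of u0] u0 F(2) norm_triangle_ineq[of "F u - F u0" "F u0"]
      unfolding B3_def K_def by simp
    have "cmod (F u - F v) \<le> B * ?l' (q u v)" if uv: "u \<in> K" "v \<in> K" for u v
    proof (cases "norm (u - v) \<le> \<delta>")
      case True
      have "cmod (F u - F v) \<le> B1 * L * ?l' (q u v)" by (rule loc[OF uv True])
      also have "\<dots> \<le> B * ?l' (q u v)" using B by (intro mult_right_mono) auto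
      finally show ?thesis .
    next
      case False
      have "cmod (F u - F v) \<le> 2 * B3" using norm_triangle_ineq4[of "F u" "F v"] bd[OF uv(1)] bd[OF uv(2)] by linarith
      also have "\<dots> = 2 * B3 / \<mu> * \<mu>" using \<mu> by simp
      also have "\<dots> \<le> B * ?l' (q u v)"
        using B \<mu> uv False by (intro mult_mono) auto
      finally show ?thesis .
    qed
    thus ?thesis using bd B(2) unfolding K_def by force
  qed
  show thesis by (rule that[OF B(1)]) (fact main)
qed

section \<open>Sums of independent sub-Gaussian variables\<close>

lemma (in prob_space) indep_var_nn_integral_mult:
  fixes U V :: "'a \<Rightarrow> ennreal"
  assumes "indep_var borel U borel V"
  shows "(\<integral>\<^sup>+\<omega>. U \<omega> * V \<omega> \<partial>M) = (\<integral>\<^sup>+\<omega>. U \<omega> \<partial>M) * (\<integral>\<^sup>+\<omega>. V \<omega> \<partial>M)"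
proof -
  have "indep_vars (\<lambda>_. borel) (case_bool U V) UNIV"
    using assms unfolding indep_var_def by (rule indep_vars_cong[THEN iffD1, rotated 3]) (auto split: bool.splits)
  from indep_vars_nn_integral[OF _ this] show ?thesis by (simp add: UNIV_bool mult.commute)
qed

text \<open>
  Doob's inequality for the exponential submartingale. The induction on \<open>n\<close> proves the stronger
  bound in which the right-hand side is restricted to the event that the level \<open>t\<close> has already
  been reached: on that event the next increment is independent of the past and its exponential
  has mean at least \<open>1\<close>, while on the event that the level is first reached at time \<open>n + 1\<close> the
  exponential is at least \<open>exp t\<close>.
\<close>

lemma (in prob_space) exp_maximal_inequality:
  fixes Y :: "nat \<Rightarrow> 'a \<Rightarrow> real"
  assumes indep: "indep_vars (\<lambda>_. borel) Y {1..}"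
    and sub: "\<And>n. n \<ge> 1 \<Longrightarrow> 1 \<le> (\<integral>\<^sup>+\<omega>. ennreal (exp (Y n \<omega>)) \<partial>M)"
  shows "ennreal (exp t) * emeasure M {\<omega>\<in>space M. \<exists>n\<le>N. t \<le> (\<Sum>i=1..n. Y i \<omega>)}
    \<le> (\<integral>\<^sup>+\<omega>. ennreal (exp (\<Sum>i=1..N. Y i \<omega>)) \<partial>M)"
proof -
  have Y [measurable]: "Y n \<in> borel_measurable M" if "n \<ge> 1" for n
    using indep that by (auto simp: indep_vars_def)
  define S where "S n \<omega> = (\<Sum>i=1..n. Y i \<omega>)" for n \<omega>
  have S [measurable]: "S n \<in> borel_measurable M" for n
    unfolding S_def by (intro borel_measurable_sum) auto
  have S_Suc: "S (Suc n) \<omega> = S n \<omega> + Y (Suc n) \<omega>" for n \<omega> by (simp add: S_def)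
  define H where "H n = {\<omega>\<in>space M. \<exists>m\<le>n. t \<le> S m \<omega>}" for n
  have H [measurable]: "H n \<in> sets M" for n unfolding H_def by measurable
  let ?J = "\<lambda>A n. \<integral>\<^sup>+\<omega>. indicator A \<omega> * ennreal (exp (S n \<omega>)) \<partial>M"
  have "ennreal (exp t) * emeasure M (H n) \<le> ?J (H n) n" for n
  proof (induction n)
    case 0
    have "ennreal (exp t) * emeasure M (H 0) = (\<integral>\<^sup>+\<omega>. ennreal (exp t) * indicator (H 0) \<omega> \<partial>M)"
      by (simp add: nn_integral_cmult_indicator)
    also have "\<dots> \<le> ?J (H 0) 0"
      by (intro nn_integral_mono) (auto simp: H_def indicator_def intro!: ennreal_leI)
    finally show ?case .
  next
    case (Suc n)
    \<comment> \<open>The level is reached for the first time at step \<open>Suc n\<close>.\<close>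
    define H' where "H' = H (Suc n) - H n"
    have [measurable]: "H' \<in> sets M" unfolding H'_def by measurable
    have HU: "H (Suc n) = H n \<union> H'" "H n \<inter> H' = {}"
      by (auto simp: H'_def H_def intro: le_SucI)
    \<comment> \<open>The integrand of the induction hypothesis as a function of the first \<open>n\<close> variables.\<close>
    define \<phi> :: "(nat \<Rightarrow> real) \<Rightarrow> ennreal" where
      "\<phi> x = indicator {x. \<exists>m\<le>n. t \<le> (\<Sum>i=1..m. x i)} x * ennreal (exp (\<Sum>i=1..n. x i))" for x
    have [measurable]: "(\<lambda>x. \<Sum>i=1..m. x i) \<in> borel_measurable (PiM {1..n} (\<lambda>_. borel :: real measure))" if "m \<le> n" for m
      using that by (intro borel_measurable_sum measurable_component_singleton) auto
    have \<phi>: "\<phi> \<in> borel_measurable (PiM {1..n} (\<lambda>_. borel))"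
    proof -
      have "\<phi> = (\<lambda>x. (if \<exists>m\<in>{..n}. t \<le> (\<Sum>i=1..m. x i) then 1 else 0) * ennreal (exp (\<Sum>i=1..n. x i)))"
        by (auto simp: \<phi>_def fun_eq_iff indicator_def)
      also have "\<dots> \<in> borel_measurable (PiM {1..n} (\<lambda>_. borel))"
        by (intro borel_measurable_times_ennreal measurable_If borel_measurable_const) measurable
      finally show ?thesis .
    qed
    have "indep_var (PiM {1..n} (\<lambda>_. borel)) (\<lambda>\<omega>. restrict (\<lambda>i. Y i \<omega>) {1..n})
       (PiM {Suc n} (\<lambda>_. borel)) (\<lambda>\<omega>. restrict (\<lambda>i. Y i \<omega>) {Suc n})"
      by (rule indep_var_restrict[OF indep]) auto
    hence "indep_var borel (\<phi> \<circ> (\<lambda>\<omega>. restrict (\<lambda>i. Y i \<omega>) {1..n}))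
        borel ((\<lambda>x. ennreal (exp (x (Suc n)))) \<circ> (\<lambda>\<omega>. restrict (\<lambda>i. Y i \<omega>) {Suc n}))"
      by (rule indep_var_compose) (use \<phi> in \<open>simp_all\<close>)
    from indep_var_nn_integral_mult[OF this]
    have prod: "(\<integral>\<^sup>+\<omega>. \<phi> (restrict (\<lambda>i. Y i \<omega>) {1..n}) * ennreal (exp (Y (Suc n) \<omega>)) \<partial>M)
      = (\<integral>\<^sup>+\<omega>. \<phi> (restrict (\<lambda>i. Y i \<omega>) {1..n}) \<partial>M) * (\<integral>\<^sup>+\<omega>. ennreal (exp (Y (Suc n) \<omega>)) \<partial>M)"
      by simp
    have \<phi>_eq: "\<phi> (restrict (\<lambda>i. Y i \<omega>) {1..n}) = indicator (H n) \<omega> * ennreal (exp (S n \<omega>))"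
      if "\<omega> \<in> space M" for \<omega>
    proof -
      have "(\<Sum>i=1..m. restrict (\<lambda>i. Y i \<omega>) {1..n} i) = S m \<omega>" if "m \<le> n" for m
        unfolding S_def using that by (intro sum.cong) auto
      thus ?thesis using that by (auto simp: \<phi>_def H_def indicator_def)
    qed
    have "ennreal (exp t) * emeasure M (H (Suc n)) =
        ennreal (exp t) * emeasure M (H n) * 1 + ennreal (exp t) * emeasure M H'"
      unfolding HU(1) using HU(2) by (simp add: plus_emeasure[symmetric] distrib_left)
    also have "\<dots> \<le> ?J (H n) n * (\<integral>\<^sup>+\<omega>. ennreal (exp (Y (Suc n) \<omega>)) \<partial>M)
        + ennreal (exp t) * emeasure M H'"
      using Suc sub[of "Suc n"] by (intro add_mono mult_mono) auto
    also have "?J (H n) n * (\<integral>\<^sup>+\<omega>. ennreal (exp (Y (Suc n) \<omega>)) \<partial>M)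
       = (\<integral>\<^sup>+\<omega>. \<phi> (restrict (\<lambda>i. Y i \<omega>) {1..n}) * ennreal (exp (Y (Suc n) \<omega>)) \<partial>M)"
      unfolding prod by (intro arg_cong2[where f="(*)"] nn_integral_cong refl \<phi>_eq[symmetric])
    also have "\<dots> = ?J (H n) (Suc n)"
      by (intro nn_integral_cong) (simp only: \<phi>_eq S_Suc exp_add ennreal_mult exp_ge_zero mult.assoc)
    also have "ennreal (exp t) * emeasure M H' = (\<integral>\<^sup>+\<omega>. ennreal (exp t) * indicator H' \<omega> \<partial>M)"
      by (simp add: nn_integral_cmult_indicator)
    also have "\<dots> \<le> ?J H' (Suc n)"
      by (intro nn_integral_mono) (auto simp: H'_def H_def indicator_def le_Suc_eq intro!: ennreal_leI)
    also have "?J (H n) (Suc n)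
        + ?J H' (Suc n)
       = (\<integral>\<^sup>+\<omega>. indicator (H n) \<omega> * ennreal (exp (S (Suc n) \<omega>)) + indicator H' \<omega> * ennreal (exp (S (Suc n) \<omega>)) \<partial>M)"
      by (rule nn_integral_add[symmetric]) measurable
    also have "\<dots> = ?J (H (Suc n)) (Suc n)"
      using HU by (intro nn_integral_cong) (auto simp: indicator_def)
    finally show ?case by (simp add: add_left_mono)
  qed
  also have "?J (H N) N \<le> (\<integral>\<^sup>+\<omega>. ennreal (exp (S N \<omega>)) \<partial>M)"
    by (intro nn_integral_mono) (auto simp: indicator_def)
  finally show ?thesis by (simp add: H_def S_def)
qed

text \<open>
  By symmetry the mean of \<open>exp Y\<close> is that of \<open>cosh Y\<close>.
\<close>

lemma (in prob_space) symmetric_exp_ge_1: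
  assumes "symmetric_rv M Z"
  shows "1 \<le> (\<integral>\<^sup>+\<omega>. ennreal (exp (Re (cnj z * Z \<omega>))) \<partial>M)"
proof -
  have [measurable]: "Z \<in> borel_measurable M" and Z: "distr M borel Z = distr M borel (\<lambda>\<omega>. - Z \<omega>)"
    using assms by (auto simp: symmetric_rv_def)
  define I where "I = (\<integral>\<^sup>+\<omega>. ennreal (exp (Re (cnj z * Z \<omega>))) \<partial>M)"
  have "I = (\<integral>\<^sup>+x. ennreal (exp (Re (cnj z * x))) \<partial>distr M borel Z)"
    unfolding I_def by (subst nn_integral_distr) auto
  also have "\<dots> = (\<integral>\<^sup>+\<omega>. ennreal (exp (- Re (cnj z * Z \<omega>))) \<partial>M)"
    unfolding Z by (subst nn_integral_distr) auto
  finally have "I + I = (\<integral>\<^sup>+\<omega>. ennreal (exp (Re (cnj z * Z \<omega>))) + ennreal (exp (- Re (cnj z * Z \<omega>))) \<partial>M)"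
    by (subst nn_integral_add) (auto simp: I_def)
  also have "\<dots> \<ge> (\<integral>\<^sup>+\<omega>. 2 \<partial>M)"
  proof (rule nn_integral_mono)
    fix \<omega>
    have "2 \<le> exp x + exp (- x)" for x :: real
      using cosh_real_ge_1[of x] by (simp add: cosh_def)
    hence "ennreal 2 \<le> ennreal (exp x + exp (- x))" for x :: real by (rule ennreal_leI)
    thus "2 \<le> ennreal (exp (Re (cnj z * Z \<omega>))) + ennreal (exp (- Re (cnj z * Z \<omega>)))"
      by (simp only: ennreal_plus exp_ge_zero ennreal_numeral)
  qed
  finally have "2 * 1 \<le> 2 * I" by (simp add: mult_2 emeasure_space_1)
  thus ?thesis unfolding I_def[symmetric] using ennreal_mult_le_mult_iff[of 2 1 I] by simp
qed

text \<open>
  The inequality \<open>exp_maximal_inequality\<close> for the real parts in the four directions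
  \<open>1, -1, \<i>, -\<i>\<close>, one of which captures at least half of the modulus.
\<close>

lemma (in prob_space) sub_gaussian_maximal_inequality:
  fixes g :: "nat \<Rightarrow> 'a \<Rightarrow> complex" and c :: "nat \<Rightarrow> complex"
  assumes indep: "indep_vars (\<lambda>_. borel) g {1..}"
    and sym: "\<And>n. n \<ge> 1 \<Longrightarrow> symmetric_rv M (g n)"
    and sg: "\<And>n. n \<ge> 1 \<Longrightarrow> sub_gaussian M (g n) 1"
    and s: "0 < s" "\<And>N. (\<Sum>n=1..N. (cmod (c n))\<^sup>2) \<le> s\<^sup>2" and t: "0 \<le> t"
  shows "prob {\<omega>\<in>space M. \<exists>n. t \<le> cmod (\<Sum>i=1..n. c i * g i \<omega>)} \<le> 4 * exp (- (t\<^sup>2 / (8 * s\<^sup>2)))"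
proof -
  have [measurable]: "g n \<in> borel_measurable M" if "n \<ge> 1" for n
    using indep that by (auto simp: indep_vars_def)
  define S where "S n \<omega> = (\<Sum>i=1..n. c i * g i \<omega>)" for n \<omega>
  have S [measurable]: "S n \<in> borel_measurable M" for n
    unfolding S_def by (intro borel_measurable_sum) auto
  define E where "E z N = {\<omega>\<in>space M. \<exists>n\<le>N. t / 2 \<le> Re (cnj z * S n \<omega>)}" for z N
  have [measurable]: "E z N \<in> sets M" for z N unfolding E_def by measurable
  have one_dir: "prob (E z N) \<le> exp (- (t\<^sup>2 / (8 * s\<^sup>2)))" if z: "cmod z = 1" for z N
  proof -
    \<comment> \<open>The minimiser of \<open>\<theta>\<^sup>2 s\<^sup>2 / 2 - \<theta> t / 2\<close>.\<close>
    define \<theta> where "\<theta> = t / (2 * s\<^sup>2)"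
    have \<theta>: "0 \<le> \<theta>" using t by (simp add: \<theta>_def)
    define Y where "Y n \<omega> = Re (cnj (of_real \<theta> * z * cnj (c n)) * g n \<omega>)" for n \<omega>
    have indY: "indep_vars (\<lambda>_. borel) Y {1..}"
      unfolding Y_def by (rule indep_vars_compose2[OF indep]) auto
    have sumY: "(\<Sum>i=1..n. Y i \<omega>) = \<theta> * Re (cnj z * S n \<omega>)" for n \<omega>
      by (simp add: Y_def S_def sum_distrib_left algebra_simps sum_subtractf sum.distrib Re_sum)
    have "ennreal (exp (\<theta> * (t / 2))) * emeasure M {\<omega>\<in>space M. \<exists>n\<le>N. \<theta> * (t / 2) \<le> (\<Sum>i=1..n. Y i \<omega>)}
        \<le> (\<integral>\<^sup>+\<omega>. ennreal (exp (\<Sum>i=1..N. Y i \<omega>)) \<partial>M)"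
    proof (rule exp_maximal_inequality[OF indY])
      show "1 \<le> (\<integral>\<^sup>+\<omega>. ennreal (exp (Y n \<omega>)) \<partial>M)" if "n \<ge> 1" for n
        unfolding Y_def by (intro symmetric_exp_ge_1 sym that)
    qed
    also have "\<dots> = (\<integral>\<^sup>+\<omega>. (\<Prod>i\<in>{1..N}. ennreal (exp (Y i \<omega>))) \<partial>M)"
      by (simp add: exp_sum prod_ennreal)
    also have "\<dots> = (\<Prod>i\<in>{1..N}. \<integral>\<^sup>+\<omega>. ennreal (exp (Y i \<omega>)) \<partial>M)"
    proof (rule indep_vars_nn_integral)
      show "indep_vars (\<lambda>_. borel) (\<lambda>i \<omega>. ennreal (exp (Y i \<omega>))) {1..N}"
        using indep_vars_subset[OF indY, of "{1..N}"] by (rule indep_vars_compose2) auto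
    qed auto
    also have "\<dots> \<le> (\<Prod>i\<in>{1..N}. ennreal (exp (\<theta>\<^sup>2 * (cmod (c i))\<^sup>2 / 2)))"
    proof (rule prod_mono_ennreal)
      fix i assume "i \<in> {1..N}"
      hence "sub_gaussian M (g i) 1" by (intro sg) auto
      hence "(\<integral>\<^sup>+\<omega>. ennreal (exp (Y i \<omega>)) \<partial>M) \<le> ennreal (exp (1\<^sup>2 * (cmod (of_real \<theta> * z * cnj (c i)))\<^sup>2 / 2))"
        unfolding sub_gaussian_def Y_def by blast
      thus "(\<integral>\<^sup>+\<omega>. ennreal (exp (Y i \<omega>)) \<partial>M) \<le> ennreal (exp (\<theta>\<^sup>2 * (cmod (c i))\<^sup>2 / 2))"
        using z by (simp add: norm_mult power_mult_distrib)
    qed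
    also have "\<dots> = ennreal (exp (\<theta>\<^sup>2 / 2 * (\<Sum>i=1..N. (cmod (c i))\<^sup>2)))"
      by (simp add: prod_ennreal exp_sum[symmetric] sum_distrib_left)
    also have "\<dots> \<le> ennreal (exp (\<theta>\<^sup>2 / 2 * s\<^sup>2))"
      using s(2)[of N] by (intro ennreal_leI) (auto intro!: mult_left_mono divide_right_mono)
    finally have le: "ennreal (exp (\<theta> * (t / 2))) * emeasure M {\<omega>\<in>space M. \<exists>n\<le>N. \<theta> * (t / 2) \<le> \<theta> * Re (cnj z * S n \<omega>)}
       \<le> ennreal (exp (\<theta>\<^sup>2 / 2 * s\<^sup>2))" by (simp only: sumY)
    have "E z N \<subseteq> {\<omega>\<in>space M. \<exists>n\<le>N. \<theta> * (t / 2) \<le> \<theta> * Re (cnj z * S n \<omega>)}"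
      using mult_left_mono[OF _ \<theta>] unfolding E_def by blast
    hence "prob (E z N) \<le> prob {\<omega>\<in>space M. \<exists>n\<le>N. \<theta> * (t / 2) \<le> \<theta> * Re (cnj z * S n \<omega>)}"
      by (intro finite_measure_mono) measurable
    also have "\<dots> \<le> exp (\<theta>\<^sup>2 / 2 * s\<^sup>2) / exp (\<theta> * (t / 2))"
      using le by (simp add: emeasure_eq_measure ennreal_mult[symmetric] field_simps del: times_complex.sel)
    also have "\<dots> = exp (\<theta>\<^sup>2 / 2 * s\<^sup>2 - \<theta> * (t / 2))" by (simp add: exp_diff)
    also have "\<theta>\<^sup>2 / 2 * s\<^sup>2 - \<theta> * (t / 2) = - (t\<^sup>2 / (8 * s\<^sup>2))"
      using s by (simp add: \<theta>_def field_simps power2_eq_square)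
    finally show ?thesis .
  qed
  define F where "F N = {\<omega>\<in>space M. \<exists>n\<le>N. t \<le> cmod (S n \<omega>)}" for N
  have [measurable]: "F N \<in> sets M" for N unfolding F_def by measurable
  have FN: "prob (F N) \<le> 4 * exp (- (t\<^sup>2 / (8 * s\<^sup>2)))" for N
  proof -
    have "F N \<subseteq> (\<Union>z\<in>{1, -1, \<i>, -\<i>}. E z N)"
    proof
      fix \<omega> assume "\<omega> \<in> F N"
      then obtain n where n: "n \<le> N" "t \<le> cmod (S n \<omega>)" "\<omega> \<in> space M" by (auto simp: F_def)
      have "t / 2 \<le> Re (S n \<omega>) \<or> t / 2 \<le> - Re (S n \<omega>) \<or> t / 2 \<le> Im (S n \<omega>) \<or> t / 2 \<le> - Im (S n \<omega>)"
        using cmod_le[of "S n \<omega>"] n(2) by linarith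
      thus "\<omega> \<in> (\<Union>z\<in>{1, -1, \<i>, -\<i>}. E z N)" using n by (auto simp: E_def)
    qed
    hence "prob (F N) \<le> prob (\<Union>z\<in>{1, -1, \<i>, -\<i>}. E z N)"
      by (intro finite_measure_mono) auto
    also have "\<dots> \<le> (\<Sum>z\<in>{1, -1, \<i>, -\<i>}. prob (E z N))"
      by (intro finite_measure_subadditive_finite) auto
    also have "\<dots> \<le> (\<Sum>z\<in>{1, -1, \<i>, -\<i>}. exp (- (t\<^sup>2 / (8 * s\<^sup>2))))"
      by (intro sum_mono one_dir) auto
    also have "\<dots> = 4 * exp (- (t\<^sup>2 / (8 * s\<^sup>2)))"
      by (simp add: complex_eq_iff)
    finally show ?thesis .
  qed
  have "incseq F" unfolding F_def by (intro incseq_SucI) (auto intro: le_SucI)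
  hence "(\<lambda>N. prob (F N)) \<longlonglongrightarrow> prob (\<Union>N. F N)"
    by (intro finite_Lim_measure_incseq) auto
  hence "prob (\<Union>N. F N) \<le> 4 * exp (- (t\<^sup>2 / (8 * s\<^sup>2)))"
    by (rule LIMSEQ_le_const2) (use FN in auto)
  also have "(\<Union>N. F N) = {\<omega>\<in>space M. \<exists>n. t \<le> cmod (S n \<omega>)}"
    by (auto simp: F_def)
  finally show ?thesis by (simp add: S_def)
qed

text \<open>
  A union bound over exponentially many sums costs only a factor \<open>sqrt k\<close>, by the Borel--Cantelli
  lemma. The constant \<open>L\<close> is a natural number so that existential quantification over it is
  countable and preserves measurability.
\<close>

lemma (in prob_space) AE_sub_gaussian_sums_le:
  fixes g :: "nat \<Rightarrow> 'a \<Rightarrow> complex" and A :: "nat \<Rightarrow> real"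
    and P :: "nat \<Rightarrow> 'i set" and d :: "'i \<Rightarrow> nat \<Rightarrow> complex" and w :: "'i \<Rightarrow> real"
  assumes indep: "indep_vars (\<lambda>_. borel) g {1..}"
    and sym: "\<And>n. n \<ge> 1 \<Longrightarrow> symmetric_rv M (g n)"
    and sg: "\<And>n. n \<ge> 1 \<Longrightarrow> sub_gaussian M (g n) 1"
    and A: "summable (\<lambda>n. (A n)\<^sup>2)"
    and P: "\<And>k. finite (P k)" "\<And>k. card (P k) \<le> C * B ^ k"
    and w: "\<And>i. 0 \<le> w i"
    and d: "\<And>k i n. i \<in> P k \<Longrightarrow> n \<ge> 1 \<Longrightarrow> cmod (d i n) \<le> A n * w i"
  shows "\<exists>L::nat. AE \<omega> in M. \<exists>k0. \<forall>k\<ge>k0. \<forall>i\<in>P k. \<forall>N.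
    cmod (\<Sum>n=1..N. d i n * g n \<omega>) \<le> real L * sqrt (real k) * w i"
proof -
  have [measurable]: "g n \<in> borel_measurable M" if "n \<ge> 1" for n
    using indep that by (auto simp: indep_vars_def)
  \<comment> \<open>Adding \<open>1\<close> keeps the variance proxy positive when all \<open>A n\<close> vanish.\<close>
  define s where "s = sqrt (\<Sum>n. (A n)\<^sup>2) + 1"
  have s0: "0 \<le> (\<Sum>n. (A n)\<^sup>2)" by (intro suminf_nonneg A) auto
  hence s: "0 < s" by (simp add: s_def add_nonneg_pos)
  have sA: "(\<Sum>n=1..N. (A n)\<^sup>2) \<le> s\<^sup>2" for N
  proof -
    have "(\<Sum>n=1..N. (A n)\<^sup>2) \<le> (\<Sum>n. (A n)\<^sup>2)" by (intro sum_le_suminf A) auto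
    also have "\<dots> = (sqrt (\<Sum>n. (A n)\<^sup>2))\<^sup>2" using s0 by simp
    also have "\<dots> \<le> s\<^sup>2" using s0 by (intro power_mono) (auto simp: s_def)
    finally show ?thesis .
  qed
  \<comment> \<open>The factor \<open>exp (- \<kappa> * k)\<close> must beat the number of sums \<open>C * B ^ k\<close> and leave \<open>exp (- k)\<close>.\<close>
  define \<kappa> where "\<kappa> = ln (real B + 1) + 1"
  have \<kappa>: "0 < \<kappa>" by (simp add: \<kappa>_def add_nonneg_pos)
  define \<tau> where "\<tau> = sqrt (8 * \<kappa>)"
  define L where "L = nat \<lceil>\<tau> * s\<rceil>"
  have L: "\<tau> * s \<le> real L" unfolding L_def by linarith
  define bad where "bad k i = {\<omega>\<in>space M. \<exists>N. \<tau> * sqrt (real k) * (s * w i) \<le> cmod (\<Sum>n=1..N. d i n * g n \<omega>)}" for k i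
  have [measurable]: "bad k i \<in> sets M" for k i
  proof -
    have [measurable]: "(\<lambda>\<omega>. \<Sum>n=1..N. d i n * g n \<omega>) \<in> borel_measurable M" for N
      by (intro borel_measurable_sum borel_measurable_times borel_measurable_const) auto
    show ?thesis unfolding bad_def by measurable
  qed
  have prob_bad: "prob (bad k i) \<le> 4 * exp (- (\<kappa> * real k))" if i: "i \<in> P k" "0 < w i" for k i
  proof -
    have "prob (bad k i) \<le> 4 * exp (- ((\<tau> * sqrt (real k) * (s * w i))\<^sup>2 / (8 * (s * w i)\<^sup>2)))"
      unfolding bad_def
    proof (rule sub_gaussian_maximal_inequality[OF indep sym sg])
      show "0 < s * w i" using s i by simp
      show "(\<Sum>n=1..N. (cmod (d i n))\<^sup>2) \<le> (s * w i)\<^sup>2" for N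
      proof -
        have "(\<Sum>n=1..N. (cmod (d i n))\<^sup>2) \<le> (\<Sum>n=1..N. (A n * w i)\<^sup>2)"
          using d[OF i(1)] by (intro sum_mono power_mono) auto
        also have "\<dots> = (\<Sum>n=1..N. (A n)\<^sup>2) * (w i)\<^sup>2" by (simp add: power_mult_distrib sum_distrib_right)
        also have "\<dots> \<le> (s * w i)\<^sup>2" using sA[of N] by (simp add: power_mult_distrib mult_right_mono)
        finally show ?thesis .
      qed
      show "0 \<le> \<tau> * sqrt (real k) * (s * w i)" using \<kappa> s i by (simp add: \<tau>_def)
    qed auto
    also have "(\<tau> * sqrt (real k) * (s * w i))\<^sup>2 / (8 * (s * w i)\<^sup>2) = \<kappa> * real k"
      using s i \<kappa> by (simp add: \<tau>_def power_mult_distrib)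
    finally show ?thesis .
  qed
  define Bad where "Bad k = (\<Union>i\<in>{i\<in>P k. 0 < w i}. bad k i)" for k
  have [measurable]: "Bad k \<in> sets M" for k unfolding Bad_def using P(1)[of k] by (intro sets.finite_UN) auto
  have prob_Bad: "prob (Bad k) \<le> 4 * real C * exp (- 1) ^ k" for k
  proof -
    have "prob (Bad k) \<le> (\<Sum>i\<in>{i\<in>P k. 0 < w i}. prob (bad k i))"
      unfolding Bad_def using P(1) by (intro finite_measure_subadditive_finite) auto
    also have "\<dots> \<le> (\<Sum>i\<in>{i\<in>P k. 0 < w i}. 4 * exp (- (\<kappa> * real k)))"
      by (intro sum_mono prob_bad) auto
    also have "\<dots> \<le> (\<Sum>i\<in>P k. 4 * exp (- (\<kappa> * real k)))"
      using P(1) by (intro sum_mono2) auto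
    also have "\<dots> = real (card (P k)) * (4 * exp (- (\<kappa> * real k)))" by simp
    also have "\<dots> \<le> (real C * (real B + 1) ^ k) * (4 * exp (- (\<kappa> * real k)))"
    proof (intro mult_right_mono)
      have "real (card (P k)) \<le> real (C * B ^ k)" using P(2)[of k] by (rule of_nat_mono)
      also have "\<dots> \<le> real C * (real B + 1) ^ k" by (auto intro!: mult_left_mono power_mono)
      finally show "real (card (P k)) \<le> real C * (real B + 1) ^ k" .
    qed auto
    also have "exp (- (\<kappa> * real k)) = exp (- 1) ^ k / (real B + 1) ^ k"
    proof -
      have "- (\<kappa> * real k) = real k * (- 1) - real k * ln (real B + 1)" by (simp add: \<kappa>_def algebra_simps)
      thus ?thesis by (simp only: exp_diff exp_of_nat_mult) simp
    qed
    also have "real C * (real B + 1) ^ k * (4 * (exp (- 1) ^ k / (real B + 1) ^ k)) = 4 * real C * exp (- 1) ^ k"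
    proof -
      have "(real B + 1) ^ k \<noteq> 0" by (simp add: add_nonneg_eq_0_iff)
      thus ?thesis by simp
    qed
    finally show ?thesis .
  qed
  have "summable (\<lambda>k. prob (Bad k))"
  proof (rule summable_comparison_test')
    show "summable (\<lambda>k. 4 * real C * exp (- 1 :: real) ^ k)"
      by (intro summable_mult summable_geometric) auto
    show "norm (prob (Bad k)) \<le> 4 * real C * exp (- 1) ^ k" if "k \<ge> 0" for k
      using prob_Bad[of k] by simp
  qed
  hence "AE \<omega> in M. eventually (\<lambda>k. \<omega> \<in> space M - Bad k) sequentially"
    by (intro borel_cantelli_AE1) (auto simp: emeasure_eq_measure)
  hence "AE \<omega> in M. \<exists>k0. \<forall>k\<ge>k0. \<forall>i\<in>P k. \<forall>N.
    cmod (\<Sum>n=1..N. d i n * g n \<omega>) \<le> real L * sqrt (real k) * w i"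
  proof eventually_elim
    case (elim \<omega>)
    then obtain k0 where k0: "\<And>k. k \<ge> k0 \<Longrightarrow> \<omega> \<in> space M - Bad k" by (auto simp: eventually_sequentially)
    have "cmod (\<Sum>n=1..N. d i n * g n \<omega>) \<le> real L * sqrt (real k) * w i"
      if k: "k \<ge> k0" and i: "i \<in> P k" for k i N
    proof (cases "w i = 0")
      case True
      hence "d i n = 0" if "n \<ge> 1" for n using d[OF i that] by simp
      thus ?thesis using True by simp
    next
      case False
      hence "0 < w i" using w[of i] by simp
      hence "cmod (\<Sum>n=1..N. d i n * g n \<omega>) \<le> \<tau> * sqrt (real k) * (s * w i)"
        using k0[OF k] i unfolding Bad_def bad_def by (auto simp: not_le less_imp_le)
      also have "\<dots> = (\<tau> * s) * (sqrt (real k) * w i)" by simp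
      also have "\<dots> \<le> real L * (sqrt (real k) * w i)" using L w[of i] by (intro mult_right_mono) auto
      finally show ?thesis by simp
    qed
    thus ?case by blast
  qed
  thus ?thesis by blast
qed

text \<open>
  A bound for all partial sums of \<open>\<Sum> c\<^sub>n x\<^sub>n\<close> that mentions countably many points and constants only,
  hence is an event when the coefficients and the \<open>x\<^sub>n\<close> are random. It determines the behaviour
  on the whole box through \<open>modulus_from_grid\<close>.
\<close>

definition grid_bounded ::
    "real ^ 'd \<Rightarrow> real ^ 'd \<Rightarrow> real \<Rightarrow> (real ^ 'd \<Rightarrow> real ^ 'd \<Rightarrow> real) \<Rightarrow> real ^ 'd \<Rightarrow>
     (nat \<Rightarrow> real ^ 'd \<Rightarrow> complex) \<Rightarrow> (nat \<Rightarrow> complex) \<Rightarrow> bool" where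
  "grid_bounded lo hi \<delta> w u0 c x \<longleftrightarrow>
     (\<exists>L k0 :: nat. \<forall>k\<ge>k0. \<forall>i\<in>grid_pairs lo hi \<delta> k. \<forall>N.
        cmod (\<Sum>n=1..N. (c n (fst i) - c n (snd i)) * x n) \<le> real L * sqrt (real k) * w (fst i) (snd i)) \<and>
     (\<exists>L :: nat. \<forall>N. cmod (\<Sum>n=1..N. c n u0 * x n) \<le> real L)"

lemma grid_bounded_cong:
  assumes "\<And>n. n \<ge> 1 \<Longrightarrow> c n = c' n" "\<And>n. n \<ge> 1 \<Longrightarrow> x n = x' n"
  shows "grid_bounded lo hi \<delta> w u0 c x \<longleftrightarrow> grid_bounded lo hi \<delta> w u0 c' x'"
proof -
  have "(\<Sum>n=1..N. (c n u - c n v) * x n) = (\<Sum>n=1..N. (c' n u - c' n v) * x' n)"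
    "(\<Sum>n=1..N. c n u * x n) = (\<Sum>n=1..N. c' n u * x' n)" for N u v
    using assms by (auto intro!: sum.cong)
  thus ?thesis unfolding grid_bounded_def by presburger
qed

lemma (in prob_space) AE_grid_bounded:
  fixes g :: "nat \<Rightarrow> 'a \<Rightarrow> complex" and A :: "nat \<Rightarrow> real" and lo hi u0 :: "real ^ 'd"
  assumes g: "indep_vars (\<lambda>_. borel) g {1..}" "\<And>n. n \<ge> 1 \<Longrightarrow> symmetric_rv M (g n)"
    "\<And>n. n \<ge> 1 \<Longrightarrow> sub_gaussian M (g n) 1"
    and A: "summable (\<lambda>n. (A n)\<^sup>2)" and w: "\<And>u v. 0 \<le> w u v"
    and c: "\<And>n. n \<ge> 1 \<Longrightarrow> cmod (c n u0) \<le> A n"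
      "\<And>n u v. n \<ge> 1 \<Longrightarrow> u \<in> cbox lo hi \<Longrightarrow> v \<in> cbox lo hi \<Longrightarrow> norm (u - v) \<le> \<delta> \<Longrightarrow>
         cmod (c n u - c n v) \<le> A n * w u v"
  shows "AE \<omega> in M. grid_bounded lo hi \<delta> w u0 c (\<lambda>n. g n \<omega>)"
proof -
  obtain C B :: nat where P: "\<And>k. finite (grid_pairs lo hi \<delta> k)" "\<And>k. card (grid_pairs lo hi \<delta> k) \<le> C * B ^ k"
    using grid_pairs_card[of lo hi \<delta>] by metis
  have "\<exists>L::nat. AE \<omega> in M. \<exists>k0. \<forall>k\<ge>k0. \<forall>i\<in>grid_pairs lo hi \<delta> k. \<forall>N.
      cmod (\<Sum>n=1..N. (c n (fst i) - c n (snd i)) * g n \<omega>) \<le> real L * sqrt (real k) * w (fst i) (snd i)"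
    by (rule AE_sub_gaussian_sums_le[OF g A P w])
       (auto intro!: c(2) dest: grid_pairs_in_cbox)
  then obtain L :: nat where L: "AE \<omega> in M. \<exists>k0. \<forall>k\<ge>k0. \<forall>i\<in>grid_pairs lo hi \<delta> k. \<forall>N.
      cmod (\<Sum>n=1..N. (c n (fst i) - c n (snd i)) * g n \<omega>) \<le> real L * sqrt (real k) * w (fst i) (snd i)" ..
  have "\<exists>L::nat. AE \<omega> in M. \<exists>k0. \<forall>k\<ge>k0. \<forall>i\<in>{()}. \<forall>N.
      cmod (\<Sum>n=1..N. c n u0 * g n \<omega>) \<le> real L * sqrt (real k) * 1"
    by (rule AE_sub_gaussian_sums_le[OF g A, of "\<lambda>_. {()}" 1 1]) (auto intro!: c(1))
  then obtain L' :: nat where L': "AE \<omega> in M. \<exists>k0. \<forall>k\<ge>k0. \<forall>i\<in>{()}. \<forall>N.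
      cmod (\<Sum>n=1..N. c n u0 * g n \<omega>) \<le> real L' * sqrt (real k) * 1" ..
  from L L' show ?thesis
  proof eventually_elim
    case (elim \<omega>)
    from elim(2) obtain k0 where "\<forall>k\<ge>k0. \<forall>i\<in>{()}. \<forall>N. cmod (\<Sum>n=1..N. c n u0 * g n \<omega>) \<le> real L' * sqrt (real k) * 1" ..
    hence k0: "\<And>N. cmod (\<Sum>n=1..N. c n u0 * g n \<omega>) \<le> real L' * sqrt (real k0)" by simp
    obtain L'' :: nat where "real L' * sqrt (real k0) \<le> real L''" using real_arch_simple by blast
    hence "\<And>N. cmod (\<Sum>n=1..N. c n u0 * g n \<omega>) \<le> real L''" using k0 order_trans by blast
    thus ?case unfolding grid_bounded_def using elim(1) by blast
  qed
qed

lemma grid_bounded_imp_uniform_bound: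
  fixes q :: "real ^ 'd \<Rightarrow> real ^ 'd \<Rightarrow> real" and lo hi u0 :: "real ^ 'd" and x :: "nat \<Rightarrow> complex"
  assumes qm: "quasi_metric q" and H: "0 < H" and d: "0 < d"
    and up: "\<And>x y. norm (x - y) \<le> 1 \<Longrightarrow> q x y \<le> d * norm (x - y) powr H"
    and \<beta>: "0 < \<beta>" and e: "0 \<le> e" and \<delta>: "0 < \<delta>" and u0: "u0 \<in> cbox lo hi"
    and c: "\<And>n u v. n \<ge> 1 \<Longrightarrow> u \<in> cbox lo hi \<Longrightarrow> v \<in> cbox lo hi \<Longrightarrow> norm (u - v) \<le> \<delta> \<Longrightarrow>
         cmod (c n u - c n v) \<le> A n * log_power \<beta> e (q u v)"
    and A: "\<And>n. 0 \<le> A n"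
    and gb: "grid_bounded lo hi \<delta> (\<lambda>u v. log_power \<beta> e (q u v)) u0 c x"
  shows "\<exists>B>0. \<forall>N. (\<forall>u\<in>cbox lo hi. cmod (\<Sum>n=1..N. c n u * x n) \<le> B) \<and>
    (\<forall>u\<in>cbox lo hi. \<forall>v\<in>cbox lo hi.
       cmod ((\<Sum>n=1..N. c n u * x n) - (\<Sum>n=1..N. c n v * x n)) \<le> B * log_power \<beta> (e + 1 / 2) (q u v))"
proof -
  let ?F = "\<lambda>N u. \<Sum>n=1..N. c n u * x n"
  obtain L1 k0 :: nat where L1': "\<forall>k\<ge>k0. \<forall>i\<in>grid_pairs lo hi \<delta> k. \<forall>N.
      cmod (\<Sum>n=1..N. (c n (fst i) - c n (snd i)) * x n) \<le> real L1 * sqrt (real k) * log_power \<beta> e (q (fst i) (snd i))"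
    using gb unfolding grid_bounded_def by blast
  have L1: "cmod (\<Sum>n=1..N. (c n u - c n v) * x n) \<le> real L1 * sqrt (real k) * log_power \<beta> e (q u v)"
    if "k \<ge> k0" "(u, v) \<in> grid_pairs lo hi \<delta> k" for k u v N
    using L1'[rule_format, OF that, of N] by simp
  obtain L2 :: nat where L2: "\<And>N. cmod (?F N u0) \<le> real L2"
    using gb unfolding grid_bounded_def by blast
  define L where "L = real (max L1 L2)"
  have L: "0 \<le> L" "real L1 \<le> L" "real L2 \<le> L" by (auto simp: L_def)
  obtain B where B: "0 < B" "\<And>F :: real ^ 'd \<Rightarrow> complex. continuous_on (cbox lo hi) F \<Longrightarrow> cmod (F u0) \<le> L \<Longrightarrow>
       (\<And>k u v. k \<ge> k0 \<Longrightarrow> (u, v) \<in> grid_pairs lo hi \<delta> k \<Longrightarrow> cmod (F u - F v) \<le> L * sqrt k * log_power \<beta> e (q u v)) \<Longrightarrow>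
       (\<forall>u\<in>cbox lo hi. cmod (F u) \<le> B) \<and>
       (\<forall>u\<in>cbox lo hi. \<forall>v\<in>cbox lo hi. cmod (F u - F v) \<le> B * log_power \<beta> (e + 1 / 2) (q u v))"
    using modulus_from_grid[OF qm H d up \<beta> e \<delta> u0 L(1), of k0] by blast
  have "(\<forall>u\<in>cbox lo hi. cmod (?F N u) \<le> B) \<and>
    (\<forall>u\<in>cbox lo hi. \<forall>v\<in>cbox lo hi.
       cmod (?F N u - ?F N v) \<le> B * log_power \<beta> (e + 1 / 2) (q u v))" for N
  proof (rule B(2))
    have "continuous_on (cbox lo hi) (c n)" if "n \<ge> 1" for n
      using qm c[OF that] A
      by (intro log_power_modulus_continuous_on[OF H d _ up \<beta> e \<delta>, of "A n"]) (auto simp: quasi_metric_def)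
    thus "continuous_on (cbox lo hi) (\<lambda>u. \<Sum>n=1..N. c n u * x n)"
      by (intro continuous_intros) auto
    show "cmod (?F N u0) \<le> L" using L2[of N] L by linarith
    fix k u v assume k: "k \<ge> k0" "(u, v) \<in> grid_pairs lo hi \<delta> k"
    have "cmod (?F N u - ?F N v) = cmod (\<Sum>n=1..N. (c n u - c n v) * x n)"
      by (simp add: sum_subtractf left_diff_distrib)
    also have "\<dots> \<le> real L1 * sqrt (real k) * log_power \<beta> e (q u v)" by (rule L1[OF k])
    also have "\<dots> \<le> L * sqrt k * log_power \<beta> e (q u v)" using L by (intro mult_right_mono) auto
    finally show "cmod (?F N u - ?F N v) \<le> L * sqrt k * log_power \<beta> e (q u v)" .
  qed
  thus ?thesis using B(1) by blast
qed

section \<open>Arrival times of a Poisson process\<close>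

lemma poisson_generating_function:
  assumes "0 < l" "0 \<le> z"
  shows "(\<integral>\<^sup>+n. ennreal (z ^ n) \<partial>measure_pmf (poisson_pmf l)) = ennreal (exp (l * (z - 1)))"
proof -
  have *: "(\<lambda>n. z ^ n * (l ^ n / fact n * exp (- l))) sums (exp (z * l) * exp (- l))"
    using sums_mult2[OF exp_converges[of "z * l"], of "exp (- l)"]
    by (simp add: power_mult_distrib divide_inverse mult_ac)
  have "(\<integral>\<^sup>+n. ennreal (z ^ n) \<partial>measure_pmf (poisson_pmf l))
      = (\<Sum>n. ennreal (z ^ n * (l ^ n / fact n * exp (- l))))"
    using assms by (simp add: nn_integral_measure_pmf nn_integral_count_space_nat ennreal_mult'[symmetric] mult_ac)
  also have "\<dots> = ennreal (exp (z * l) * exp (- l))"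
    using assms * by (intro suminf_ennreal_eq) auto
  finally show ?thesis by (simp add: exp_add[symmetric] algebra_simps)
qed

lemma poisson_process_generating_function:
  assumes M: "prob_space M" and X: "poisson_process M 1 X" and t: "0 < t" and z: "0 \<le> z"
  shows "(\<integral>\<^sup>+\<omega>. ennreal (z ^ X t \<omega>) \<partial>M) = ennreal (exp (t * (z - 1)))"
proof -
  have [measurable]: "X s \<in> measurable M (count_space UNIV)" if "0 \<le> s" for s
    using X that by (auto simp: poisson_process_def)
  have X0: "AE \<omega> in M. X 0 \<omega> = 0"
    using X unfolding poisson_process_def by (auto elim: AE_mp)
  have "(\<integral>\<^sup>+\<omega>. ennreal (z ^ X t \<omega>) \<partial>M) = (\<integral>\<^sup>+\<omega>. ennreal (z ^ (X t \<omega> - X 0 \<omega>)) \<partial>M)"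
    by (rule nn_integral_cong_AE) (use X0 in eventually_elim, simp)
  also have "\<dots> = (\<integral>\<^sup>+n. ennreal (z ^ n) \<partial>distr M (count_space UNIV) (\<lambda>\<omega>. X t \<omega> - X 0 \<omega>))"
    using t by (subst nn_integral_distr) auto
  also have "distr M (count_space UNIV) (\<lambda>\<omega>. X t \<omega> - X 0 \<omega>) = measure_pmf (poisson_pmf t)"
    using X t unfolding poisson_process_def by force
  finally show ?thesis using poisson_generating_function[OF t z] by simp
qed

text \<open>
  Markov's inequality for \<open>2\<close> to the power \<open>X k\<close>, whose mean is \<open>e\<^sup>k\<close>, bounds the probability of
  the complementary event by \<open>(e/8)\<^sup>k\<close>.
\<close>

lemma poisson_process_eventually_less:
  assumes M: "prob_space M" and X: "poisson_process M 1 X"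
  shows "AE \<omega> in M. \<forall>\<^sub>F k in sequentially. X (real k) \<omega> < 3 * k"
proof -
  interpret prob_space M by fact
  have [measurable]: "X s \<in> measurable M (count_space UNIV)" if "0 \<le> s" for s
    using X that by (auto simp: poisson_process_def)
  let ?E = "\<lambda>k. {\<omega>\<in>space M. 3 * k \<le> X (real k) \<omega>}"
  have pb: "prob (?E k) \<le> (exp 1 / 8) ^ k" for k
  proof (cases "k = 0")
    case False
    have "ennreal (8 ^ k) * emeasure M (?E k)
        = (\<integral>\<^sup>+\<omega>. ennreal (8 ^ k) * indicator (?E k) \<omega> \<partial>M)"
      by (simp add: nn_integral_cmult_indicator)
    also have "\<dots> \<le> (\<integral>\<^sup>+\<omega>. ennreal (2 ^ X (real k) \<omega>) \<partial>M)"
    proof (rule nn_integral_mono)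
      fix \<omega>
      have "(8::real) ^ k \<le> 2 ^ X (real k) \<omega>" if "3 * k \<le> X (real k) \<omega>"
      proof -
        have "(8::real) ^ k = 2 ^ (3 * k)" by (simp add: power_mult)
        also have "\<dots> \<le> 2 ^ X (real k) \<omega>" using that by (intro power_increasing) auto
        finally show ?thesis .
      qed
      thus "ennreal (8 ^ k) * indicator (?E k) \<omega> \<le> ennreal (2 ^ X (real k) \<omega>)"
        by (auto simp: indicator_def intro!: ennreal_leI)
    qed
    also have "\<dots> = ennreal (exp (real k * (2 - 1)))"
      using False by (intro poisson_process_generating_function M X) auto
    finally have "8 ^ k * prob (?E k) \<le> exp (real k)"
      by (simp add: emeasure_eq_measure ennreal_mult'[symmetric])
    thus ?thesis by (simp add: power_divide exp_of_nat_mult[symmetric] field_simps)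
  qed simp
  have sm: "summable (\<lambda>k. (exp 1 / 8 :: real) ^ k)"
    using exp_le by (intro summable_geometric) auto
  have "summable (\<lambda>k. prob (?E k))"
    by (rule summable_comparison_test'[OF sm, of 0]) (simp only: real_norm_def abs_of_nonneg[OF measure_nonneg] pb)
  from borel_cantelli_AE1[OF _ _ this]
  have "AE \<omega> in M. \<forall>\<^sub>F k in sequentially. \<omega> \<in> space M - (?E k)"
    by (auto simp: emeasure_eq_measure)
  thus ?thesis by eventually_elim (auto elim!: eventually_mono simp: not_le)
qed

text \<open>
  Needed because \<open>arrival_time\<close> is an infimum in the reals, which is meaningful for nonempty sets
  only. Markov's inequality is applied to \<open>1/2\<close> to the power \<open>X k\<close>.
\<close>

lemma poisson_process_unbounded:
  assumes M: "prob_space M" and X: "poisson_process M 1 X"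
  shows "AE \<omega> in M. \<forall>n. \<exists>k. n \<le> X (real k) \<omega>"
  unfolding AE_all_countable
proof
  fix n :: nat
  interpret prob_space M by fact
  have [measurable]: "X s \<in> measurable M (count_space UNIV)" if "0 \<le> s" for s
    using X that by (auto simp: poisson_process_def)
  let ?E = "\<lambda>k. {\<omega>\<in>space M. X (real k) \<omega> < n}"
  have pb: "prob (?E k) \<le> 2 ^ n * exp (- 1 / 2) ^ k" for k
  proof (cases "k = 0")
    case True
    have "prob (?E k) \<le> 1 * 1" by simp
    also have "\<dots> \<le> 2 ^ n * exp (- 1 / 2) ^ k" using True by (intro mult_mono) auto
    finally show ?thesis .
  next
    case False
    have "emeasure M (?E k) = (\<integral>\<^sup>+\<omega>. indicator (?E k) \<omega> \<partial>M)"
      by simp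
    also have "\<dots> \<le> (\<integral>\<^sup>+\<omega>. ennreal (2 ^ n) * ennreal ((1 / 2) ^ X (real k) \<omega>) \<partial>M)"
    proof (rule nn_integral_mono)
      fix \<omega>
      have "(1::real) \<le> 2 ^ n * (1 / 2) ^ X (real k) \<omega>" if "X (real k) \<omega> < n"
        using that power_increasing[of "X (real k) \<omega>" n "2::real"] by (simp add: power_divide field_simps)
      hence "ennreal 1 \<le> ennreal (2 ^ n * (1 / 2) ^ X (real k) \<omega>)" if "X (real k) \<omega> < n"
        using that by (intro ennreal_leI) auto
      thus "indicator (?E k) \<omega> \<le> ennreal (2 ^ n) * ennreal ((1 / 2) ^ X (real k) \<omega>)"
        by (auto simp: indicator_def ennreal_mult'[symmetric])
    qed
    also have "\<dots> = ennreal (2 ^ n) * (\<integral>\<^sup>+\<omega>. ennreal ((1 / 2) ^ X (real k) \<omega>) \<partial>M)"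
      by (rule nn_integral_cmult) measurable
    also have "(\<integral>\<^sup>+\<omega>. ennreal ((1 / 2) ^ X (real k) \<omega>) \<partial>M) = ennreal (exp (real k * (1 / 2 - 1)))"
      using False by (intro poisson_process_generating_function M X) auto
    also have "exp (real k * (1 / 2 - 1)) = exp (- 1 / 2) ^ k"
      by (simp add: exp_of_nat_mult[symmetric])
    finally show ?thesis
      by (simp add: emeasure_eq_measure ennreal_mult'[symmetric])
  qed
  have sm: "summable (\<lambda>k. 2 ^ n * exp (- 1 / 2 :: real) ^ k)"
    by (intro summable_mult summable_geometric) auto
  have "summable (\<lambda>k. prob (?E k))"
    by (rule summable_comparison_test'[OF sm, of 0]) (simp only: real_norm_def abs_of_nonneg[OF measure_nonneg] pb)
  from borel_cantelli_AE1[OF _ _ this]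
  have "AE \<omega> in M. \<forall>\<^sub>F k in sequentially. \<omega> \<in> space M - (?E k)"
    by (auto simp: emeasure_eq_measure)
  thus "AE \<omega> in M. \<exists>k. n \<le> X (real k) \<omega>"
    by eventually_elim (auto simp: eventually_sequentially not_less)
qed

text \<open>
  If \<open>n \<le> X t\<close> then \<open>n\<close> is at most \<open>3 (t + const)\<close>, because \<open>X k < 3 k\<close> for large integers \<open>k\<close>.
  Right-continuity at \<open>0\<close> bounds \<open>t\<close> away from \<open>0\<close>, so that the additive constant can be absorbed
  into the multiplicative one.
\<close>

lemma arrival_time_linear_lower_bound:
  assumes M: "prob_space M" and X: "poisson_process M 1 X"
  shows "AE \<omega> in M. \<exists>c>0. \<forall>n\<ge>1. c * real n \<le> arrival_time X n \<omega>"
proof -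
  have "AE \<omega> in M. X 0 \<omega> = 0 \<and> (\<forall>s t. 0 \<le> s \<and> s \<le> t \<longrightarrow> X s \<omega> \<le> X t \<omega>) \<and>
        (\<forall>t\<ge>0. \<exists>e>0. \<forall>s\<in>{t..<t+e}. X s \<omega> = X t \<omega>)"
    using X unfolding poisson_process_def by blast
  with poisson_process_eventually_less[OF M X] poisson_process_unbounded[OF M X]
  show ?thesis
  proof eventually_elim
    case (elim \<omega>)
    have X0: "X 0 \<omega> = 0" and mono: "\<And>s t. 0 \<le> s \<Longrightarrow> s \<le> t \<Longrightarrow> X s \<omega> \<le> X t \<omega>"
      using elim by auto
    obtain e where "0 < e" "\<forall>s\<in>{0..<0 + e}. X s \<omega> = X 0 \<omega>"
      using elim(3) by blast
    hence e: "0 < e" "\<And>s. 0 \<le> s \<Longrightarrow> s < e \<Longrightarrow> X s \<omega> = 0"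
      using X0 by auto
    obtain K where K: "\<And>k. k \<ge> K \<Longrightarrow> X (real k) \<omega> < 3 * k"
      using elim(1) by (auto simp: eventually_sequentially)
    define c where "c = 1 / (3 * ((real K + 1) / e + 1))"
    have c: "0 < c" using e by (simp add: c_def add_nonneg_pos)
    have "c * real n \<le> arrival_time X n \<omega>" if n: "1 \<le> n" for n
      unfolding arrival_time_def
    proof (rule cInf_greatest)
      obtain k where "n \<le> X (real k) \<omega>" using elim(2) by blast
      thus "{t. 0 \<le> t \<and> n \<le> X t \<omega>} \<noteq> {}" by (auto intro!: exI[of _ "real k"])
    next
      fix t assume "t \<in> {t. 0 \<le> t \<and> n \<le> X t \<omega>}"
      hence t: "0 \<le> t" "n \<le> X t \<omega>" by auto
      have et: "e \<le> t" using e(2)[of t] t n by force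
      define k where "k = max K (nat \<lceil>t\<rceil>)"
      have tk: "t \<le> real k" "real k \<le> real K + t + 1" using t by (auto simp: k_def) linarith+
      have "n < 3 * k" using t(2) mono[OF t(1) tk(1)] K[of k] by (simp add: k_def)
      hence "real n \<le> 3 * real k" by simp
      also have "\<dots> \<le> 3 * ((real K + 1) * 1 + t)" using tk(2) by simp
      also have "\<dots> \<le> 3 * ((real K + 1) * (t / e) + t)"
        using et e by (intro mult_left_mono add_mono) auto
      also have "\<dots> = t / c" by (simp add: c_def algebra_simps add_divide_distrib)
      finally show "c * real n \<le> t" using c by (simp add: field_simps)
    qed
    thus ?case using c by blast
  qed
qed

section \<open>Conditioning by independence\<close>

lemma (in prob_space) indep_set_distr_pair:
  fixes Y :: "'a \<Rightarrow> 'b" and G :: "'a \<Rightarrow> 'c"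
  assumes Y: "Y \<in> measurable M S" and G: "G \<in> measurable M T"
    and ind: "indep_set A B"
    and sub: "\<And>D. D \<in> sets S \<Longrightarrow> Y -` D \<inter> space M \<in> A" "\<And>D. D \<in> sets T \<Longrightarrow> G -` D \<inter> space M \<in> B"
  shows "distr M S Y \<Otimes>\<^sub>M distr M T G = distr M (S \<Otimes>\<^sub>M T) (\<lambda>\<omega>. (Y \<omega>, G \<omega>))"
proof -
  have YG: "(\<lambda>\<omega>. (Y \<omega>, G \<omega>)) \<in> measurable M (S \<Otimes>\<^sub>M T)" using Y G by (rule measurable_Pair)
  interpret Y: prob_space "distr M S Y" by (rule prob_space_distr) fact
  interpret G: prob_space "distr M T G" by (rule prob_space_distr) fact
  show ?thesis
  proof (rule pair_measure_eqI)
    show "sigma_finite_measure (distr M S Y)" ..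
    show "sigma_finite_measure (distr M T G)" ..
    fix D E assume D: "D \<in> sets (distr M S Y)" and E: "E \<in> sets (distr M T G)"
    have "emeasure (distr M (S \<Otimes>\<^sub>M T) (\<lambda>\<omega>. (Y \<omega>, G \<omega>))) (D \<times> E)
        = emeasure M ((\<lambda>\<omega>. (Y \<omega>, G \<omega>)) -` (D \<times> E) \<inter> space M)"
      using D E by (intro emeasure_distr[OF YG]) auto
    also have "(\<lambda>\<omega>. (Y \<omega>, G \<omega>)) -` (D \<times> E) \<inter> space M = (Y -` D \<inter> space M) \<inter> (G -` E \<inter> space M)"
      by auto
    also have "emeasure M \<dots> = emeasure M (Y -` D \<inter> space M) * emeasure M (G -` E \<inter> space M)"
      using indep_setD[OF ind sub(1) sub(2), of D E] D E
      by (simp add: emeasure_eq_measure ennreal_mult)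
    finally show "emeasure (distr M S Y) D * emeasure (distr M T G) E
        = emeasure (distr M (S \<Otimes>\<^sub>M T) (\<lambda>\<omega>. (Y \<omega>, G \<omega>))) (D \<times> E)"
      using D E Y G by (simp add: emeasure_distr)
  qed simp
qed

lemma measurable_sigma_seq:
  fixes X :: "nat \<Rightarrow> 'w \<Rightarrow> 'a::topological_space"
  assumes "space N = space M" "sigma_seq M X \<subseteq> sets N"
  shows "(\<lambda>\<omega>. \<lambda>n\<in>{1..}. X n \<omega>) \<in> measurable N (PiM {1..} (\<lambda>_. borel))"
proof (rule measurableI)
  show "(\<lambda>n\<in>{1..}. X n x) \<in> space (PiM {1..} (\<lambda>_. borel))" for x
    by (simp add: space_PiM)
  fix A assume "A \<in> sets (PiM {1..} (\<lambda>_. borel) :: (nat \<Rightarrow> 'a) measure)"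
  hence "(\<lambda>\<omega>. \<lambda>n\<in>{1..}. X n \<omega>) -` A \<inter> space M \<in> sigma_seq M X"
    unfolding sigma_seq_def by (rule in_vimage_algebra)
  thus "(\<lambda>\<omega>. \<lambda>n\<in>{1..}. X n \<omega>) -` A \<inter> space N \<in> sets N" using assms by auto
qed

text \<open>
  The last two sequences are grouped: jointly they are independent of the first one, which is
  expressed as a product of laws so that Fubini's theorem applies.
\<close>

lemma indep_three_seqs_distr_pair:
  fixes X :: "nat \<Rightarrow> 'w \<Rightarrow> 'a::topological_space" and Y :: "nat \<Rightarrow> 'w \<Rightarrow> 'b::topological_space"
    and Z :: "nat \<Rightarrow> 'w \<Rightarrow> 'c::topological_space"
  assumes "prob_space M" "indep_three_seqs M X Y Z"
  defines "S \<equiv> PiM {1..} (\<lambda>_. borel) \<Otimes>\<^sub>M PiM {1..} (\<lambda>_. borel)"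
    and "T \<equiv> PiM {1..} (\<lambda>_. borel)"
    and "YZ \<equiv> \<lambda>\<omega>. (\<lambda>n\<in>{1..}. Y n \<omega>, \<lambda>n\<in>{1..}. Z n \<omega>)"
    and "XX \<equiv> \<lambda>\<omega>. \<lambda>n\<in>{1..}. X n \<omega>"
  shows "YZ \<in> measurable M S" "XX \<in> measurable M T"
    "distr M S YZ \<Otimes>\<^sub>M distr M T XX = distr M (S \<Otimes>\<^sub>M T) (\<lambda>\<omega>. (YZ \<omega>, XX \<omega>))"
proof -
  interpret prob_space M by fact
  define E where "E = (\<lambda>i::nat. if i = 0 then sigma_seq M X else if i = 1 then sigma_seq M Y else sigma_seq M Z)"
  define I :: "bool \<Rightarrow> nat set" where "I = case_bool {1, 2} {0}"
  have ind: "indep_sets E {0, 1, 2}"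
    using assms(2) by (simp add: indep_three_seqs_def E_def)
  have U: "(\<Union>j\<in>UNIV. I j) = {0, 1, 2}" by (auto simp: I_def UNIV_bool)
  have col: "indep_sets (\<lambda>j. sigma_sets (space M) (\<Union>i\<in>I j. E i)) UNIV"
  proof (rule indep_sets_collect_sigma)
    show "indep_sets E (\<Union>j\<in>UNIV. I j)" unfolding U by (fact ind)
    show "Int_stable (E i)" for i
      by (simp add: E_def sigma_seq_def sets.Int_stable)
    show "disjoint_family_on I UNIV"
      by (auto simp: disjoint_family_on_def I_def split: bool.splits)
  qed
  have ev: "sigma_sets (space M) (\<Union>i\<in>I j. E i) \<subseteq> events" for j
    using col by (auto simp: indep_sets_def)
  define N where "N j = sigma (space M) (\<Union>i\<in>I j. E i)" for j
  have E_sub: "E i \<subseteq> Pow (space M)" for i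
    by (auto simp: E_def sigma_seq_def dest!: sets.sets_into_space)
  have N: "space (N j) = space M" "sets (N j) = sigma_sets (space M) (\<Union>i\<in>I j. E i)" for j
    unfolding N_def using E_sub by (auto simp: space_measure_of sets_measure_of UN_subset_iff)
  have mX: "XX \<in> measurable (N False) T"
    unfolding XX_def T_def by (rule measurable_sigma_seq) (auto simp: N E_def I_def)
  have mYZ: "YZ \<in> measurable (N True) S"
    unfolding YZ_def S_def
    by (intro measurable_Pair measurable_sigma_seq) (auto simp: N E_def I_def)
  show YZ: "YZ \<in> measurable M S" and XX: "XX \<in> measurable M T"
    using mX mYZ N ev by (auto simp: measurable_def subset_eq)
  show "distr M S YZ \<Otimes>\<^sub>M distr M T XX = distr M (S \<Otimes>\<^sub>M T) (\<lambda>\<omega>. (YZ \<omega>, XX \<omega>))"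
  proof (rule indep_set_distr_pair[OF YZ XX])
    show "indep_set (sets (N True)) (sets (N False))"
      unfolding indep_set_def N(2)
      by (rule indep_sets_mono_sets[OF col]) (simp split: bool.split)
    show "YZ -` D \<inter> space M \<in> sets (N True)" if "D \<in> sets S" for D
      using measurable_sets[OF mYZ that] by (simp add: N(1))
    show "XX -` D \<inter> space M \<in> sets (N False)" if "D \<in> sets T" for D
      using measurable_sets[OF mX that] by (simp add: N(1))
  qed
qed

text \<open>
  Fubini's theorem in the form of conditioning: the independent variable \<open>Y\<close> may be frozen at a
  typical value.
\<close>

lemma (in prob_space) AE_product_distr_freeze:
  fixes Y :: "'a \<Rightarrow> 'b" and G :: "'a \<Rightarrow> 'c"
  assumes YG [measurable]: "Y \<in> measurable M S" "G \<in> measurable M T"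
    and eq: "distr M S Y \<Otimes>\<^sub>M distr M T G = distr M (S \<Otimes>\<^sub>M T) (\<lambda>x. (Y x, G x))"
    and meas: "{x\<in>space (S \<Otimes>\<^sub>M T). P (fst x) (snd x)} \<in> sets (S \<Otimes>\<^sub>M T)"
    and ae: "AE \<omega>' in M. AE \<omega> in M. P (Y \<omega>') (G \<omega>)"
  shows "AE \<omega> in M. P (Y \<omega>) (G \<omega>)"
proof -
  interpret Y: prob_space "distr M S Y" by (rule prob_space_distr) simp
  interpret G: prob_space "distr M T G" by (rule prob_space_distr) simp
  interpret YG: pair_prob_space "distr M S Y" "distr M T G" ..
  define Q where "Q = {x\<in>space (S \<Otimes>\<^sub>M T). \<not> P (fst x) (snd x)}"
  have Q [measurable]: "Q \<in> sets (S \<Otimes>\<^sub>M T)"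
    unfolding Q_def using meas by (rule sets.sets_Collect_neg)
  have AE_iff: "(AE y in distr M T G. P x y) \<longleftrightarrow> emeasure (distr M T G) (Pair x -` Q) = 0" if "x \<in> space S" for x
  proof -
    have "{y \<in> space (distr M T G). \<not> P x y} = Pair x -` Q"
      using that by (auto simp: Q_def space_pair_measure)
    moreover have "Pair x -` Q \<in> sets (distr M T G)" by simp
    ultimately show ?thesis by (subst AE_iff_measurable) auto
  qed
  have "(\<lambda>x. emeasure (distr M T G) (Pair x -` Q)) \<in> borel_measurable S"
    using G.measurable_emeasure_Pair[of Q S] by simp
  hence "{x\<in>space S. emeasure (distr M T G) (Pair x -` Q) = 0} \<in> sets S" by measurable
  hence msr: "{x\<in>space S. AE y in distr M T G. P x y} \<in> sets S"
    by (simp add: AE_iff cong: conj_cong)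
  have sec: "{y\<in>space T. P x y} \<in> sets T" if "x \<in> space S" for x
  proof -
    have "{y\<in>space T. P x y} = Pair x -` {x\<in>space (S \<Otimes>\<^sub>M T). P (fst x) (snd x)}"
      using that by (auto simp: space_pair_measure)
    thus ?thesis using sets_Pair1[OF meas] by simp
  qed
  have "AE x in distr M S Y. AE y in distr M T G. P x y"
  proof (subst AE_distr_iff[OF _ msr], simp, use ae AE_space in eventually_elim)
    case (elim \<omega>')
    hence "Y \<omega>' \<in> space S" using measurable_space[of Y M S] by simp
    thus ?case using elim by (subst AE_distr_iff[OF _ sec]) auto
  qed
  hence "AE x in distr M S Y \<Otimes>\<^sub>M distr M T G. P (fst x) (snd x)"
    using meas by (intro YG.AE_pair_measure) (auto cong: sets_pair_measure_cong simp: space_pair_measure)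
  thus ?thesis unfolding eq using meas by (subst (asm) AE_distr_iff) auto
qed

section \<open>Random series under moment conditions\<close>

text \<open>
  With \<open>q = min p 1\<close> the expectation of the sum of the \<open>q\<close>-th powers is finite, and summability of \<open>q\<close>-th powers with \<open>q \<le> 1\<close> implies summability.
\<close>

lemma AE_summable_weighted_squares:
  fixes Z :: "nat \<Rightarrow> 'w \<Rightarrow> real"
  assumes M: "prob_space M"
    and Z [measurable]: "\<And>n. n \<ge> 1 \<Longrightarrow> Z n \<in> borel_measurable M"
    and p: "0 < p" and C: "C < \<infinity>"
    and mom: "\<And>n. n \<ge> 1 \<Longrightarrow> (\<integral>\<^sup>+\<omega>. ennreal (\<bar>Z n \<omega>\<bar> powr (2 * p)) \<partial>M) \<le> C"
    and s: "1 < s * min p 1"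
  shows "AE \<omega> in M. summable (\<lambda>n. real n powr (- s) * (Z n \<omega>)\<^sup>2)"
proof -
  interpret prob_space M by fact
  define q where "q = min p 1"
  have q: "0 < q" "q \<le> 1" "q \<le> p" "1 < s * q" using p s by (auto simp: q_def)
  have sp: "0 < s" using q by (metis less_trans zero_less_one zero_less_mult_pos2)
  define x where "x n \<omega> = real n powr (- s) * (Z n \<omega>)\<^sup>2" for n \<omega>
  have x0: "x 0 \<omega> = 0" "0 \<le> x n \<omega>" for n \<omega> using sp by (auto simp: x_def)
  have [measurable]: "x n \<in> borel_measurable M" for n
    by (cases "n = 0") (simp_all add: x_def[abs_def])
  have xq: "(\<integral>\<^sup>+\<omega>. ennreal (x n \<omega> powr q) \<partial>M) \<le> ennreal (real n powr (- (s * q))) * (1 + C)" for n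
  proof (cases "n = 0")
    case False
    have "(\<integral>\<^sup>+\<omega>. ennreal (x n \<omega> powr q) \<partial>M)
       \<le> (\<integral>\<^sup>+\<omega>. ennreal (real n powr (- (s * q))) * (1 + ennreal (\<bar>Z n \<omega>\<bar> powr (2 * p))) \<partial>M)"
    proof (rule nn_integral_mono)
      fix \<omega>
      have "x n \<omega> powr q = real n powr (- (s * q)) * \<bar>Z n \<omega>\<bar> powr (2 * q)"
      proof -
        have "(Z n \<omega>)\<^sup>2 = \<bar>Z n \<omega>\<bar> powr 2" by simp
        thus ?thesis unfolding x_def by (simp add: powr_mult powr_powr del: powr_numeral)
      qed
      also have "\<dots> \<le> real n powr (- (s * q)) * (1 + \<bar>Z n \<omega>\<bar> powr (2 * p))"
      proof (rule mult_left_mono)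
        show "\<bar>Z n \<omega>\<bar> powr (2 * q) \<le> 1 + \<bar>Z n \<omega>\<bar> powr (2 * p)"
        proof (cases "\<bar>Z n \<omega>\<bar> \<le> 1")
          case True
          hence "\<bar>Z n \<omega>\<bar> powr (2 * q) \<le> 1" using q by (intro powr_le1) auto
          thus ?thesis by (simp add: add_increasing2)
        next
          case False
          hence "\<bar>Z n \<omega>\<bar> powr (2 * q) \<le> \<bar>Z n \<omega>\<bar> powr (2 * p)" using q by (intro powr_mono) auto
          thus ?thesis by simp
        qed
      qed simp
      finally show "ennreal (x n \<omega> powr q) \<le> ennreal (real n powr (- (s * q))) * (1 + ennreal (\<bar>Z n \<omega>\<bar> powr (2 * p)))"
        by (simp add: ennreal_mult'[symmetric] ennreal_leI flip: ennreal_1 ennreal_plus)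
    qed
    also have "\<dots> = ennreal (real n powr (- (s * q))) * (1 + (\<integral>\<^sup>+\<omega>. ennreal (\<bar>Z n \<omega>\<bar> powr (2 * p)) \<partial>M))"
      using False by (simp add: nn_integral_cmult nn_integral_add emeasure_space_1)
    also have "\<dots> \<le> ennreal (real n powr (- (s * q))) * (1 + C)"
      using False by (intro mult_left_mono add_left_mono mom) auto
    finally show ?thesis .
  qed (simp add: x0)
  have "(\<integral>\<^sup>+\<omega>. (\<Sum>n. ennreal (x n \<omega> powr q)) \<partial>M) = (\<Sum>n. \<integral>\<^sup>+\<omega>. ennreal (x n \<omega> powr q) \<partial>M)"
    by (rule nn_integral_suminf) measurable
  also have "\<dots> \<le> (\<Sum>n. ennreal (real n powr (- (s * q))) * (1 + C))"
    by (intro suminf_le xq) auto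
  also have "\<dots> = (\<Sum>n. ennreal (real n powr (- (s * q)))) * (1 + C)" by simp
  also have "\<dots> < \<infinity>"
  proof -
    have "summable (\<lambda>n. real n powr (- (s * q)))"
      using q by (simp add: summable_real_powr_iff)
    thus ?thesis using C by (simp add: ennreal_mult_less_top suminf_ennreal2)
  qed
  finally have "AE \<omega> in M. (\<Sum>n. ennreal (x n \<omega> powr q)) \<noteq> \<infinity>"
    by (intro nn_integral_PInf_AE) auto
  thus ?thesis
  proof eventually_elim
    case (elim \<omega>)
    hence sm: "summable (\<lambda>n. x n \<omega> powr q)"
      by (intro summable_suminf_not_top) auto
    hence "(\<lambda>n. x n \<omega> powr q) \<longlonglongrightarrow> 0" by (rule summable_LIMSEQ_zero)
    hence ev: "\<forall>\<^sub>F n in sequentially. x n \<omega> powr q < 1" by (rule order_tendstoD(2)) simp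
    have "\<forall>\<^sub>F n in sequentially. norm (x n \<omega>) \<le> x n \<omega> powr q"
      using ev
    proof eventually_elim
      case (elim n)
      have "x n \<omega> \<le> 1"
      proof (rule ccontr)
        assume "\<not> x n \<omega> \<le> 1"
        hence "1 \<le> x n \<omega> powr q" using q by (intro ge_one_powr_ge_zero) auto
        thus False using elim by simp
      qed
      hence "x n \<omega> powr 1 \<le> x n \<omega> powr q" using q x0(2)[of n \<omega>] by (intro powr_mono') auto
      thus ?case using x0(2)[of n \<omega>] by simp
    qed
    from summable_comparison_test_ev[OF this sm] show ?case by (simp add: x_def)
  qed
qed

lemma AE_summable_identically_distributed:
  fixes \<xi> :: "nat \<Rightarrow> 'w \<Rightarrow> 'b::topological_space" and h :: "'b \<Rightarrow> real"
  assumes M: "prob_space M" and \<xi>: "\<And>n. n \<ge> 1 \<Longrightarrow> \<xi> n \<in> measurable M borel"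
    and D: "\<And>n. n \<ge> 1 \<Longrightarrow> distr M borel (\<xi> n) = D"
    and h: "h \<in> borel_measurable borel" and p: "0 < p"
    and mom: "(\<integral>\<^sup>+\<omega>. ennreal (\<bar>h (\<xi> 1 \<omega>)\<bar> powr (2 * p)) \<partial>M) < \<infinity>"
    and s: "1 < s * min p 1"
  shows "AE \<omega> in M. summable (\<lambda>n. real n powr (- s) * (h (\<xi> n \<omega>))\<^sup>2)"
proof (rule AE_summable_weighted_squares[OF M _ p mom _ s])
  note [measurable] = \<xi> h
  show "(\<lambda>\<omega>. h (\<xi> n \<omega>)) \<in> borel_measurable M" if "n \<ge> 1" for n using that by measurable
  have eq: "(\<integral>\<^sup>+\<omega>. ennreal (\<bar>h (\<xi> n \<omega>)\<bar> powr (2 * p)) \<partial>M) = (\<integral>\<^sup>+z. ennreal (\<bar>h z\<bar> powr (2 * p)) \<partial>D)"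
    if "n \<ge> 1" for n
    using that unfolding D[OF that, symmetric] by (subst nn_integral_distr) auto
  show "(\<integral>\<^sup>+\<omega>. ennreal (\<bar>h (\<xi> n \<omega>)\<bar> powr (2 * p)) \<partial>M) \<le> (\<integral>\<^sup>+\<omega>. ennreal (\<bar>h (\<xi> 1 \<omega>)\<bar> powr (2 * p)) \<partial>M)"
    if "n \<ge> 1" for n using eq[OF that] eq[of 1] by simp
qed

text \<open>
  The function \<open>\<Lambda>\<close> is measurable up to null sets only. It is replaced by a Borel function, to which
  equality of the laws of the \<open>\<xi>\<^sub>n\<close> applies; the exceptional set is negligible for these laws
  since they have a density with respect to \<open>\<nu>\<close>.
\<close>

lemma AE_modulus_summable:
  fixes \<xi> :: "nat \<Rightarrow> 'w \<Rightarrow> 'b::topological_space" and \<Lambda> :: "'b \<Rightarrow> ennreal"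
  assumes M: "prob_space M" and \<xi>: "\<And>n. n \<ge> 1 \<Longrightarrow> \<xi> n \<in> measurable M borel"
    and D: "\<And>n. n \<ge> 1 \<Longrightarrow> distr M borel (\<xi> n) = density \<nu> (\<lambda>z. ennreal (m z))"
    and \<nu>: "sets \<nu> = sets borel" and m: "m \<in> borel_measurable borel"
    and \<Lambda>: "\<Lambda> \<in> borel_measurable (completion \<nu>)" and p: "0 < p"
    and mom: "(\<integral>\<^sup>+\<omega>. enn_powr (\<Lambda> (\<xi> 1 \<omega>)) (2 * p) \<partial>M) < \<infinity>"
    and s: "1 < s * min p 1"
  shows "AE \<omega> in M. (\<forall>n\<ge>1. \<Lambda> (\<xi> n \<omega>) < \<infinity>) \<and> summable (\<lambda>n. real n powr (- s) * (enn2real (\<Lambda> (\<xi> n \<omega>)))\<^sup>2)"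
proof -
  interpret prob_space M by fact
  obtain \<Lambda>' where \<Lambda>': "\<Lambda>' \<in> borel_measurable \<nu>" "AE z in \<nu>. \<Lambda> z = \<Lambda>' z"
    using completion_ex_borel_measurable[OF \<Lambda>] by blast
  have \<Lambda>'_borel: "\<Lambda>' \<in> borel_measurable borel"
    using \<Lambda>'(1) measurable_cong_sets[OF \<nu> refl] by blast
  note [measurable] = \<Lambda>'_borel \<xi>
  have m\<nu>: "(\<lambda>z. ennreal (m z)) \<in> borel_measurable \<nu>"
    using m measurable_cong_sets[OF \<nu> refl] by (intro measurable_compose[OF _ measurable_ennreal]) blast
  have AE_\<nu>: "AE \<omega> in M. P (\<xi> n \<omega>)" if "AE z in \<nu>. P z" "n \<ge> 1" for P n
  proof -
    have "AE z in density \<nu> (\<lambda>z. ennreal (m z)). P z"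
      unfolding AE_density[OF m\<nu>] using that(1) by eventually_elim simp
    hence "AE z in distr M borel (\<xi> n). P z" unfolding D[OF that(2)] .
    thus ?thesis using \<xi>[OF that(2)] by (rule AE_distrD[rotated])
  qed
  have eq: "AE \<omega> in M. \<Lambda> (\<xi> n \<omega>) = \<Lambda>' (\<xi> n \<omega>)" if "n \<ge> 1" for n
    by (rule AE_\<nu>[OF \<Lambda>'(2) that])
  have mom': "(\<integral>\<^sup>+\<omega>. enn_powr (\<Lambda>' (\<xi> 1 \<omega>)) (2 * p) \<partial>M) < \<infinity>"
  proof -
    have "(\<integral>\<^sup>+\<omega>. enn_powr (\<Lambda>' (\<xi> 1 \<omega>)) (2 * p) \<partial>M) = (\<integral>\<^sup>+\<omega>. enn_powr (\<Lambda> (\<xi> 1 \<omega>)) (2 * p) \<partial>M)"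
      by (rule nn_integral_cong_AE) (use eq[of 1] in \<open>auto elim: eventually_mono\<close>)
    thus ?thesis using mom by simp
  qed
  have fin1: "AE \<omega> in M. \<Lambda>' (\<xi> 1 \<omega>) \<noteq> \<infinity>"
  proof -
    define E where "E = {\<omega>\<in>space M. \<Lambda>' (\<xi> 1 \<omega>) = \<infinity>}"
    have [measurable]: "\<xi> 1 \<in> measurable M borel" by (rule \<xi>) simp
    have [measurable]: "E \<in> sets M" unfolding E_def by measurable
    \<comment> \<open>The integrand is \<open>\<top>\<close> on \<open>E\<close>, which has to be null.\<close>
    have "\<infinity> * emeasure M E = (\<integral>\<^sup>+\<omega>. \<infinity> * indicator E \<omega> \<partial>M)" by (simp add: nn_integral_cmult_indicator)
    also have "\<dots> \<le> (\<integral>\<^sup>+\<omega>. enn_powr (\<Lambda>' (\<xi> 1 \<omega>)) (2 * p) \<partial>M)"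
      using p by (intro nn_integral_mono) (auto simp: E_def indicator_def enn_powr_def)
    finally have "\<infinity> * emeasure M E < \<infinity>" using mom' by (rule le_less_trans)
    hence "emeasure M E = 0" by (auto simp: ennreal_mult_less_top)
    thus ?thesis by (intro AE_I[of _ _ E]) (auto simp: E_def)
  qed
  have fin: "AE \<omega> in M. \<Lambda>' (\<xi> n \<omega>) \<noteq> \<infinity>" if n: "n \<ge> 1" for n
  proof -
    have [measurable]: "\<xi> 1 \<in> measurable M borel" "\<xi> n \<in> measurable M borel" using n by (auto intro: \<xi>)
    have "AE z in distr M borel (\<xi> 1). \<Lambda>' z \<noteq> \<infinity>" using fin1 by (subst AE_distr_iff) auto
    hence "AE z in distr M borel (\<xi> n). \<Lambda>' z \<noteq> \<infinity>" unfolding D[OF n] D[OF order_refl] .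
    thus ?thesis by (subst (asm) AE_distr_iff) auto
  qed
  have "AE \<omega> in M. summable (\<lambda>n. real n powr (- s) * (enn2real (\<Lambda>' (\<xi> n \<omega>)))\<^sup>2)"
  proof (rule AE_summable_identically_distributed[OF M \<xi> D _ p _ s])
    have "(\<integral>\<^sup>+\<omega>. ennreal (\<bar>enn2real (\<Lambda>' (\<xi> 1 \<omega>))\<bar> powr (2 * p)) \<partial>M) \<le> (\<integral>\<^sup>+\<omega>. enn_powr (\<Lambda>' (\<xi> 1 \<omega>)) (2 * p) \<partial>M)"
      using p by (intro nn_integral_mono) (auto simp: enn_powr_def)
    thus "(\<integral>\<^sup>+\<omega>. ennreal (\<bar>enn2real (\<Lambda>' (\<xi> 1 \<omega>))\<bar> powr (2 * p)) \<partial>M) < \<infinity>"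
      using mom' by (rule le_less_trans)
  qed measurable
  moreover have "AE \<omega> in M. \<forall>n\<in>{1..}. \<Lambda> (\<xi> n \<omega>) = \<Lambda>' (\<xi> n \<omega>) \<and> \<Lambda>' (\<xi> n \<omega>) \<noteq> \<infinity>"
    using eq fin by (subst AE_ball_countable) (auto intro: AE_conjI)
  ultimately show ?thesis
  proof eventually_elim
    case (elim \<omega>)
    have eq': "(\<lambda>n. real n powr (- s) * (enn2real (\<Lambda> (\<xi> n \<omega>)))\<^sup>2) = (\<lambda>n. real n powr (- s) * (enn2real (\<Lambda>' (\<xi> n \<omega>)))\<^sup>2)"
    proof
      show "real n powr (- s) * (enn2real (\<Lambda> (\<xi> n \<omega>)))\<^sup>2 = real n powr (- s) * (enn2real (\<Lambda>' (\<xi> n \<omega>)))\<^sup>2" for n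
        using elim(2) by (cases "n = 0") auto
    qed
    show ?case unfolding eq' using elim by (auto simp: less_top)
  qed
qed

section \<open>The coefficients of the conditional series\<close>

lemma exp_diff_le: "\<bar>exp p - exp q\<bar> \<le> max (exp p) (exp q) * \<bar>p - q\<bar>" for p q :: real
proof -
  have *: "exp x - exp y \<le> exp x * (x - y)" for x y :: real
  proof -
    have "exp x * (1 + (y - x)) \<le> exp x * exp (y - x)" by (intro mult_left_mono) auto
    thus ?thesis by (simp add: exp_diff algebra_simps)
  qed
  show ?thesis
  proof (cases "q \<le> p")
    case True
    thus ?thesis using *[of p q] by (simp add: max_def)
  next
    case False
    thus ?thesis using *[of q p] by (simp add: max_def)
  qed
qed

text \<open>
  The derivative of \<open>T powr (- x)\<close> with respect to \<open>x\<close> has an additional factor \<open>ln T\<close>. It is absorbed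
  by lowering the exponent \<open>1 / b\<close> to \<open>\<sigma>\<close>.
\<close>

lemma arrival_power_bounds:
  fixes a b c \<sigma> :: real
  assumes ab: "0 < a" "a \<le> b" and c: "0 < c" and \<sigma>: "0 \<le> \<sigma>" "\<sigma> < 1 / b"
  obtains D where "0 < D"
    "\<And>n T s. 1 \<le> n \<Longrightarrow> c * real n \<le> T \<Longrightarrow> s \<in> {a..b} \<Longrightarrow> T powr (- 1 / s) \<le> D * real n powr - \<sigma>"
    "\<And>n T s t. 1 \<le> n \<Longrightarrow> c * real n \<le> T \<Longrightarrow> s \<in> {a..b} \<Longrightarrow> t \<in> {a..b} \<Longrightarrow>
        \<bar>T powr (- 1 / s) - T powr (- 1 / t)\<bar> \<le> D * real n powr - \<sigma> * \<bar>s - t\<bar>"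
proof -
  \<comment> \<open>With \<open>c' \<le> 1\<close> the ratio \<open>\<tau> = T / c'\<close> is at least \<open>n \<ge> 1\<close>, and powers of \<open>\<tau>\<close> are monotone
    in the exponent.\<close>
  define c' where "c' = min c 1"
  have c': "0 < c'" "c' \<le> 1" "c' \<le> c" using c by (auto simp: c'_def)
  define \<epsilon> where "\<epsilon> = 1 / b - \<sigma>"
  have \<epsilon>: "0 < \<epsilon>" using \<sigma> by (simp add: \<epsilon>_def)
  define C1 where "C1 = c' powr (- 1 / a)"
  define C2 where "C2 = 1 + \<bar>ln c'\<bar> + 1 / \<epsilon>"
  have C1: "0 < C1" using c' by (simp add: C1_def)
  have C2: "1 \<le> C2" using \<epsilon> by (simp add: C2_def)
  have key: "T powr (- 1 / s) \<le> C1 * C2 * real n powr - \<sigma> \<and> T powr (- 1 / s) * \<bar>ln T\<bar> \<le> C1 * C2 * real n powr - \<sigma>"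
    if n: "1 \<le> n" and T: "c * real n \<le> T" and s: "s \<in> {a..b}" for n T s
  proof -
    define \<tau> where "\<tau> = T / c'"
    have "c' * real n \<le> T" using c' T n by (intro order_trans[OF mult_right_mono T]) auto
    hence \<tau>n: "real n \<le> \<tau>" using c' by (simp add: \<tau>_def field_simps)
    have \<tau>: "1 \<le> \<tau>" "T = c' * \<tau>" using order_trans[OF _ \<tau>n, of 1] n c' by (simp, simp add: \<tau>_def)
    have s0: "0 < s" using s ab by auto
    have "T powr (- 1 / s) = c' powr (- 1 / s) * \<tau> powr (- 1 / s)"
      unfolding \<tau>(2) using c' \<tau>(1) by (intro powr_mult)
    also have "\<dots> \<le> C1 * \<tau> powr (- 1 / b)"
    proof (intro mult_mono)
      show "c' powr (- 1 / s) \<le> C1"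
        unfolding C1_def using c' s ab by (intro powr_mono') (auto simp: field_simps)
      show "\<tau> powr (- 1 / s) \<le> \<tau> powr (- 1 / b)"
        using \<tau> s s0 ab by (intro powr_mono) (auto simp: field_simps)
    qed (use C1 in auto)
    finally have 1: "T powr (- 1 / s) \<le> C1 * \<tau> powr (- 1 / b)" .
    have \<tau>e: "1 \<le> \<tau> powr \<epsilon>" using \<tau> \<epsilon> by (intro ge_one_powr_ge_zero) auto
    have "ln T = ln c' + ln \<tau>"
      using c' \<tau>(1) unfolding \<tau>(2) by (simp add: ln_mult)
    hence "\<bar>ln T\<bar> \<le> \<bar>ln c'\<bar> * 1 + \<bar>ln \<tau>\<bar>" by linarith
    also have "\<dots> \<le> \<bar>ln c'\<bar> * \<tau> powr \<epsilon> + \<tau> powr \<epsilon> / \<epsilon>"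
      using \<tau> \<tau>e \<epsilon> ln_powr_bound[of \<tau> \<epsilon>] by (intro add_mono mult_left_mono) auto
    also have "\<dots> \<le> C2 * \<tau> powr \<epsilon>" by (simp add: C2_def algebra_simps)
    finally have 2: "\<bar>ln T\<bar> \<le> C2 * \<tau> powr \<epsilon>" .
    have 3: "\<tau> powr (- 1 / b) * \<tau> powr \<epsilon> \<le> real n powr - \<sigma>"
    proof -
      have "\<tau> powr (- 1 / b) * \<tau> powr \<epsilon> = \<tau> powr - \<sigma>"
        by (simp add: powr_add[symmetric] \<epsilon>_def)
      also have "\<dots> \<le> real n powr - \<sigma>" using \<tau>n n \<sigma> by (intro powr_mono2') auto
      finally show ?thesis .
    qed
    have "T powr (- 1 / s) * \<bar>ln T\<bar> \<le> (C1 * \<tau> powr (- 1 / b)) * (C2 * \<tau> powr \<epsilon>)"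
      using 1 2 C1 by (intro mult_mono) auto
    also have "\<dots> = C1 * C2 * (\<tau> powr (- 1 / b) * \<tau> powr \<epsilon>)" by simp
    also have "\<dots> \<le> C1 * C2 * real n powr - \<sigma>" using 3 C1 C2 by (intro mult_left_mono) auto
    finally have 4: "T powr (- 1 / s) * \<bar>ln T\<bar> \<le> C1 * C2 * real n powr - \<sigma>" .
    have "T powr (- 1 / s) \<le> C1 * (\<tau> powr (- 1 / b) * 1)" using 1 by simp
    also have "\<dots> \<le> C1 * (\<tau> powr (- 1 / b) * \<tau> powr \<epsilon>)" using \<tau>e C1 by (intro mult_left_mono) auto
    also have "\<dots> \<le> C1 * real n powr - \<sigma>" using 3 C1 by (intro mult_left_mono) auto
    also have "\<dots> \<le> C1 * C2 * real n powr - \<sigma>" using C1 C2 by (intro mult_right_mono) auto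
    finally show ?thesis using 4 by blast
  qed
  define D where "D = C1 * C2 * max 1 (1 / a\<^sup>2)"
  have D0: "C1 * C2 \<le> D" "C1 * C2 / a\<^sup>2 \<le> D"
    using mult_left_mono[of 1 "max 1 (1 / a\<^sup>2)" "C1 * C2"] mult_left_mono[of "1 / a\<^sup>2" "max 1 (1 / a\<^sup>2)" "C1 * C2"] C1 C2
    by (auto simp: D_def)
  have "0 < C1 * C2" using C1 C2 by simp
  hence "0 < D" using D0 by linarith
  moreover have "T powr (- 1 / s) \<le> D * real n powr - \<sigma>"
    if "1 \<le> n" "c * real n \<le> T" "s \<in> {a..b}" for n T s
    using key[OF that] D0(1) by (meson mult_right_mono order_trans powr_ge_zero)
  moreover have "\<bar>T powr (- 1 / s) - T powr (- 1 / t)\<bar> \<le> D * real n powr - \<sigma> * \<bar>s - t\<bar>"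
    if n: "1 \<le> n" "c * real n \<le> T" and s: "s \<in> {a..b}" and t: "t \<in> {a..b}" for n T s t
  proof -
    have "0 < c * real n" using c n by simp
    hence T: "0 < T" using n by linarith
    have st: "0 < s" "0 < t" using s t ab by auto
    have "\<bar>T powr (- 1 / s) - T powr (- 1 / t)\<bar>
        \<le> max (T powr (- 1 / s)) (T powr (- 1 / t)) * \<bar>- 1 / s * ln T - - 1 / t * ln T\<bar>"
      using exp_diff_le[of "- 1 / s * ln T" "- 1 / t * ln T"] T by (simp add: powr_def)
    also have "- 1 / s * ln T - - 1 / t * ln T = (1 / t - 1 / s) * ln T" by (simp add: algebra_simps)
    also have "max (T powr (- 1 / s)) (T powr (- 1 / t)) * \<bar>(1 / t - 1 / s) * ln T\<bar>
        = (max (T powr (- 1 / s)) (T powr (- 1 / t)) * \<bar>ln T\<bar>) * \<bar>1 / t - 1 / s\<bar>"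
      by (simp add: abs_mult)
    also have "\<dots> \<le> (C1 * C2 * real n powr - \<sigma>) * (\<bar>s - t\<bar> / a\<^sup>2)"
    proof (rule mult_mono)
      show "max (T powr (- 1 / s)) (T powr (- 1 / t)) * \<bar>ln T\<bar> \<le> C1 * C2 * real n powr - \<sigma>"
        using key[OF n s] key[OF n t] by (simp add: max_def)
      have "\<bar>1 / t - 1 / s\<bar> = \<bar>s - t\<bar> / (s * t)"
        using st by (simp add: field_simps abs_divide flip: abs_mult)
      also have "\<dots> \<le> \<bar>s - t\<bar> / a\<^sup>2"
        using s t ab unfolding power2_eq_square by (intro divide_left_mono mult_mono mult_pos_pos) auto
      finally show "\<bar>1 / t - 1 / s\<bar> \<le> \<bar>s - t\<bar> / a\<^sup>2" .
    qed (use C1 C2 in auto)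
    also have "\<dots> = C1 * C2 / a\<^sup>2 * (real n powr - \<sigma> * \<bar>s - t\<bar>)" by simp
    also have "\<dots> \<le> D * (real n powr - \<sigma> * \<bar>s - t\<bar>)" using D0 by (intro mult_right_mono) auto
    finally show ?thesis by simp
  qed
  ultimately show thesis using that by blast
qed

lemma log_modulus_boundD:
  fixes \<rho> :: "'a::real_normed_vector \<Rightarrow> 'a \<Rightarrow> real"
  assumes fin: "log_modulus \<rho> K r \<beta> \<eta> F < \<infinity>"
    and xy: "x \<in> K" "y \<in> K" "x \<noteq> y" "norm (x - y) \<le> r" and \<rho>: "0 < \<rho> x y" "\<rho> x y \<noteq> 1"
  shows "cmod (F x - F y) \<le> enn2real (log_modulus \<rho> K r \<beta> \<eta> F) * (\<rho> x y powr \<beta> * \<bar>ln (\<rho> x y)\<bar> powr \<eta>)"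
proof -
  define l where "l = enn2real (log_modulus \<rho> K r \<beta> \<eta> F)"
  have l: "log_modulus \<rho> K r \<beta> \<eta> F = ennreal l" using fin by (simp add: l_def)
  have ln: "0 < \<bar>ln (\<rho> x y)\<bar>" using \<rho> by simp
  define D where "D = \<rho> x y powr \<beta> * \<bar>ln (\<rho> x y)\<bar> powr \<eta>"
  have D: "0 < D" using \<rho> ln by (simp add: D_def)
  have "enn_powr (ennreal \<bar>ln (\<rho> x y)\<bar>) \<eta> = ennreal (\<bar>ln (\<rho> x y)\<bar> powr \<eta>)"
    using ln by (auto simp: enn_powr_def)
  hence D_eq: "ennreal (\<rho> x y powr \<beta>) * enn_powr (ennreal \<bar>ln (\<rho> x y)\<bar>) \<eta> = ennreal D"
    by (simp add: D_def ennreal_mult)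
  have "ennreal (cmod (F x - F y)) / ennreal D \<le> log_modulus \<rho> K r \<beta> \<eta> F"
    unfolding log_modulus_def
    by (rule SUP_upper2[of "(x, y)"]) (use xy in \<open>auto simp: D_eq\<close>)
  hence "ennreal (cmod (F x - F y) / D) \<le> ennreal l"
    using D by (simp add: l divide_ennreal)
  hence "cmod (F x - F y) / D \<le> l"
    by (subst (asm) ennreal_le_iff) (auto simp: l_def)
  thus ?thesis using D by (simp add: D_def l_def field_simps)
qed

text \<open>
  The modulus of a field on \<open>[a,b] \<times> K\<close> is restricted to the graph of \<open>\<alpha>\<close>. As \<open>\<alpha>\<close> is Lipschitz
  for \<open>q\<close>, the quasi-metric \<open>\<rho>\<close> on the graph is comparable to \<open>q\<close>. For close points \<open>\<rho>\<close> is
  below \<open>1/4\<close>, away from the point \<open>\<rho> = 1\<close> where its logarithm vanishes.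
\<close>

lemma log_modulus_graph_bounds:
  fixes q :: "real ^ 'd \<Rightarrow> real ^ 'd \<Rightarrow> real" and lo hi u0 :: "real ^ 'd" and \<alpha> :: "real ^ 'd \<Rightarrow> real"
  assumes qm: "quasi_metric q" and H: "0 < H" and c: "0 < c"
    and up: "\<And>x y. norm (x - y) \<le> 1 \<Longrightarrow> q x y \<le> c * norm (x - y) powr H"
    and \<beta>: "0 < \<beta>" "\<beta> \<le> 1" and r: "0 < r"
    and C\<alpha>: "0 \<le> C\<alpha>" "\<And>u v. u \<in> cbox lo hi \<Longrightarrow> v \<in> cbox lo hi \<Longrightarrow> \<bar>\<alpha> u - \<alpha> v\<bar> \<le> C\<alpha> * q u v"
    and ab: "\<And>u. u \<in> cbox lo hi \<Longrightarrow> \<alpha> u \<in> {a..b}"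
    and u0: "u0 \<in> cbox lo hi"
    and \<rho>: "\<rho> = (\<lambda>(s, u) (t, v). \<bar>s - t\<bar> + q u v)"
  obtains \<delta> C where "0 < \<delta>" "0 < C"
    "\<And>u v. u \<in> cbox lo hi \<Longrightarrow> v \<in> cbox lo hi \<Longrightarrow> norm (u - v) \<le> \<delta> \<Longrightarrow>
       \<bar>\<alpha> u - \<alpha> v\<bar> \<le> C * log_power \<beta> (max \<eta> 0) (q u v)"
    "\<And>F u v. log_modulus \<rho> ({a..b} \<times> cbox lo hi) r \<beta> \<eta> F < \<infinity> \<Longrightarrow> u \<in> cbox lo hi \<Longrightarrow> v \<in> cbox lo hi \<Longrightarrow>
       norm (u - v) \<le> \<delta> \<Longrightarrow>
       cmod (F (\<alpha> u, u) - F (\<alpha> v, v)) \<le> C * enn2real (log_modulus \<rho> ({a..b} \<times> cbox lo hi) r \<beta> \<eta> F) * log_power \<beta> (max \<eta> 0) (q u v)"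
    "\<And>F u. log_modulus \<rho> ({a..b} \<times> cbox lo hi) r \<beta> \<eta> F < \<infinity> \<Longrightarrow> u \<in> cbox lo hi \<Longrightarrow>
       cmod (F (\<alpha> u, u)) \<le> cmod (F (\<alpha> u0, u0)) + C * enn2real (log_modulus \<rho> ({a..b} \<times> cbox lo hi) r \<beta> \<eta> F)"
proof -
  define K where "K = cbox lo hi"
  let ?e = "max \<eta> 0"
  let ?h = "\<lambda>u v. log_power \<beta> ?e (q u v)"
  define L where "L F = log_modulus \<rho> ({a..b} \<times> K) r \<beta> \<eta> F" for F :: "real \<times> (real ^ 'd) \<Rightarrow> complex"
  have q: "0 \<le> q u v" "q u v = 0 \<longleftrightarrow> u = v" for u v using qm by (auto simp: quasi_metric_def)
  define C1 where "C1 = C\<alpha> + 1"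
  have C1: "1 \<le> C1" using C\<alpha> by (simp add: C1_def)
  have "((\<lambda>\<delta>. C1 * (c * \<delta> powr H) + \<delta>) \<longlongrightarrow> C1 * (c * 0 powr H) + 0) (at_right 0)"
    using H by (intro tendsto_add tendsto_mult tendsto_const tendsto_powr' tendsto_ident_at)
      (auto intro!: eventually_mono[OF eventually_at_right_less[of "0::real"]])
  hence "((\<lambda>\<delta>. C1 * (c * \<delta> powr H) + \<delta>) \<longlongrightarrow> 0) (at_right 0)" by simp
  hence "\<forall>\<^sub>F \<delta> in at_right 0. C1 * (c * \<delta> powr H) + \<delta> < min r (1 / 4)"
    using r by (intro order_tendstoD(2)) auto
  hence "\<forall>\<^sub>F \<delta> in at_right (0::real). 0 < \<delta> \<and> C1 * (c * \<delta> powr H) + \<delta> < min r (1 / 4)"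
    using eventually_at_right_less[of "0::real"] by eventually_elim auto
  then obtain \<delta> where \<delta>: "0 < \<delta>" "C1 * (c * \<delta> powr H) + \<delta> < min r (1 / 4)"
    using eventually_happens'[OF trivial_limit_at_right_real] by blast
  have c0: "0 \<le> C1 * (c * \<delta> powr H)" using C1 c by simp
  have \<delta>1: "\<delta> \<le> 1" using \<delta> c0 by linarith
  have qs: "C1 * q u v \<le> C1 * (c * \<delta> powr H)" if "norm (u - v) \<le> \<delta>" for u v
  proof -
    have "q u v \<le> c * norm (u - v) powr H" using that \<delta>1 by (intro up) auto
    also have "\<dots> \<le> c * \<delta> powr H" using that c H by (intro mult_left_mono powr_mono2) auto
    finally show ?thesis using C1 by (intro mult_left_mono) auto
  qed
  have q4: "q u v \<le> 1 / 4" "C1 * q u v \<le> 1 / 4" if "norm (u - v) \<le> \<delta>" for u v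
  proof -
    show *: "C1 * q u v \<le> 1 / 4" using qs[OF that] \<delta> by linarith
    have "1 * q u v \<le> C1 * q u v" using C1 q by (intro mult_right_mono) auto
    thus "q u v \<le> 1 / 4" using * by linarith
  qed
  have alpha: "\<bar>\<alpha> u - \<alpha> v\<bar> \<le> C\<alpha> * ?h u v"
    if uv: "u \<in> K" "v \<in> K" "norm (u - v) \<le> \<delta>" for u v
  proof (cases "u = v")
    case True
    thus ?thesis using C\<alpha>(1) by simp
  next
    case False
    hence "0 < q u v" using q by (simp add: less_le)
    hence "q u v \<le> ?h u v" using q4[OF uv(3)] \<beta> by (intro log_power_near_zero) auto
    hence "C\<alpha> * q u v \<le> C\<alpha> * ?h u v" using C\<alpha>(1) by (rule mult_left_mono)
    thus ?thesis using C\<alpha>(2)[of u v] uv unfolding K_def by linarith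
  qed
  have field: "cmod (F (\<alpha> u, u) - F (\<alpha> v, v)) \<le> C1 powr \<beta> * enn2real (L F) * ?h u v"
    if fin: "L F < \<infinity>" and uv: "u \<in> K" "v \<in> K" "norm (u - v) \<le> \<delta>" for F u v
  proof (cases "u = v")
    case True
    thus ?thesis by simp
  next
    case False
    hence q0: "0 < q u v" using q by (simp add: less_le)
    define R where "R = \<rho> (\<alpha> u, u) (\<alpha> v, v)"
    have R_eq: "R = \<bar>\<alpha> u - \<alpha> v\<bar> + q u v" by (simp add: R_def \<rho>)
    have al: "\<bar>\<alpha> u - \<alpha> v\<bar> \<le> C\<alpha> * q u v" using C\<alpha>(2)[of u v] uv unfolding K_def by simp
    have R: "q u v \<le> R" "R \<le> C1 * q u v" using al by (auto simp: R_eq C1_def algebra_simps)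
    have R4: "0 < R" "R \<le> 1 / 4" using R q0 q4[OF uv(3)] by auto
    have "norm ((\<alpha> u, u) - (\<alpha> v, v)) \<le> \<bar>\<alpha> u - \<alpha> v\<bar> + norm (u - v)"
      using norm_Pair_le[of "\<alpha> u - \<alpha> v" "u - v"] by simp
    also have "\<dots> \<le> C1 * q u v + \<delta>" using al q0 uv(3) by (simp add: C1_def algebra_simps)
    also have "\<dots> \<le> r" using qs[OF uv(3)] \<delta> by linarith
    finally have nr: "norm ((\<alpha> u, u) - (\<alpha> v, v)) \<le> r" .
    have "cmod (F (\<alpha> u, u) - F (\<alpha> v, v)) \<le> enn2real (L F) * (R powr \<beta> * \<bar>ln R\<bar> powr \<eta>)"
      unfolding L_def R_def
      by (rule log_modulus_boundD) (use fin uv ab nr False R4 in \<open>auto simp: L_def K_def R_def\<close>)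
    also have "R powr \<beta> * \<bar>ln R\<bar> powr \<eta> \<le> (C1 powr \<beta> * q u v powr \<beta>) * ln (1 + inverse (q u v)) powr ?e"
    proof (rule mult_mono)
      have "R powr \<beta> \<le> (C1 * q u v) powr \<beta>" using R R4 \<beta> by (intro powr_mono2) auto
      thus "R powr \<beta> \<le> C1 powr \<beta> * q u v powr \<beta>" using C1 q0 by (simp add: powr_mult)
      have "\<bar>ln R\<bar> powr \<eta> \<le> \<bar>ln R\<bar> powr ?e"
        using log_power_near_zero(2)[OF R4 \<beta>, of 0] by (intro powr_mono) auto
      also have "\<dots> \<le> ln (1 + inverse (q u v)) powr ?e"
      proof (rule powr_mono2)
        have "\<bar>ln R\<bar> \<le> \<bar>ln (q u v)\<bar>"
        proof -
          have "ln (q u v) \<le> ln R" using R(1) q0 R4 by (intro iffD2[OF ln_le_cancel_iff]) auto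
          moreover have "ln R < 0" using R4 by simp
          ultimately show ?thesis by simp
        qed
        also have "\<dots> \<le> ln (1 + inverse (q u v))"
          using q0 q4[OF uv(3)] \<beta> by (intro log_power_near_zero(3)[of _ \<beta> 0]) auto
        finally show "\<bar>ln R\<bar> \<le> ln (1 + inverse (q u v))" .
      qed auto
      finally show "\<bar>ln R\<bar> powr \<eta> \<le> ln (1 + inverse (q u v)) powr ?e" .
    qed auto
    hence "enn2real (L F) * (R powr \<beta> * \<bar>ln R\<bar> powr \<eta>)
        \<le> enn2real (L F) * ((C1 powr \<beta> * q u v powr \<beta>) * ln (1 + inverse (q u v)) powr ?e)"
      by (intro mult_left_mono) auto
    finally show ?thesis by (simp add: log_power_def mult_ac)
  qed
  obtain m :: nat where m: "\<And>(G :: real ^ 'd \<Rightarrow> complex) b u v.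
       (\<And>u v. u \<in> K \<Longrightarrow> v \<in> K \<Longrightarrow> norm (u - v) \<le> \<delta> \<Longrightarrow> cmod (G u - G v) \<le> b) \<Longrightarrow>
       u \<in> K \<Longrightarrow> v \<in> K \<Longrightarrow> cmod (G u - G v) \<le> real m * b"
    using convex_oscillation[of K \<delta>] \<delta>(1) unfolding K_def by (metis convex_box(1) bounded_cbox)
  obtain B where B: "0 < B" "\<And>x. 0 \<le> x \<Longrightarrow> x \<le> 1 \<Longrightarrow> log_power \<beta> ?e x \<le> B * x powr (\<beta> / 2)"
    using log_power_le_powr[OF \<beta>(1), of ?e] by auto
  define C where "C = max (max (C\<alpha> + 1) (C1 powr \<beta>)) (real m * (C1 powr \<beta> * B))"
  have C: "0 < C" "C\<alpha> \<le> C" "C1 powr \<beta> \<le> C" "real m * (C1 powr \<beta> * B) \<le> C"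
    using C\<alpha>(1) by (auto simp: C_def)
  have sup: "cmod (F (\<alpha> u, u)) \<le> cmod (F (\<alpha> u0, u0)) + C * enn2real (L F)"
    if fin: "L F < \<infinity>" and u: "u \<in> K" for F u
  proof -
    have "cmod (F (\<alpha> u, u) - F (\<alpha> u0, u0)) \<le> real m * (C1 powr \<beta> * enn2real (L F) * B)"
    proof (rule m[where G = "\<lambda>u. F (\<alpha> u, u)", OF _ u])
      show "u0 \<in> K" using u0 by (simp add: K_def)
      fix u v assume uv: "u \<in> K" "v \<in> K" "norm (u - v) \<le> \<delta>"
      have "?h u v \<le> B * q u v powr (\<beta> / 2)" using q q4[OF uv(3)] by (intro B) auto
      also have "\<dots> \<le> B * 1" using B q q4[OF uv(3)] \<beta> by (intro mult_left_mono powr_le1) auto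
      finally have "C1 powr \<beta> * enn2real (L F) * ?h u v \<le> C1 powr \<beta> * enn2real (L F) * B"
        by (intro mult_left_mono) auto
      thus "cmod (F (\<alpha> u, u) - F (\<alpha> v, v)) \<le> C1 powr \<beta> * enn2real (L F) * B"
        using field[OF fin uv] by linarith
    qed
    also have "\<dots> = real m * (C1 powr \<beta> * B) * enn2real (L F)" by simp
    also have "\<dots> \<le> C * enn2real (L F)" using C by (intro mult_right_mono) auto
    finally show ?thesis using norm_triangle_ineq[of "F (\<alpha> u, u) - F (\<alpha> u0, u0)" "F (\<alpha> u0, u0)"] by simp
  qed
  show thesis
  proof (rule that[OF \<delta>(1) C(1)])
    show "\<bar>\<alpha> u - \<alpha> v\<bar> \<le> C * log_power \<beta> ?e (q u v)"
      if "u \<in> cbox lo hi" "v \<in> cbox lo hi" "norm (u - v) \<le> \<delta>" for u v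
      using alpha[of u v] mult_right_mono[OF C(2) log_power_nonneg[of \<beta> ?e "q u v"]] that unfolding K_def by linarith
    show "cmod (F (\<alpha> u, u) - F (\<alpha> v, v)) \<le> C * enn2real (log_modulus \<rho> ({a..b} \<times> cbox lo hi) r \<beta> \<eta> F) * log_power \<beta> ?e (q u v)"
      if "log_modulus \<rho> ({a..b} \<times> cbox lo hi) r \<beta> \<eta> F < \<infinity>" "u \<in> cbox lo hi" "v \<in> cbox lo hi" "norm (u - v) \<le> \<delta>" for F u v
    proof -
      have "cmod (F (\<alpha> u, u) - F (\<alpha> v, v)) \<le> C1 powr \<beta> * enn2real (L F) * log_power \<beta> ?e (q u v)"
        using that by (intro field) (auto simp: L_def K_def)
      also have "\<dots> \<le> C * enn2real (L F) * log_power \<beta> ?e (q u v)"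
        using C by (intro mult_right_mono) auto
      finally show ?thesis by (simp add: L_def K_def)
    qed
    show "cmod (F (\<alpha> u, u)) \<le> cmod (F (\<alpha> u0, u0)) + C * enn2real (log_modulus \<rho> ({a..b} \<times> cbox lo hi) r \<beta> \<eta> F)"
      if "log_modulus \<rho> ({a..b} \<times> cbox lo hi) r \<beta> \<eta> F < \<infinity>" "u \<in> cbox lo hi" for F u
      using sup[of F u] that by (simp add: L_def K_def)
  qed
qed

lemma product_increment_bounds:
  fixes F :: "'a \<Rightarrow> complex" and P :: "'a \<Rightarrow> real"
  assumes P: "\<bar>P u\<bar> \<le> D" "\<bar>P u - P v\<bar> \<le> D * \<bar>s\<bar>" and s: "\<bar>s\<bar> \<le> C * h" and h: "0 \<le> h"
    and F: "cmod (F u) \<le> X + C * L" "cmod (F v) \<le> X + C * L" "cmod (F u - F v) \<le> C * L * h"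
    and pos: "0 \<le> D" "0 \<le> C" "0 \<le> X" "0 \<le> L"
  shows "cmod (of_real (P u) * F u) \<le> D * (1 + C)\<^sup>2 * (X + L)"
    "cmod (of_real (P u) * F u - of_real (P v) * F v) \<le> D * (1 + C)\<^sup>2 * (X + L) * h"
proof -
  have "X + C * L \<le> (1 + C)\<^sup>2 * (X + L)"
    using pos by (simp add: power2_eq_square algebra_simps add_increasing add_increasing2)
  hence *: "D * (X + C * L) \<le> D * ((1 + C)\<^sup>2 * (X + L))" using pos by (intro mult_left_mono) auto
  have "cmod (of_real (P u) * F u) \<le> D * (X + C * L)"
    unfolding norm_mult norm_of_real using P F pos by (intro mult_mono) auto
  thus "cmod (of_real (P u) * F u) \<le> D * (1 + C)\<^sup>2 * (X + L)" using * by simp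
  have "of_real (P u) * F u - of_real (P v) * F v = of_real (P u) * (F u - F v) + of_real (P u - P v) * F v"
    by (simp add: algebra_simps)
  also have "cmod \<dots> \<le> \<bar>P u\<bar> * cmod (F u - F v) + \<bar>P u - P v\<bar> * cmod (F v)"
    by (intro order_trans[OF norm_triangle_ineq]) (simp add: norm_mult del: of_real_diff)
  also have "\<dots> \<le> D * (C * L * h) + (D * (C * h)) * (X + C * L)"
  proof (intro add_mono mult_mono P F)
    show "\<bar>P u - P v\<bar> \<le> D * (C * h)" using P(2) mult_left_mono[OF s pos(1)] by linarith
  qed (use pos h in auto)
  also have "\<dots> = D * h * (C * (X + L) + C\<^sup>2 * L)" by (simp add: power2_eq_square algebra_simps)
  also have "\<dots> \<le> D * h * ((1 + C)\<^sup>2 * (X + L))"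
    using pos h by (intro mult_left_mono) (auto simp: power2_eq_square algebra_simps)
  finally show "cmod (of_real (P u) * F u - of_real (P v) * F v) \<le> D * (1 + C)\<^sup>2 * (X + L) * h"
    by (simp add: mult_ac)
qed

definition weighted_coef ::
    "(real \<Rightarrow> 'a \<Rightarrow> 'b \<Rightarrow> complex) \<Rightarrow> ('b \<Rightarrow> real) \<Rightarrow> ('a \<Rightarrow> real) \<Rightarrow> real \<Rightarrow> (nat \<Rightarrow> real) \<Rightarrow> (nat \<Rightarrow> 'b) \<Rightarrow>
     nat \<Rightarrow> 'a \<Rightarrow> complex" where
  "weighted_coef f m \<alpha> \<gamma> t z n u =
     complex_of_real (real n powr \<gamma>) * (complex_of_real (t n powr (- 1 / \<alpha> u)) * V_field f m (z n) (\<alpha> u, u))"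

text \<open>
  The weights \<open>A\<^sub>n\<close> are a constant times \<open>n powr (\<gamma> - \<sigma>) * (X n + L n)\<close>; in the application \<open>L n\<close> is
  the modulus of continuity of the field and \<open>X n\<close> its absolute value at the base point.
\<close>

lemma weighted_coef_bounds:
  fixes lo hi u0 :: "real ^ 'd" and \<alpha> :: "real ^ 'd \<Rightarrow> real" and z :: "nat \<Rightarrow> 'b"
  assumes ab: "0 < a" "a \<le> b" "\<And>u. u \<in> K \<Longrightarrow> \<alpha> u \<in> {a..b}"
    and \<sigma>: "0 \<le> \<sigma>" "\<sigma> < 1 / b" and C: "0 \<le> C" and h: "\<And>u v. 0 \<le> h u v"
    and fb: "\<And>u v. u \<in> K \<Longrightarrow> v \<in> K \<Longrightarrow> norm (u - v) \<le> \<delta> \<Longrightarrow> \<bar>\<alpha> u - \<alpha> v\<bar> \<le> C * h u v"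
      "\<And>n u v. n \<ge> 1 \<Longrightarrow> u \<in> K \<Longrightarrow> v \<in> K \<Longrightarrow> norm (u - v) \<le> \<delta> \<Longrightarrow>
         cmod (V_field f m (z n) (\<alpha> u, u) - V_field f m (z n) (\<alpha> v, v)) \<le> C * L n * h u v"
      "\<And>n u. n \<ge> 1 \<Longrightarrow> u \<in> K \<Longrightarrow> cmod (V_field f m (z n) (\<alpha> u, u)) \<le> X n + C * L n"
    and t: "0 < c" "\<And>n. n \<ge> 1 \<Longrightarrow> c * real n \<le> t n"
    and XL: "\<And>n. 0 \<le> X n" "\<And>n. 0 \<le> L n"
    and sX: "summable (\<lambda>n. real n powr (- (2 * (\<sigma> - \<gamma>))) * (X n)\<^sup>2)"
    and sL: "summable (\<lambda>n. real n powr (- (2 * (\<sigma> - \<gamma>))) * (L n)\<^sup>2)"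
  shows "\<exists>A. summable (\<lambda>n. (A n)\<^sup>2) \<and> (\<forall>n. 0 \<le> A n) \<and>
    (\<forall>n\<ge>1. \<forall>u\<in>K. cmod (weighted_coef f m \<alpha> \<gamma> t z n u) \<le> A n) \<and>
    (\<forall>n\<ge>1. \<forall>u\<in>K. \<forall>v\<in>K. norm (u - v) \<le> \<delta> \<longrightarrow> cmod (weighted_coef f m \<alpha> \<gamma> t z n u - weighted_coef f m \<alpha> \<gamma> t z n v) \<le> A n * h u v)"
proof -
  obtain D where D: "0 < D"
    "\<And>n T s. 1 \<le> n \<Longrightarrow> c * real n \<le> T \<Longrightarrow> s \<in> {a..b} \<Longrightarrow> T powr (- 1 / s) \<le> D * real n powr - \<sigma>"
    "\<And>n T s t. 1 \<le> n \<Longrightarrow> c * real n \<le> T \<Longrightarrow> s \<in> {a..b} \<Longrightarrow> t \<in> {a..b} \<Longrightarrow>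
        \<bar>T powr (- 1 / s) - T powr (- 1 / t)\<bar> \<le> D * real n powr - \<sigma> * \<bar>s - t\<bar>"
    using arrival_power_bounds[OF ab(1,2) t(1) \<sigma>] by metis
  define E where "E = D * (1 + C)\<^sup>2"
  define A where "A n = real n powr (\<gamma> - \<sigma>) * (E * (X n + L n))" for n
  have E: "0 \<le> E" using D by (simp add: E_def)
  let ?w = "\<lambda>n. real n powr (- (2 * (\<sigma> - \<gamma>)))"
  have sq: "(A n)\<^sup>2 \<le> 2 * E\<^sup>2 * (?w n * (X n)\<^sup>2) + 2 * E\<^sup>2 * (?w n * (L n)\<^sup>2)" for n
  proof -
    have "(real n powr (\<gamma> - \<sigma>))\<^sup>2 = real n powr (- (2 * (\<sigma> - \<gamma>)))"
      by (simp add: power2_eq_square powr_add[symmetric])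
    hence "(A n)\<^sup>2 = E\<^sup>2 * real n powr (- (2 * (\<sigma> - \<gamma>))) * (X n + L n)\<^sup>2"
      by (simp only: A_def power_mult_distrib mult_ac)
    also have "\<dots> \<le> E\<^sup>2 * real n powr (- (2 * (\<sigma> - \<gamma>))) * (2 * (X n)\<^sup>2 + 2 * (L n)\<^sup>2)"
    proof (intro mult_left_mono)
      show "(X n + L n)\<^sup>2 \<le> 2 * (X n)\<^sup>2 + 2 * (L n)\<^sup>2"
        using zero_le_power2[of "X n - L n"] by (simp add: power2_sum power2_diff)
    qed auto
    finally show ?thesis by (simp add: algebra_simps)
  qed
  have "summable (\<lambda>n. (A n)\<^sup>2)"
  proof (rule summable_comparison_test')
    show "summable (\<lambda>n. 2 * E\<^sup>2 * (?w n * (X n)\<^sup>2) + 2 * E\<^sup>2 * (?w n * (L n)\<^sup>2))"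
      by (intro summable_add summable_mult sX sL)
    show "norm ((A n)\<^sup>2) \<le> 2 * E\<^sup>2 * (?w n * (X n)\<^sup>2) + 2 * E\<^sup>2 * (?w n * (L n)\<^sup>2)"
      if "n \<ge> 0" for n using sq[of n] by simp
  qed
  moreover have "0 \<le> A n" for n using XL E by (simp add: A_def)
  moreover have "cmod (weighted_coef f m \<alpha> \<gamma> t z n u) \<le> A n" if n: "n \<ge> 1" and u: "u \<in> K" for n u
  proof -
    have "cmod (complex_of_real (t n powr (- 1 / \<alpha> u)) * V_field f m (z n) (\<alpha> u, u))
       \<le> D * real n powr - \<sigma> * (1 + C)\<^sup>2 * (X n + L n)"
      by (rule product_increment_bounds(1)[where P = "\<lambda>u. t n powr (- 1 / \<alpha> u)" and F = "\<lambda>u. V_field f m (z n) (\<alpha> u, u)" and v = u and s = 0 and h = 0])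
         (use D(2)[OF n t(2)[OF n] ab(3)[OF u]] D(1) fb(3)[OF n u] XL C in auto)
    hence "cmod (weighted_coef f m \<alpha> \<gamma> t z n u) \<le> real n powr \<gamma> * (D * real n powr - \<sigma> * (1 + C)\<^sup>2 * (X n + L n))"
      unfolding weighted_coef_def norm_mult[of "complex_of_real (real n powr \<gamma>)"] by (intro mult_mono) auto
    also have "\<dots> = A n" by (simp add: A_def E_def diff_conv_add_uminus powr_add mult_ac del: add_uminus_conv_diff)
    finally show ?thesis .
  qed
  moreover have "cmod (weighted_coef f m \<alpha> \<gamma> t z n u - weighted_coef f m \<alpha> \<gamma> t z n v) \<le> A n * h u v"
    if n: "n \<ge> 1" and uv: "u \<in> K" "v \<in> K" "norm (u - v) \<le> \<delta>" for n u v
  proof -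
    have "cmod (complex_of_real (t n powr (- 1 / \<alpha> u)) * V_field f m (z n) (\<alpha> u, u) -
            complex_of_real (t n powr (- 1 / \<alpha> v)) * V_field f m (z n) (\<alpha> v, v))
       \<le> D * real n powr - \<sigma> * (1 + C)\<^sup>2 * (X n + L n) * h u v"
      by (rule product_increment_bounds(2)[where P = "\<lambda>u. t n powr (- 1 / \<alpha> u)" and F = "\<lambda>u. V_field f m (z n) (\<alpha> u, u)" and s = "\<alpha> u - \<alpha> v"])
         (use D(2)[OF n t(2)[OF n] ab(3)[OF uv(1)]] D(3)[OF n t(2)[OF n] ab(3)[OF uv(1)] ab(3)[OF uv(2)]]
            D(1) fb(1)[OF uv] fb(2)[OF n uv] fb(3)[OF n uv(1)] fb(3)[OF n uv(2)] XL C h in auto)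
    hence "cmod (weighted_coef f m \<alpha> \<gamma> t z n u - weighted_coef f m \<alpha> \<gamma> t z n v)
       \<le> real n powr \<gamma> * (D * real n powr - \<sigma> * (1 + C)\<^sup>2 * (X n + L n) * h u v)"
      unfolding weighted_coef_def right_diff_distrib[symmetric] norm_mult[of "complex_of_real (real n powr \<gamma>)"]
      by (intro mult_mono) auto
    also have "\<dots> = A n * h u v" by (simp add: A_def E_def diff_conv_add_uminus powr_add mult_ac del: add_uminus_conv_diff)
    finally show ?thesis .
  qed
  ultimately show ?thesis by blast
qed

lemma grid_bounded_weighted_coef_measurable:
  fixes f :: "real \<Rightarrow> real ^ 'd \<Rightarrow> real ^ 'd \<Rightarrow> complex" and lo hi u0 :: "real ^ 'd"
  defines "S \<equiv> PiM {1..} (\<lambda>_::nat. borel :: real measure) \<Otimes>\<^sub>M PiM {1..} (\<lambda>_::nat. borel :: (real ^ 'd) measure)"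
    and "T \<equiv> PiM {1..} (\<lambda>_::nat. borel :: complex measure)"
  assumes f: "\<And>u. u \<in> cbox lo hi \<Longrightarrow> f (\<alpha> u) u \<in> borel_measurable borel"
    and m: "m \<in> borel_measurable borel" and u0: "u0 \<in> cbox lo hi"
  shows "{x \<in> space (S \<Otimes>\<^sub>M T). grid_bounded lo hi \<delta> w u0 (weighted_coef f m \<alpha> \<gamma> (fst (fst x)) (snd (fst x))) (snd x)} \<in> sets (S \<Otimes>\<^sub>M T)"
proof -
  let ?cf = "\<lambda>x. weighted_coef f m \<alpha> \<gamma> (fst (fst x)) (snd (fst x))"
  have t: "(\<lambda>x. fst (fst x) n) \<in> borel_measurable (S \<Otimes>\<^sub>M T)" if "n \<ge> 1" for n
  proof -
    have [measurable]: "(\<lambda>y. y n) \<in> borel_measurable (PiM {1..} (\<lambda>_::nat. borel :: real measure))"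
      using that by (intro measurable_component_singleton) auto
    show ?thesis unfolding S_def by measurable
  qed
  have z: "(\<lambda>x. snd (fst x) n) \<in> borel_measurable (S \<Otimes>\<^sub>M T)" if "n \<ge> 1" for n
  proof -
    have [measurable]: "(\<lambda>y. y n) \<in> borel_measurable (PiM {1..} (\<lambda>_::nat. borel :: (real ^ 'd) measure))"
      using that by (intro measurable_component_singleton) auto
    show ?thesis unfolding S_def by measurable
  qed
  have x: "(\<lambda>x. snd x n) \<in> borel_measurable (S \<Otimes>\<^sub>M T)" if "n \<ge> 1" for n
  proof -
    have [measurable]: "(\<lambda>y. y n) \<in> borel_measurable T"
      unfolding T_def using that by (intro measurable_component_singleton) auto
    show ?thesis by measurable
  qed
  have weighted_coef: "(\<lambda>x. ?cf x n u) \<in> borel_measurable (S \<Otimes>\<^sub>M T)"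
    if "n \<ge> 1" "u \<in> cbox lo hi" for n u
  proof -
    note [measurable] = t[OF that(1)] z[OF that(1)] f[OF that(2)] m
    show ?thesis unfolding weighted_coef_def V_field_def by simp
  qed
  have s1: "(\<lambda>x. \<Sum>n=1..N. (?cf x n u - ?cf x n v) * snd x n)
      \<in> borel_measurable (S \<Otimes>\<^sub>M T)" if "u \<in> cbox lo hi" "v \<in> cbox lo hi" for N u v
    using that by (intro borel_measurable_sum borel_measurable_times borel_measurable_diff weighted_coef x) auto
  have s2: "(\<lambda>x. \<Sum>n=1..N. ?cf x n u0 * snd x n)
      \<in> borel_measurable (S \<Otimes>\<^sub>M T)" for N
    using u0 by (intro borel_measurable_sum borel_measurable_times weighted_coef x) auto
  obtain C B :: nat where fin: "\<And>k. finite (grid_pairs lo hi \<delta> k)"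
    using grid_pairs_card[of lo hi \<delta>] by metis
  have p1: "Measurable.pred (S \<Otimes>\<^sub>M T) (\<lambda>x. \<forall>i\<in>grid_pairs lo hi \<delta> k. \<forall>N.
        cmod (\<Sum>n=1..N. (?cf x n (fst i) - ?cf x n (snd i)) * snd x n)
          \<le> real L * sqrt (real k) * w (fst i) (snd i))" for k and L :: nat
  proof (intro pred_intros_finite(3) fin pred_intros_countable)
    fix i N assume i: "i \<in> grid_pairs lo hi \<delta> k"
    have "fst i \<in> cbox lo hi" "snd i \<in> cbox lo hi"
      using i grid_pairs_in_cbox[of "fst i" "snd i" lo hi \<delta> k] by auto
    note [measurable] = s1[OF this, of N]
    show "Measurable.pred (S \<Otimes>\<^sub>M T) (\<lambda>x.
        cmod (\<Sum>n=1..N. (?cf x n (fst i) - ?cf x n (snd i)) * snd x n)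
          \<le> real L * sqrt (real k) * w (fst i) (snd i))"
      by measurable
  qed
  have p2: "Measurable.pred (S \<Otimes>\<^sub>M T) (\<lambda>x. cmod (\<Sum>n=1..N. ?cf x n u0 * snd x n) \<le> real L)" for N and L :: nat
    using s2[of N] by measurable
  have "Measurable.pred (S \<Otimes>\<^sub>M T) (\<lambda>x. grid_bounded lo hi \<delta> w u0 (?cf x) (snd x))"
    unfolding grid_bounded_def
    by (intro pred_intros_logic pred_intros_countable p1 p2) simp
  thus ?thesis by (simp add: pred_def)
qed

section \<open>Summation by parts\<close>

text \<open>
  Summation by parts; the differences of the decreasing sequence \<open>a\<close> telescope.
\<close>

lemma abel_tail_bound:
  fixes R :: "nat \<Rightarrow> complex" and a :: "nat \<Rightarrow> real"
  assumes a: "\<And>n. n \<ge> 1 \<Longrightarrow> 0 \<le> a n" "\<And>n. n \<ge> 1 \<Longrightarrow> a (Suc n) \<le> a n" and R: "\<And>n. cmod (R n) \<le> B" and NM: "N \<le> M"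
  shows "cmod (\<Sum>n=Suc N..M. of_real (a n) * (R n - R (n - 1))) \<le> 2 * B * a (Suc N)"
proof -
  have eq: "(\<Sum>n=Suc N..M. of_real (a n) * (R n - R (n - 1)))
     = of_real (a (Suc M)) * R M - of_real (a (Suc N)) * R N + (\<Sum>n=Suc N..M. of_real (a n - a (Suc n)) * R n)"
    using NM by (induction M rule: dec_induct) (simp_all add: algebra_simps)
  have tel: "(\<Sum>n=Suc N..M. a n - a (Suc n)) = a (Suc N) - a (Suc M)"
    using NM by (induction M rule: dec_induct) simp_all
  have "cmod (\<Sum>n=Suc N..M. of_real (a n - a (Suc n)) * R n) \<le> (\<Sum>n=Suc N..M. (a n - a (Suc n)) * B)"
    using a R by (intro sum_norm_le) (auto simp: norm_mult simp del: of_real_diff intro!: mult_mono)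
  also have "\<dots> = (a (Suc N) - a (Suc M)) * B" by (simp add: sum_distrib_right[symmetric] tel)
  finally have 1: "cmod (\<Sum>n=Suc N..M. of_real (a n - a (Suc n)) * R n) \<le> (a (Suc N) - a (Suc M)) * B" .
  have 2: "cmod (of_real (a (Suc k)) * R k) \<le> a (Suc k) * B" for k
    using a(1)[of "Suc k"] R[of k] by (simp add: norm_mult mult_left_mono)
  have "cmod (\<Sum>n=Suc N..M. of_real (a n) * (R n - R (n - 1)))
     \<le> a (Suc M) * B + a (Suc N) * B + (a (Suc N) - a (Suc M)) * B"
    unfolding eq by (intro order_trans[OF norm_diff_add_le] add_mono 1 2)
  thus ?thesis by (simp add: algebra_simps)
qed

lemma weighted_tail_bound:
  fixes x :: "nat \<Rightarrow> complex"
  assumes \<gamma>: "0 \<le> \<gamma>" and B: "\<And>n. cmod (\<Sum>i=1..n. of_real (real i powr \<gamma>) * x i) \<le> B" and NM: "N \<le> M"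
  shows "cmod ((\<Sum>n=1..M. x n) - (\<Sum>n=1..N. x n)) \<le> 2 * B * real (Suc N) powr - \<gamma>"
proof -
  define R where "R n = (\<Sum>i=1..n. of_real (real i powr \<gamma>) * x i)" for n
  have x: "x n = of_real (real n powr - \<gamma>) * (R n - R (n - 1))" if "n \<ge> 1" for n
  proof -
    from that obtain k where k: "n = Suc k" by (cases n) auto
    have "R n - R (n - 1) = of_real (real n powr \<gamma>) * x n" by (simp add: R_def k)
    moreover have "real n powr - \<gamma> * real n powr \<gamma> = 1"
      using that by (simp add: powr_minus)
    ultimately show ?thesis by (simp add: mult.assoc[symmetric] of_real_mult[symmetric] del: of_real_mult)
  qed
  have "(\<Sum>n=1..M. x n) - (\<Sum>n=1..N. x n) = (\<Sum>n=Suc N..M. x n)"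
    using NM sum.ub_add_nat[of 1 N x "M - N"] by simp
  also have "\<dots> = (\<Sum>n=Suc N..M. of_real (real n powr - \<gamma>) * (R n - R (n - 1)))"
    using x by (intro sum.cong) auto
  also have "cmod \<dots> \<le> 2 * B * real (Suc N) powr - \<gamma>"
    using NM B \<gamma> unfolding R_def by (intro abel_tail_bound) (auto intro!: powr_mono2')
  finally show ?thesis .
qed

text \<open>
  The tail bound is used twice: for the terms at a point, where it gives the Cauchy property and
  the rate, and for the differences of the terms at two points with no initial terms removed,
  where it gives the modulus.
\<close>

lemma weighted_sums_bounded_imp_convergence:
  fixes x :: "nat \<Rightarrow> 'a \<Rightarrow> complex" and h :: "'a \<Rightarrow> 'a \<Rightarrow> real"
  defines "S N u \<equiv> \<Sum>n=1..N. x n u"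
  assumes \<gamma>: "0 < \<gamma>"
    and bd: "\<And>N u. u \<in> K \<Longrightarrow> cmod (\<Sum>n=1..N. of_real (real n powr \<gamma>) * x n u) \<le> B"
    and inc: "\<And>N u v. u \<in> K \<Longrightarrow> v \<in> K \<Longrightarrow>
       cmod ((\<Sum>n=1..N. of_real (real n powr \<gamma>) * x n u) - (\<Sum>n=1..N. of_real (real n powr \<gamma>) * x n v)) \<le> B * h u v"
    and l: "\<And>u. convergent (\<lambda>N. S N u) \<Longrightarrow> l u = lim (\<lambda>N. S N u)"
  shows "uniform_limit K S l sequentially"
    "\<And>u v. u \<in> K \<Longrightarrow> v \<in> K \<Longrightarrow> cmod (l u - l v) \<le> 2 * B * h u v"
    "\<And>N u. u \<in> K \<Longrightarrow> cmod (l u - S N u) \<le> 2 * B * real (Suc N) powr - \<gamma>"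
proof -
  have tail: "cmod (S M u - S N u) \<le> 2 * B * real (Suc N) powr - \<gamma>" if "N \<le> M" "u \<in> K" for M N u
    unfolding S_def using \<gamma> bd[OF that(2)] that(1) by (intro weighted_tail_bound) auto
  have "((\<lambda>N. 2 * B * real (Suc N) powr - \<gamma>) \<longlongrightarrow> 2 * B * 0) sequentially"
    using \<gamma> by (intro tendsto_mult tendsto_const tendsto_neg_powr filterlim_compose[OF filterlim_real_sequentially filterlim_Suc]) auto
  hence lim0: "(\<lambda>N. 2 * B * real (Suc N) powr - \<gamma>) \<longlonglongrightarrow> 0" by simp
  have conv: "(\<lambda>N. S N u) \<longlonglongrightarrow> l u" if u: "u \<in> K" for u
  proof -
    have "Cauchy (\<lambda>N. S N u)"
    proof (rule CauchyI')
      fix e :: real assume "0 < e"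
      then obtain N0 where N0: "\<And>N. N \<ge> N0 \<Longrightarrow> 2 * B * real (Suc N) powr - \<gamma> < e"
        using order_tendstoD(2)[OF lim0] by (auto simp: eventually_sequentially)
      have "dist (S N u) (S M u) < e" if "N \<ge> N0" "N < M" for N M
        using tail[OF less_imp_le[OF that(2)] u] N0[OF that(1)] by (simp add: dist_norm norm_minus_commute)
      thus "\<exists>N0. \<forall>N\<ge>N0. \<forall>M>N. dist (S N u) (S M u) < e" by blast
    qed
    hence "convergent (\<lambda>N. S N u)" by (rule Cauchy_convergent)
    thus ?thesis using l[of u] by (simp add: convergent_LIMSEQ_iff)
  qed
  show rate: "cmod (l u - S N u) \<le> 2 * B * real (Suc N) powr - \<gamma>" if u: "u \<in> K" for N u
  proof (rule LIMSEQ_le_const2)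
    show "(\<lambda>M. cmod (S M u - S N u)) \<longlonglongrightarrow> cmod (l u - S N u)" by (intro tendsto_intros conv u)
    show "\<exists>M0. \<forall>M\<ge>M0. cmod (S M u - S N u) \<le> 2 * B * real (Suc N) powr - \<gamma>" using tail[OF _ u] by blast
  qed
  show "uniform_limit K S l sequentially"
  proof (rule uniform_limitI)
    fix e :: real assume "0 < e"
    from order_tendstoD(2)[OF lim0 this] show "\<forall>\<^sub>F N in sequentially. \<forall>u\<in>K. dist (S N u) (l u) < e"
    proof eventually_elim
      case (elim N)
      show ?case using rate[of _ N] elim by (auto simp: dist_norm norm_minus_commute intro: le_less_trans)
    qed
  qed
  show "cmod (l u - l v) \<le> 2 * B * h u v" if uv: "u \<in> K" "v \<in> K" for u v
  proof (rule LIMSEQ_le_const2)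
    show "(\<lambda>M. cmod (S M u - S M v)) \<longlonglongrightarrow> cmod (l u - l v)" by (intro tendsto_intros conv uv)
    have "cmod (S M u - S M v) \<le> 2 * B * h u v" for M
    proof -
      have "cmod ((\<Sum>n=1..M. x n u - x n v) - (\<Sum>n=1..0. x n u - x n v)) \<le> 2 * (B * h u v) * real (Suc 0) powr - \<gamma>"
      proof (rule weighted_tail_bound)
        show "cmod (\<Sum>n=1..N. of_real (real n powr \<gamma>) * (x n u - x n v)) \<le> B * h u v" for N
          using inc[OF uv, of N] by (simp add: right_diff_distrib sum_subtractf)
      qed (use \<gamma> in auto)
      thus ?thesis by (simp add: S_def sum_subtractf)
    qed
    thus "\<exists>M0. \<forall>M\<ge>M0. cmod (S M u - S M v) \<le> 2 * B * h u v" by blast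
  qed
qed

section \<open>Uniform convergence, modulus of continuity and rate\<close>

theorem proposition5p2:
  fixes M :: "'w measure"
    and lo hi u0 :: "real ^ 'd"
    and K :: "(real ^ 'd) set"
    and \<rho>t :: "real ^ 'd \<Rightarrow> real ^ 'd \<Rightarrow> real"
    and \<rho> :: "real \<times> (real ^ 'd) \<Rightarrow> real \<times> (real ^ 'd) \<Rightarrow> real"
    and Hl Hu c1 c2 a b r p \<beta> \<eta> :: real
    and \<alpha> :: "real ^ 'd \<Rightarrow> real"
    and g :: "nat \<Rightarrow> 'w \<Rightarrow> complex"
    and X :: "real \<Rightarrow> 'w \<Rightarrow> nat"
    and T :: "nat \<Rightarrow> 'w \<Rightarrow> real"
    and \<nu> :: "(real ^ 'd) measure"
    and m :: "real ^ 'd \<Rightarrow> real"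
    and \<xi> :: "nat \<Rightarrow> 'w \<Rightarrow> real ^ 'd"
    and f :: "real \<Rightarrow> real ^ 'd \<Rightarrow> real ^ 'd \<Rightarrow> complex"
  assumes "prob_space M"
    and K: "K = cbox lo hi" and "u0 \<in> K"
    and "quasi_metric \<rho>t"
    and "0 < Hl" "Hl \<le> Hu" "Hu \<le> 1" "0 < c1" "0 < c2"
    and "\<And>x y. norm (x - y) \<le> 1 \<Longrightarrow>
           c1 * norm (x - y) powr Hu \<le> \<rho>t x y \<and> \<rho>t x y \<le> c2 * norm (x - y) powr Hl"
    and "\<And>u. u \<in> K \<Longrightarrow> 0 < \<alpha> u \<and> \<alpha> u < 2"
    and "\<alpha> \<in> holder_log \<rho>t K 1 0"
    and a: "a = Inf (\<alpha> ` K)" and b: "b = Sup (\<alpha> ` K)"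
    and \<rho>: "\<rho> = (\<lambda>(s, u) (t, v). \<bar>s - t\<bar> + \<rho>t u v)"
    and "prob_space.indep_vars M (\<lambda>_. borel) g {1..}"
    and "\<And>n. n \<ge> 1 \<Longrightarrow> symmetric_rv M (g n)"
    and "\<And>n. n \<ge> 1 \<Longrightarrow> sub_gaussian M (g n) 1"
    and "poisson_process M 1 X"
    and "AE \<omega> in M. \<forall>n\<ge>1. T n \<omega> = arrival_time X n \<omega>"
    and "sigma_finite_measure \<nu>" and "sets \<nu> = sets borel"
    and "m \<in> borel_measurable borel" and "AE z in \<nu>. 0 < m z"
    and "prob_space.indep_vars M (\<lambda>_. borel) \<xi> {1..}"
    and "\<And>n. n \<ge> 1 \<Longrightarrow> distr M borel (\<xi> n) = density \<nu> (\<lambda>z. ennreal (m z))"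
    and "indep_three_seqs M g T \<xi>"
    and "\<And>s u. s \<in> {a..b} \<Longrightarrow> u \<in> K \<Longrightarrow> f s u \<in> borel_measurable borel"
    and "\<And>s u. s \<in> {a..b} \<Longrightarrow> u \<in> K \<Longrightarrow> (\<integral>\<^sup>+ z. ennreal (cmod (f s u z) powr s) \<partial>\<nu>) < \<infinity>"
    and "0 < r" "b / 2 < p" "0 < \<beta>" "\<beta> \<le> 1"
    and "(\<lambda>z. log_modulus \<rho> ({a..b} \<times> K) r \<beta> \<eta> (V_field f m z)) \<in> borel_measurable (completion \<nu>)"
    and "(\<integral>\<^sup>+ \<omega>. enn_powr (log_modulus \<rho> ({a..b} \<times> K) r \<beta> \<eta> (V_field f m (\<xi> 1 \<omega>))) (2 * p) \<partial>M) < \<infinity>"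
    and "(\<integral>\<^sup>+ \<omega>. ennreal (cmod (V_field f m (\<xi> 1 \<omega>) (\<alpha> u0, u0)) powr (2 * p)) \<partial>M) < \<infinity>"
  shows "(AE \<omega> in M. uniform_limit K (\<lambda>N. S_partial f m \<alpha> T \<xi> g N \<omega>) (S_limit f m \<alpha> T \<xi> g \<omega>) sequentially)
       \<and> (AE \<omega> in M. S_limit f m \<alpha> T \<xi> g \<omega> \<in> holder_log \<rho>t K \<beta> (max \<eta> 0 + 1 / 2))
       \<and> (\<forall>p'>0. 1 / p' \<in> {0<..<1 / b - 1 / min (2 * p) 2} \<longrightarrow>
            (AE \<omega> in M.
               (SUP N::nat. ennreal (real N powr (1 / p')) *
                  (SUP u\<in>K. ennreal (cmod (S_limit f m \<alpha> T \<xi> g \<omega> u - S_partial f m \<alpha> T \<xi> g N \<omega> u))))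
               < \<infinity>))"
proof -
  interpret prob_space M by (fact assms(1))
  note qm = assms(4) and Hl = assms(5) and c2 = assms(9)
  have up: "\<And>x y. norm (x - y) \<le> 1 \<Longrightarrow> \<rho>t x y \<le> c2 * norm (x - y) powr Hl" using assms(10) by blast
  have q0: "0 \<le> \<rho>t u v" for u v using qm by (simp add: quasi_metric_def)
  have u0: "u0 \<in> cbox lo hi" using assms(3) K by simp
  let ?e = "max \<eta> 0"
  let ?h = "\<lambda>u v. log_power \<beta> ?e (\<rho>t u v)" and ?h' = "\<lambda>u v. log_power \<beta> (?e + 1 / 2) (\<rho>t u v)"
  let ?cf = "\<lambda>\<gamma> \<omega>. weighted_coef f m \<alpha> \<gamma> (\<lambda>n. T n \<omega>) (\<lambda>n. \<xi> n \<omega>)"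
  let ?Sl = "S_limit f m \<alpha> T \<xi> g" and ?SN = "S_partial f m \<alpha> T \<xi> g"
  obtain C\<alpha> where C\<alpha>: "0 < C\<alpha>" "\<And>u v. u \<in> K \<Longrightarrow> v \<in> K \<Longrightarrow>
      norm (\<alpha> u - \<alpha> v) \<le> C\<alpha> * \<rho>t u v powr 1 * ln (1 + inverse (\<rho>t u v)) powr 0"
    using assms(12) unfolding holder_log_def by blast
  have \<alpha>_lip: "\<bar>\<alpha> u - \<alpha> v\<bar> \<le> C\<alpha> * \<rho>t u v" if "u \<in> K" "v \<in> K" for u v
  proof -
    have "C\<alpha> * \<rho>t u v powr 1 * ln (1 + inverse (\<rho>t u v)) powr 0 \<le> C\<alpha> * \<rho>t u v * 1"
      using C\<alpha>(1) q0[of u v] by (intro mult_mono) auto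
    thus ?thesis using C\<alpha>(2)[OF that] by simp
  qed
  have "continuous_on K (\<lambda>u. complex_of_real (\<alpha> u))"
  proof (rule log_power_modulus_continuous_on[OF Hl c2 q0 up, of 1 0 1 C\<alpha>])
    show "cmod (complex_of_real (\<alpha> u) - complex_of_real (\<alpha> v)) \<le> C\<alpha> * log_power 1 0 (\<rho>t u v)"
      if "u \<in> K" "v \<in> K" "norm (u - v) \<le> 1" for u v
    proof -
      have "cmod (complex_of_real (\<alpha> u) - complex_of_real (\<alpha> v)) = norm (\<alpha> u - \<alpha> v)"
        by (simp flip: of_real_diff)
      thus ?thesis using C\<alpha>(2)[OF that(1,2)] by (simp only: log_power_def mult.assoc)
    qed
  qed (use C\<alpha>(1) in auto)
  hence cont: "continuous_on K \<alpha>" using continuous_on_Re by fastforce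
  have Kc: "compact K" "K \<noteq> {}" using K assms(3) by auto
  have ab: "\<alpha> u \<in> {a..b}" if "u \<in> K" for u
  proof -
    have "bounded (\<alpha> ` K)" using Kc cont by (intro compact_imp_bounded compact_continuous_image)
    hence "bdd_below (\<alpha> ` K)" "bdd_above (\<alpha> ` K)" by (auto intro: bounded_imp_bdd_above bounded_imp_bdd_below)
    thus ?thesis unfolding a b using that by (auto intro: cInf_lower cSup_upper)
  qed
  have a0: "0 < a"
  proof -
    obtain u where u: "u \<in> K" "\<And>v. v \<in> K \<Longrightarrow> \<alpha> u \<le> \<alpha> v"
      using continuous_attains_inf[OF Kc cont] by blast
    have "\<alpha> u \<le> a" unfolding a using Kc(2) u by (intro cInf_greatest) auto
    thus ?thesis using assms(11)[OF u(1)] by simp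
  qed
  have b2: "b < 2"
  proof -
    obtain u where u: "u \<in> K" "\<And>v. v \<in> K \<Longrightarrow> \<alpha> v \<le> \<alpha> u"
      using continuous_attains_sup[OF Kc cont] by blast
    have "b \<le> \<alpha> u" unfolding b using Kc(2) u by (intro cSup_least) auto
    thus ?thesis using assms(11)[OF u(1)] by simp
  qed
  have a_le_b: "a \<le> b" using ab[OF assms(3)] by simp
  have b0: "0 < b" using a0 a_le_b by simp
  have p: "0 < p" using b0 assms(31) by simp
  define q where "q = min p 1"
  have q: "0 < q" "min (2 * p) 2 = 2 * q" "b < 2 * q" using p b2 assms(31) by (auto simp: q_def min_def)

  define \<Lambda> where "\<Lambda> z = log_modulus \<rho> ({a..b} \<times> K) r \<beta> \<eta> (V_field f m z)" for z
  obtain \<delta> C where \<delta>: "0 < \<delta>" and C: "0 < C"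
    and fb\<alpha>: "\<And>u v. u \<in> K \<Longrightarrow> v \<in> K \<Longrightarrow> norm (u - v) \<le> \<delta> \<Longrightarrow> \<bar>\<alpha> u - \<alpha> v\<bar> \<le> C * ?h u v"
    and fbV: "\<And>z u v. \<Lambda> z < \<infinity> \<Longrightarrow> u \<in> K \<Longrightarrow> v \<in> K \<Longrightarrow> norm (u - v) \<le> \<delta> \<Longrightarrow>
        cmod (V_field f m z (\<alpha> u, u) - V_field f m z (\<alpha> v, v)) \<le> C * enn2real (\<Lambda> z) * ?h u v"
    and fbS: "\<And>z u. \<Lambda> z < \<infinity> \<Longrightarrow> u \<in> K \<Longrightarrow>
        cmod (V_field f m z (\<alpha> u, u)) \<le> cmod (V_field f m z (\<alpha> u0, u0)) + C * enn2real (\<Lambda> z)"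
  proof (rule log_modulus_graph_bounds[OF qm Hl c2 up assms(32,33,30) less_imp_le[OF C\<alpha>(1)] _ _ u0 \<rho>, where \<alpha> = \<alpha> and a = a and b = b and \<eta> = \<eta>])
    show "\<bar>\<alpha> u - \<alpha> v\<bar> \<le> C\<alpha> * \<rho>t u v" if "u \<in> cbox lo hi" "v \<in> cbox lo hi" for u v
      using \<alpha>_lip that K by simp
    show "\<alpha> u \<in> {a..b}" if "u \<in> cbox lo hi" for u using ab that K by simp
  qed (use that in \<open>simp_all add: K \<Lambda>_def\<close>)

  have T_low: "AE \<omega> in M. \<exists>c>0. \<forall>n\<ge>1. c * real n \<le> T n \<omega>"
    using arrival_time_linear_lower_bound[OF assms(1,19)] assms(20) by eventually_elim auto
  have \<xi>: "\<xi> n \<in> measurable M borel" if "n \<ge> 1" for n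
    using assms(25) that by (auto simp: indep_vars_def)
  have fm: "f (\<alpha> u) u \<in> borel_measurable borel" if "u \<in> K" for u
    using ab[OF that] that by (intro assms(28)) auto

  let ?S = "PiM {1..} (\<lambda>_::nat. borel :: real measure) \<Otimes>\<^sub>M PiM {1..} (\<lambda>_::nat. borel :: (real ^ 'd) measure)"
  let ?T = "PiM {1..} (\<lambda>_::nat. borel :: complex measure)"
  define Y where "Y \<omega> = (\<lambda>n\<in>{1..}. T n \<omega>, \<lambda>n\<in>{1..}. \<xi> n \<omega>)" for \<omega>
  define G where "G \<omega> = (\<lambda>n\<in>{1..}. g n \<omega>)" for \<omega>
  have YG: "Y \<in> measurable M ?S" "G \<in> measurable M ?T"
    "distr M ?S Y \<Otimes>\<^sub>M distr M ?T G = distr M (?S \<Otimes>\<^sub>M ?T) (\<lambda>\<omega>. (Y \<omega>, G \<omega>))"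
    using indep_three_seqs_distr_pair[OF assms(1,27)] unfolding Y_def G_def by blast+

  have core: "AE \<omega> in M. \<exists>B>0. \<forall>N.
      (\<forall>u\<in>K. cmod (\<Sum>n=1..N. ?cf \<gamma> \<omega> n u * g n \<omega>) \<le> B) \<and>
      (\<forall>u\<in>K. \<forall>v\<in>K. cmod ((\<Sum>n=1..N. ?cf \<gamma> \<omega> n u * g n \<omega>) -
           (\<Sum>n=1..N. ?cf \<gamma> \<omega> n v * g n \<omega>))
         \<le> B * ?h' u v)"
    if \<gamma>: "0 < \<gamma>" "\<gamma> < 1 / b - 1 / (2 * q)" for \<gamma>
  proof -
    \<comment> \<open>Any \<open>\<sigma>\<close> with \<open>\<gamma> + 1 / (2 q) < \<sigma> < 1 / b\<close> works: the lower bound makes the weights square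
      summable, the upper bound absorbs the logarithms of \<open>T\<^sub>n\<close>.\<close>
    define \<sigma> where "\<sigma> = (\<gamma> + 1 / (2 * q) + 1 / b) / 2"
    have \<sigma>: "\<gamma> + 1 / (2 * q) < \<sigma>" "\<sigma> < 1 / b" using \<gamma> by (auto simp: \<sigma>_def)
    have \<sigma>0: "0 \<le> \<sigma>" using \<sigma>(1) \<gamma>(1) q(1) by (smt (verit) divide_pos_pos)
    define s where "s = 2 * (\<sigma> - \<gamma>)"
    have s: "1 < s * min p 1"
    proof -
      have "1 / (2 * q) * (2 * q) < (\<sigma> - \<gamma>) * (2 * q)" using \<sigma>(1) q(1) by (intro mult_strict_right_mono) auto
      thus ?thesis using q(1) by (simp add: s_def q_def[symmetric] mult_ac)
    qed
    have sL: "AE \<omega> in M. (\<forall>n\<ge>1. \<Lambda> (\<xi> n \<omega>) < \<infinity>) \<and> summable (\<lambda>n. real n powr (- s) * (enn2real (\<Lambda> (\<xi> n \<omega>)))\<^sup>2)"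
      using assms(34,35) unfolding \<Lambda>_def[symmetric]
      by (intro AE_modulus_summable[OF assms(1) \<xi> assms(26,22,23) _ p _ s])
    have sX: "AE \<omega> in M. summable (\<lambda>n. real n powr (- s) * (cmod (V_field f m (\<xi> n \<omega>) (\<alpha> u0, u0)))\<^sup>2)"
    proof (rule AE_summable_identically_distributed[OF assms(1) \<xi> assms(26) _ p _ s])
      note [measurable] = fm[OF assms(3)] assms(23)
      show "(\<lambda>z. cmod (V_field f m z (\<alpha> u0, u0))) \<in> borel_measurable borel"
        unfolding V_field_def by simp
    qed (use assms(36) in auto)
    define good where "good t z \<longleftrightarrow> (\<exists>A. summable (\<lambda>n. (A n)\<^sup>2) \<and> (\<forall>n. 0 \<le> A n) \<and>
      (\<forall>n\<ge>1. \<forall>u\<in>K. cmod (weighted_coef f m \<alpha> \<gamma> t z n u) \<le> A n) \<and>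
      (\<forall>n\<ge>1. \<forall>u\<in>K. \<forall>v\<in>K. norm (u - v) \<le> \<delta> \<longrightarrow>
         cmod (weighted_coef f m \<alpha> \<gamma> t z n u - weighted_coef f m \<alpha> \<gamma> t z n v) \<le> A n * ?h u v))" for t z
    have good: "AE \<omega> in M. good (\<lambda>n. T n \<omega>) (\<lambda>n. \<xi> n \<omega>)"
      using T_low sL sX
    proof eventually_elim
      case (elim \<omega>)
      then obtain c where c: "0 < c" "\<And>n. n \<ge> 1 \<Longrightarrow> c * real n \<le> T n \<omega>" by blast
      show ?case unfolding good_def
        by (rule weighted_coef_bounds[OF a0 a_le_b ab \<sigma>0 \<sigma>(2) less_imp_le[OF C], where c = c
              and X = "\<lambda>n. cmod (V_field f m (\<xi> n \<omega>) (\<alpha> u0, u0))" and L = "\<lambda>n. enn2real (\<Lambda> (\<xi> n \<omega>))"])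
           (use elim c fb\<alpha> fbV fbS in \<open>auto simp: s_def\<close>)
    qed
    have coef_Y: "weighted_coef f m \<alpha> \<gamma> (fst (Y \<omega>)) (snd (Y \<omega>)) n = ?cf \<gamma> \<omega> n"
      if "n \<ge> 1" for n \<omega> using that by (simp add: weighted_coef_def Y_def fun_eq_iff)
    \<comment> \<open>Freeze \<open>(T, \<xi>)\<close> and use the bound for deterministic coefficients.\<close>
    let ?gb = "grid_bounded lo hi \<delta> (\<lambda>u v. ?h u v) u0"
    have "AE \<omega> in M. ?gb (weighted_coef f m \<alpha> \<gamma> (fst (Y \<omega>)) (snd (Y \<omega>))) (G \<omega>)"
    proof (rule AE_product_distr_freeze[OF YG])
      show "{x \<in> space (?S \<Otimes>\<^sub>M ?T). ?gb (weighted_coef f m \<alpha> \<gamma> (fst (fst x)) (snd (fst x))) (snd x)} \<in> sets (?S \<Otimes>\<^sub>M ?T)"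
        using fm K by (intro grid_bounded_weighted_coef_measurable assms(23) u0) auto
      show "AE \<omega>' in M. AE \<omega> in M. ?gb (weighted_coef f m \<alpha> \<gamma> (fst (Y \<omega>')) (snd (Y \<omega>'))) (G \<omega>)"
        using good
      proof eventually_elim
        case (elim \<omega>')
        then obtain A where A: "summable (\<lambda>n. (A n)\<^sup>2)"
          "\<And>n u. n \<ge> 1 \<Longrightarrow> u \<in> K \<Longrightarrow> cmod (?cf \<gamma> \<omega>' n u) \<le> A n"
          "\<And>n u v. n \<ge> 1 \<Longrightarrow> u \<in> K \<Longrightarrow> v \<in> K \<Longrightarrow> norm (u - v) \<le> \<delta> \<Longrightarrow>
             cmod (?cf \<gamma> \<omega>' n u - ?cf \<gamma> \<omega>' n v)
               \<le> A n * ?h u v"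
          unfolding good_def by blast
        have "AE \<omega> in M. ?gb (?cf \<gamma> \<omega>') (\<lambda>n. g n \<omega>)"
          using A(2,3) assms(3) unfolding K
          by (intro AE_grid_bounded[OF assms(16-18) A(1)]) auto
        thus ?case
        proof eventually_elim
          case (elim \<omega>)
          thus ?case
            by (subst grid_bounded_cong[OF coef_Y]) (auto simp: G_def cong: grid_bounded_cong)
        qed
      qed
    qed
    with good show ?thesis
    proof eventually_elim
      case (elim \<omega>)
      from elim(1) obtain A where A: "\<And>n. 0 \<le> A n"
        "\<And>n u v. n \<ge> 1 \<Longrightarrow> u \<in> K \<Longrightarrow> v \<in> K \<Longrightarrow> norm (u - v) \<le> \<delta> \<Longrightarrow>
           cmod (?cf \<gamma> \<omega> n u - ?cf \<gamma> \<omega> n v)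
             \<le> A n * ?h u v"
        unfolding good_def by blast
      have "?gb (weighted_coef f m \<alpha> \<gamma> (fst (Y \<omega>)) (snd (Y \<omega>))) (G \<omega>) \<longleftrightarrow>
          ?gb (?cf \<gamma> \<omega>) (\<lambda>n. g n \<omega>)"
        by (rule grid_bounded_cong[OF coef_Y]) (simp_all add: G_def)
      hence "?gb (?cf \<gamma> \<omega>) (\<lambda>n. g n \<omega>)" using elim(2) by simp
      from grid_bounded_imp_uniform_bound[OF qm Hl c2 up assms(32) _ \<delta> u0 A(2) A(1) this]
      show ?case unfolding K by simp
    qed
  qed

  have concl: "AE \<omega> in M. uniform_limit K (\<lambda>N. ?SN N \<omega>) (?Sl \<omega>) sequentially \<and>
      ?Sl \<omega> \<in> holder_log \<rho>t K \<beta> (max \<eta> 0 + 1 / 2) \<and>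
      (SUP N::nat. ennreal (real N powr \<gamma>) *
         (SUP u\<in>K. ennreal (cmod (?Sl \<omega> u - ?SN N \<omega> u)))) < \<infinity>"
    if \<gamma>: "0 < \<gamma>" "\<gamma> < 1 / b - 1 / (2 * q)" for \<gamma>
    using core[OF \<gamma>]
  proof eventually_elim
    case (elim \<omega>)
    define x where "x n u = complex_of_real (T n \<omega> powr (- 1 / \<alpha> u)) * f (\<alpha> u) u (\<xi> n \<omega>)
        * complex_of_real (m (\<xi> n \<omega>) powr (- 1 / \<alpha> u)) * g n \<omega>" for n u
    have S: "?SN N \<omega> = (\<lambda>u. \<Sum>n=1..N. x n u)" for N
      by (simp add: S_partial_def x_def fun_eq_iff)
    have coef_x: "?cf \<gamma> \<omega> n u * g n \<omega> = of_real (real n powr \<gamma>) * x n u" for n u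
      by (simp add: weighted_coef_def x_def V_field_def mult_ac)
    from elim obtain B where B: "0 < B"
      "\<And>N u. u \<in> K \<Longrightarrow> cmod (\<Sum>n=1..N. of_real (real n powr \<gamma>) * x n u) \<le> B"
      "\<And>N u v. u \<in> K \<Longrightarrow> v \<in> K \<Longrightarrow>
         cmod ((\<Sum>n=1..N. of_real (real n powr \<gamma>) * x n u) - (\<Sum>n=1..N. of_real (real n powr \<gamma>) * x n v))
           \<le> B * ?h' u v"
      unfolding coef_x by blast
    have l: "?Sl \<omega> u = lim (\<lambda>N. \<Sum>n=1..N. x n u)" if "convergent (\<lambda>N. \<Sum>n=1..N. x n u)" for u
      using that by (simp add: S_limit_def S)
    note res = weighted_sums_bounded_imp_convergence[where x = x and l = "?Sl \<omega>"
        and h = "\<lambda>u v. ?h' u v" and K = K and B = B, OF \<gamma>(1) B(2) B(3) l]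
    have "?Sl \<omega> \<in> holder_log \<rho>t K \<beta> (max \<eta> 0 + 1 / 2)"
      unfolding holder_log_def
      using B(1) res(2) by (auto simp: log_power_def mult.assoc intro!: exI[of _ "2 * B"])
    moreover have "(SUP N::nat. ennreal (real N powr \<gamma>) *
         (SUP u\<in>K. ennreal (cmod (?Sl \<omega> u - ?SN N \<omega> u)))) \<le> ennreal (2 * B)"
    proof (rule SUP_least)
      fix N :: nat
      have "ennreal (real N powr \<gamma>) *
         (SUP u\<in>K. ennreal (cmod (?Sl \<omega> u - ?SN N \<omega> u)))
         \<le> ennreal (real N powr \<gamma>) * ennreal (2 * B * real (Suc N) powr - \<gamma>)"
        using res(3) unfolding S by (intro mult_left_mono SUP_least ennreal_leI) auto
      also have "\<dots> = ennreal (2 * B * (real N powr \<gamma> * real (Suc N) powr - \<gamma>))"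
        using B(1) by (simp add: ennreal_mult'[symmetric] mult_ac)
      also have "\<dots> \<le> ennreal (2 * B * 1)"
      proof (intro ennreal_leI mult_left_mono)
        have "real N powr \<gamma> * real (Suc N) powr - \<gamma> \<le> real (Suc N) powr \<gamma> * real (Suc N) powr - \<gamma>"
          using \<gamma> by (intro mult_right_mono powr_mono2) auto
        also have "\<dots> = 1" by (simp add: powr_minus)
        finally show "real N powr \<gamma> * real (Suc N) powr - \<gamma> \<le> 1" .
      qed (use B(1) in auto)
      finally show "ennreal (real N powr \<gamma>) *
         (SUP u\<in>K. ennreal (cmod (?Sl \<omega> u - ?SN N \<omega> u))) \<le> ennreal (2 * B)" by simp
    qed
    ultimately show ?case
      using res(1) unfolding S by (auto intro: le_less_trans)
  qed

  \<comment> \<open>The first two claims need one admissible exponent, whichever it is.\<close>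
  define \<gamma>0 where "\<gamma>0 = (1 / b - 1 / (2 * q)) / 2"
  have "1 / (2 * q) < 1 / b" using q(3) b0 by (intro divide_strict_left_mono) auto
  hence \<gamma>0: "0 < \<gamma>0" "\<gamma>0 < 1 / b - 1 / (2 * q)" by (auto simp: \<gamma>0_def)
  show ?thesis
  proof (intro conjI allI impI)
    show "AE \<omega> in M. uniform_limit K (\<lambda>N. ?SN N \<omega>) (?Sl \<omega>) sequentially"
      using concl[OF \<gamma>0] by eventually_elim blast
    show "AE \<omega> in M. ?Sl \<omega> \<in> holder_log \<rho>t K \<beta> (max \<eta> 0 + 1 / 2)"
      using concl[OF \<gamma>0] by eventually_elim blast
    fix p' :: real assume p': "0 < p'" "1 / p' \<in> {0<..<1 / b - 1 / min (2 * p) 2}"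
    have "0 < 1 / p'" "1 / p' < 1 / b - 1 / (2 * q)" using p' q(2) by auto
    from concl[OF this] show "AE \<omega> in M. (SUP N::nat. ennreal (real N powr (1 / p')) *
         (SUP u\<in>K. ennreal (cmod (?Sl \<omega> u - ?SN N \<omega> u)))) < \<infinity>"
      by eventually_elim blast
  qed
qed

end
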